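(* Let $d\ge 1$. Directional ergodicity and directional weak mixing of $\mathbb{Z}^d$-actions are spectral properties, i.e. they depend only on the reduced spectral measure: if $T$ and $S$ are $\mathbb{Z}^d$-actions whose reduced spectral measures $\sigma_0^T$ and $\sigma_0^S$ on $\mathbb{T}^d$ are equivalent (mutually absolutely continuous), then $\mathcal{E}_T=\mathcal{E}_S$ and $\mathcal{W}_T=\mathcal{W}_S$. It follows that directional ergodicity and directional weak mixing are isomorphism invariants: if $T$ and $S$ are metrically isomorphic $\mathbb{Z}^d$-actions, then $\mathcal{E}_T=\mathcal{E}_S$ and $\mathcal{W}_T=\mathcal{W}_S$.
   Context: All actions are free measurable measure preserving actions on Lebesgue probability spaces. Write $\mathbb{G}_{e,d}$ ($0\le e\le d$) for the set of $e$-dimensional linear subspaces of $\mathbb{R}^d$ and $\mathbb{G}_d=\bigcup_{e=0}^d\mathbb{G}_{e,d}$. Reduced spectral measure. For a $\mathbb{Z}^d$-action $T$ on $(X,\mu)$ and $f\in L^2(X,\mu)$, the spectral measure $\sigma_f$ is the unique finite Borel measure on $\widehat{\mathbb{Z}^d}=\mathbb{T}^d=\mathbb{R}^d/\mathbb{Z}^d$ (where $\vec a\in\mathbb{T}^d$ is the character $\vec n\mapsto e^{2\pi i\vec a\cdot\vec n}$) with $\int_X f(T^{\vec n}x)\overline{f(x)}\,d\mu=\int_{\mathbb{T}^d}e^{-2\pi i\vec a\cdot\vec n}\,d\sigma_f(\vec a)$ for all $\vec n\in\mathbb{Z}^d$. Let $L^2_0(X,\mu)$ be the orthogonal complement of the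 constants. The reduced spectral measure $\sigma_0^T$ is $\sigma_{f_0}$ for any $f_0\in L^2_0(X,\mu)$ such that $\sigma_f\ll\sigma_{f_0}$ for all $f\in L_0^2(X,\mu)$; it is well defined up to equivalence of measures. Unit suspension. $\widetilde T$ is the $\mathbb{R}^d$-action on $(\widetilde X,\tilde\mu)=(X\times[0,1)^d,\mu\times\lambda)$, $\lambda$ Lebesgue measure, given by $\widetilde T^{\vec t}(x,\vec r)=(T^{\lfloor\vec t+\vec r\rfloor}x,\{\vec t+\vec r\})$, with componentwise integer part $\lfloor\cdot\rfloor$ and fractional part $\{\cdot\}$. Let $\mathcal{O}=\{F(x,\vec s)=f(\vec s): f\in L^2([0,1)^d,\lambda)\}\subseteq L^2(\widetilde X,\tilde\mu)$ and $L^2_{\mathcal{O}}(\widetilde X,\tilde\mu)=\mathcal{O}^\perp$. Directional properties of a $\mathbb{Z}^d$-action. Let $L\in\mathbb{G}_{e,d}$ with $1\le e\le d$. A nonzero $F\in L^2(\widetilde X,\tilde\mu)$ is a direction $L$ eigenfunction of $\widetilde T$ if for some $\vec\ell\in L$ one has $F(\widetilde T^{\vec t}y)=e^{2\pi i\vec\ell\cdot\vec t}F(y)$ for all $\vec t\in L$ and a.e. $y$; it is direction $L$ invariant if this holds with $\vec\ell=\vec 0$. $T$ is ergodic in the direction $L$ if $\widetilde T$ has no nonzero direction $L$ invariant function in $L^2_{\mathcal{O}}(\widetilde X,\tilde\mu)$; $T$ is weak mixing in the direction $L$ if $\widetilde T$ has no nonzero direction $L$ eigenfunction in $L^2_{\mathcal{O}}(\widetilde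 X,\tilde\mu)$. $\mathcal{E}_T$ and $\mathcal{W}_T$ denote the sets of ergodic and of weak mixing directions $L$ of $T$. *)

theory Defs
  imports "HOL-Probability.Probability"
begin

section \<open>The torus and its characters\<close>

definition int_congruent :: "real ^ 'd \<Rightarrow> real ^ 'd \<Rightarrow> bool" where
  "int_congruent a b \<longleftrightarrow> (\<forall>i. a $ i - b $ i \<in> \<int>)"

lemma equivp_int_congruent: "equivp (int_congruent :: real ^ 'd \<Rightarrow> real ^ 'd \<Rightarrow> bool)"
proof (rule equivpI)
  show "reflp (int_congruent :: real ^ 'd \<Rightarrow> real ^ 'd \<Rightarrow> bool)"
    by (simp add: reflp_def int_congruent_def)
  show "symp (int_congruent :: real ^ 'd \<Rightarrow> real ^ 'd \<Rightarrow> bool)"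
    unfolding symp_def int_congruent_def by (metis Ints_minus minus_diff_eq)
  show "transp (int_congruent :: real ^ 'd \<Rightarrow> real ^ 'd \<Rightarrow> bool)"
    unfolding transp_def int_congruent_def by (metis Ints_add diff_add_cancel add_diff_eq)
qed

quotient_type 'd torus = "real ^ 'd" / "int_congruent :: real ^ 'd \<Rightarrow> real ^ 'd \<Rightarrow> bool"
  by (rule equivp_int_congruent)

text \<open>The quotient topology; \<open>borel :: 'd torus measure\<close> is its Borel \<open>\<sigma>\<close>-algebra.\<close>

instantiation torus :: (finite) topological_space
begin

definition open_torus :: "'a torus set \<Rightarrow> bool" where
  "open_torus U \<longleftrightarrow> open (abs_torus -` U)"

instance
  by standard (auto simp: open_torus_def vimage_Int vimage_Union)

end

lift_definition torus_char :: "'d::finite torus \<Rightarrow> int ^ 'd \<Rightarrow> complex"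
  is "\<lambda>a n. cis (2 * pi * (\<Sum>i\<in>UNIV. a $ i * of_int (n $ i)))"
proof
  fix a b :: "real ^ 'd" and n :: "int ^ 'd"
  assume "int_congruent a b"
  then have "(\<Sum>i\<in>UNIV. (a $ i - b $ i) * of_int (n $ i)) \<in> \<int>"
    unfolding int_congruent_def by (intro Ints_sum Ints_mult) auto
  moreover have "(\<Sum>i\<in>UNIV. (a $ i - b $ i) * of_int (n $ i)) =
      (\<Sum>i\<in>UNIV. a $ i * of_int (n $ i)) - (\<Sum>i\<in>UNIV. b $ i * of_int (n $ i))"
    by (simp add: left_diff_distrib sum_subtractf)
  ultimately obtain k :: int where
    "(\<Sum>i\<in>UNIV. a $ i * of_int (n $ i)) = (\<Sum>i\<in>UNIV. b $ i * of_int (n $ i)) + of_int k"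
    by (metis Ints_cases add.commute diff_add_cancel)
  then show "cis (2 * pi * (\<Sum>i\<in>UNIV. a $ i * of_int (n $ i))) =
      cis (2 * pi * (\<Sum>i\<in>UNIV. b $ i * of_int (n $ i)))"
    by (simp add: distrib_left flip: cis_mult)
qed

section \<open>Lebesgue spaces and actions\<close>

definition iso_mod0 :: "'a measure \<Rightarrow> 'b measure \<Rightarrow> 'a set \<Rightarrow> 'b set \<Rightarrow> ('a \<Rightarrow> 'b) \<Rightarrow> bool" where
  "iso_mod0 M N A B \<phi> \<longleftrightarrow>
     A \<in> sets M \<and> space M - A \<in> null_sets M \<and>
     B \<in> sets N \<and> space N - B \<in> null_sets N \<and>
     bij_betw \<phi> A B \<and>
     \<phi> \<in> measurable (restrict_space M A) (restrict_space N B) \<and>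
     the_inv_into A \<phi> \<in> measurable (restrict_space N B) (restrict_space M A) \<and>
     distr (restrict_space M A) (restrict_space N B) \<phi> = restrict_space N B"

text \<open>Atoms need not be allowed for: a free measure preserving action of \<open>\<int>\<^sup>d\<close>, \<open>d \<ge> 1\<close>, on a
  probability space that is a union of an interval and countably many atoms has no atoms.\<close>

definition lebesgue_prob_space :: "'a measure \<Rightarrow> bool" where
  "lebesgue_prob_space M \<longleftrightarrow> prob_space M \<and> complete_measure M \<and>
     (\<exists>A B \<phi>. iso_mod0 M (lebesgue_on {0..1::real}) A B \<phi>)"

definition mp_action :: "'a measure \<Rightarrow> (int ^ 'd \<Rightarrow> 'a \<Rightarrow> 'a) \<Rightarrow> bool" where
  "mp_action M T \<longleftrightarrow>
     (\<forall>n. T n \<in> measurable M M \<and> distr M M (T n) = M) \<and>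
     (\<forall>x\<in>space M. T 0 x = x) \<and>
     (\<forall>m n. \<forall>x\<in>space M. T (m + n) x = T m (T n x))"

definition free_mp_action :: "'a measure \<Rightarrow> (int ^ 'd \<Rightarrow> 'a \<Rightarrow> 'a) \<Rightarrow> bool" where
  "free_mp_action M T \<longleftrightarrow> mp_action M T \<and> (\<forall>n. n \<noteq> 0 \<longrightarrow> (AE x in M. T n x \<noteq> x))"

definition metrically_isomorphic ::
  "'a measure \<Rightarrow> (int ^ 'd \<Rightarrow> 'a \<Rightarrow> 'a) \<Rightarrow> 'b measure \<Rightarrow> (int ^ 'd \<Rightarrow> 'b \<Rightarrow> 'b) \<Rightarrow> bool" where
  "metrically_isomorphic M T N S \<longleftrightarrow>
     (\<exists>A B \<phi>. iso_mod0 M N A B \<phi> \<and>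
        (\<forall>n. \<forall>x\<in>A. T n x \<in> A) \<and> (\<forall>n. \<forall>y\<in>B. S n y \<in> B) \<and>
        (\<forall>n. \<forall>x\<in>A. \<phi> (T n x) = S n (\<phi> x)))"

section \<open>Square integrable functions and the reduced spectral measure\<close>

text \<open>Elements of \<open>L\<^sup>2\<close> are represented by functions, so ``nonzero'' means not a.e. zero.\<close>

definition L2 :: "'a measure \<Rightarrow> ('a \<Rightarrow> complex) set" where
  "L2 M = {f \<in> borel_measurable M. integrable M (\<lambda>x. (cmod (f x))\<^sup>2)}"

definition L2_inner :: "'a measure \<Rightarrow> ('a \<Rightarrow> complex) \<Rightarrow> ('a \<Rightarrow> complex) \<Rightarrow> complex" where
  "L2_inner M f g = (\<integral>x. f x * cnj (g x) \<partial>M)"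

definition L2_orth :: "'a measure \<Rightarrow> ('a \<Rightarrow> complex) set \<Rightarrow> ('a \<Rightarrow> complex) set" where
  "L2_orth M A = {f \<in> L2 M. \<forall>g\<in>A. L2_inner M f g = 0}"

definition L2_0 :: "'a measure \<Rightarrow> ('a \<Rightarrow> complex) set" where
  "L2_0 M = L2_orth M {\<lambda>x. c | c. True}"

definition spectral_measure ::
  "'a measure \<Rightarrow> (int ^ 'd \<Rightarrow> 'a \<Rightarrow> 'a) \<Rightarrow> ('a \<Rightarrow> complex) \<Rightarrow> 'd::finite torus measure \<Rightarrow> bool" where
  "spectral_measure M T f \<sigma> \<longleftrightarrow> finite_measure \<sigma> \<and> sets \<sigma> = sets borel \<and>
     (\<forall>n. (\<integral>x. f (T n x) * cnj (f x) \<partial>M) = (\<integral>a. torus_char a (- n) \<partial>\<sigma>))"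

text \<open>Every \<open>f\<close> in \<open>L\<^sup>2\<close> has exactly one spectral measure (Herglotz--Bochner), so the inner existential
  is just a way to speak about the spectral measure of \<open>f\<close>.  Note that
  \<open>absolutely_continuous \<sigma> \<tau>\<close> means \<open>\<tau> \<lless> \<sigma>\<close>.\<close>

definition reduced_spectral_measure ::
  "'a measure \<Rightarrow> (int ^ 'd \<Rightarrow> 'a \<Rightarrow> 'a) \<Rightarrow> 'd::finite torus measure \<Rightarrow> bool" where
  "reduced_spectral_measure M T \<sigma> \<longleftrightarrow>
     (\<exists>f0\<in>L2_0 M. spectral_measure M T f0 \<sigma> \<and>
        (\<forall>f\<in>L2_0 M. \<exists>\<tau>. spectral_measure M T f \<tau> \<and> absolutely_continuous \<sigma> \<tau>))"

definition equivalent_measures :: "'a measure \<Rightarrow> 'a measure \<Rightarrow> bool" where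
  "equivalent_measures \<sigma> \<tau> \<longleftrightarrow> absolutely_continuous \<sigma> \<tau> \<and> absolutely_continuous \<tau> \<sigma>"

section \<open>The unit suspension and directional properties\<close>

definition unit_cube :: "(real ^ 'd) measure" where
  "unit_cube = restrict_space lborel {r. \<forall>i. 0 \<le> r $ i \<and> r $ i < 1}"

text \<open>The product is left uncompleted; the completion has the same \<open>L\<^sup>2\<close> up to a.e. equality.\<close>

definition suspension_space :: "'a measure \<Rightarrow> ('a \<times> (real ^ 'd)) measure" where
  "suspension_space M = M \<Otimes>\<^sub>M unit_cube"

definition suspension ::
  "(int ^ 'd \<Rightarrow> 'a \<Rightarrow> 'a) \<Rightarrow> real ^ 'd \<Rightarrow> 'a \<times> (real ^ 'd) \<Rightarrow> 'a \<times> (real ^ 'd)" where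
  "suspension T t = (\<lambda>(x, r). (T (\<chi> i. \<lfloor>t $ i + r $ i\<rfloor>) x, \<chi> i. frac (t $ i + r $ i)))"

definition fibre_functions :: "('a \<times> (real ^ 'd) \<Rightarrow> complex) set" where
  "fibre_functions = {\<lambda>(x, s). f s | f. f \<in> L2 unit_cube}"

definition L2_O :: "'a measure \<Rightarrow> ('a \<times> (real ^ 'd) \<Rightarrow> complex) set" where
  "L2_O M = L2_orth (suspension_space M) fibre_functions"

definition grassmannian :: "nat \<Rightarrow> (real ^ 'd) set set" where
  "grassmannian e = {L. subspace L \<and> dim L = e}"

definition direction_eigenvalue ::
  "'a measure \<Rightarrow> (int ^ 'd \<Rightarrow> 'a \<Rightarrow> 'a) \<Rightarrow> (real ^ 'd) set \<Rightarrow> real ^ 'd \<Rightarrow>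
    ('a \<times> (real ^ 'd) \<Rightarrow> complex) \<Rightarrow> bool" where
  "direction_eigenvalue M T L l F \<longleftrightarrow>
     F \<in> L2 (suspension_space M) \<and> \<not> (AE y in suspension_space M. F y = 0) \<and>
     (\<forall>t\<in>L. AE y in suspension_space M. F (suspension T t y) = cis (2 * pi * (l \<bullet> t)) * F y)"

definition direction_eigenfunction ::
  "'a measure \<Rightarrow> (int ^ 'd \<Rightarrow> 'a \<Rightarrow> 'a) \<Rightarrow> (real ^ 'd) set \<Rightarrow> ('a \<times> (real ^ 'd) \<Rightarrow> complex) \<Rightarrow> bool" where
  "direction_eigenfunction M T L F \<longleftrightarrow> (\<exists>l\<in>L. direction_eigenvalue M T L l F)"

definition direction_invariant ::
  "'a measure \<Rightarrow> (int ^ 'd \<Rightarrow> 'a \<Rightarrow> 'a) \<Rightarrow> (real ^ 'd) set \<Rightarrow> ('a \<times> (real ^ 'd) \<Rightarrow> complex) \<Rightarrow> bool" where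
  "direction_invariant M T L F \<longleftrightarrow> direction_eigenvalue M T L 0 F"

definition ergodic_directions ::
  "'a measure \<Rightarrow> (int ^ 'd \<Rightarrow> 'a \<Rightarrow> 'a) \<Rightarrow> (real ^ 'd) set set" where
  "ergodic_directions M T =
     {L \<in> (\<Union>e\<in>{1..CARD('d)}. grassmannian e). \<not> (\<exists>F\<in>L2_O M. direction_invariant M T L F)}"

definition weak_mixing_directions ::
  "'a measure \<Rightarrow> (int ^ 'd \<Rightarrow> 'a \<Rightarrow> 'a) \<Rightarrow> (real ^ 'd) set set" where
  "weak_mixing_directions M T =
     {L \<in> (\<Union>e\<in>{1..CARD('d)}. grassmannian e). \<not> (\<exists>F\<in>L2_O M. direction_eigenfunction M T L F)}"

end

theory Submission
  imports Defs
begin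

text \<open>
  The proof identifies directional eigenfunctions in the spectral model of the action.  Let \<open>f\<close> be a mean
  zero function on \<open>X\<close> with spectral measure \<open>\<sigma>\<close>.  Sending the character with index \<open>- n\<close>
  times \<open>\<phi>(r)\<close> to \<open>f(T n x) \<phi>(r)\<close> defines an isometry from \<open>L\<^sup>2\<close> of the torus times the cube, with measure
  \<open>\<sigma> \<times> \<lambda>\<close>, onto the cyclic space of \<open>f\<close> in \<open>L\<^sup>2\<close> of the suspension.  It intertwines the suspension
  flow with the explicit operators \<open>twist t\<close>, in which \<open>T\<close> occurs only through characters.  Hence
  a directional eigenfunction in the cyclic space is the same thing as an eigenfunction of the operators
  \<open>twist t\<close>, and these do not depend on the action.

  Two facts then suffice.  First, the orthogonal projection to a cyclic space maps eigenfunctions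
  to eigenfunctions (\<open>isom_project\<close>, \<open>isom_eigen_of_projection\<close>), and a nonzero element of \<open>L2_O\<close> has a nonzero
  projection to the cyclic space of some centred indicator function (\<open>L2_O_centred_indicator\<close>).
  Secondly, the operators \<open>twist t\<close> commute with multiplication by functions of the torus
  variable.  So an eigenfunction for a measure \<open>\<rho>\<close> that is absolutely continuous with respect to \<open>\<tau>\<close> becomes
  one for \<open>\<tau>\<close>, with the same eigenvalue, when multiplied by the square root of the density
  (\<open>twist_transport\<close>).  If \<open>\<tau>\<close> is a reduced spectral measure of \<open>S\<close>, it is the spectral measure of some mean
  zero function, and its cyclic space turns the result into a directional eigenfunction of \<open>S\<close>.

  The isometry is first given on trigonometric polynomials with coefficients that are bounded functions on
  the cube.  Extending it to all of \<open>L\<^sup>2\<close> uses the completeness of \<open>L\<^sup>2\<close> and the density of these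
  functions (\<open>isom_total\<close>), which comes from the Weierstrass theorem and the fact that
  the coordinate characters generate the Borel sets of the torus.

  For isomorphic actions an eigenfunction is carried over directly (\<open>isomorphic_transfer\<close>).
\<close>

section \<open>Square integrable functions\<close>

lemma borel_measurable_cnj [measurable (raw)]:
  "f \<in> borel_measurable M \<Longrightarrow> (\<lambda>x. cnj (f x)) \<in> borel_measurable M"
  using borel_measurable_continuous_onI[OF continuous_on_cnj[OF continuous_on_id]]
  by (rule measurable_compose[rotated])

definition L2_norm :: "'a measure \<Rightarrow> ('a \<Rightarrow> complex) \<Rightarrow> real" where
  "L2_norm M f = sqrt (\<integral>x. (cmod (f x))\<^sup>2 \<partial>M)"

lemma L2_D:
  assumes "f \<in> L2 M"
  shows "f \<in> borel_measurable M" "integrable M (\<lambda>x. (cmod (f x))\<^sup>2)"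
  using assms by (auto simp: L2_def)

lemma L2_bounded_by_L2:
  assumes g: "g \<in> borel_measurable M" and f: "f \<in> L2 M"
    and le: "\<And>x. x \<in> space M \<Longrightarrow> cmod (g x) \<le> C * cmod (f x)"
  shows "g \<in> L2 M"
proof -
  have "integrable M (\<lambda>x. C\<^sup>2 * (cmod (f x))\<^sup>2)"
    using L2_D[OF f] by simp
  then have "integrable M (\<lambda>x. (cmod (g x))\<^sup>2)"
  proof (rule Bochner_Integration.integrable_bound)
    show "AE x in M. norm ((cmod (g x))\<^sup>2) \<le> norm (C\<^sup>2 * (cmod (f x))\<^sup>2)"
      using power_mono[OF le, of _ 2] by (intro AE_I2) (simp add: power_mult_distrib)
  qed (use g in measurable)
  with g show ?thesis
    by (simp add: L2_def)
qed

lemma L2_scale: "f \<in> L2 M \<Longrightarrow> (\<lambda>x. c * f x) \<in> L2 M"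
  by (rule L2_bounded_by_L2[of _ _ f "cmod c"]) (auto dest: L2_D simp: norm_mult)

lemma L2_add:
  assumes "f \<in> L2 M" "g \<in> L2 M"
  shows "(\<lambda>x. f x + g x) \<in> L2 M"
proof -
  have [measurable]: "f \<in> borel_measurable M" "g \<in> borel_measurable M"
    using assms by (auto dest: L2_D)
  have "integrable M (\<lambda>x. 2 * (cmod (f x))\<^sup>2 + 2 * (cmod (g x))\<^sup>2)"
    using L2_D(2)[OF assms(1)] L2_D(2)[OF assms(2)] by simp
  then have "integrable M (\<lambda>x. (cmod (f x + g x))\<^sup>2)"
  proof (rule Bochner_Integration.integrable_bound)
    have "(cmod (a + b))\<^sup>2 \<le> 2 * (cmod a)\<^sup>2 + 2 * (cmod b)\<^sup>2" for a b :: complex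
      using power_mono[OF norm_triangle_ineq[of a b], of 2] sum_squares_bound[of "cmod a" "cmod b"]
      by (simp add: power2_sum)
    then show "AE x in M. norm ((cmod (f x + g x))\<^sup>2) \<le> norm (2 * (cmod (f x))\<^sup>2 + 2 * (cmod (g x))\<^sup>2)"
      by (intro AE_I2) simp
  qed measurable
  then show ?thesis
    by (simp add: L2_def)
qed

lemma L2_diff:
  assumes "f \<in> L2 M" "g \<in> L2 M"
  shows "(\<lambda>x. f x - g x) \<in> L2 M"
  using L2_add[OF assms(1) L2_scale[OF assms(2), of "-1"]] by simp

lemma L2_integrable_mult:
  assumes "f \<in> L2 M" "g \<in> L2 M"
  shows "integrable M (\<lambda>x. f x * cnj (g x))"
proof -
  have [measurable]: "f \<in> borel_measurable M" "g \<in> borel_measurable M"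
    using assms by (auto dest: L2_D)
  have "integrable M (\<lambda>x. (cmod (f x))\<^sup>2 + (cmod (g x))\<^sup>2)"
    using L2_D(2)[OF assms(1)] L2_D(2)[OF assms(2)] by simp
  then show ?thesis
  proof (rule Bochner_Integration.integrable_bound)
    have "cmod (a * cnj b) \<le> (cmod a)\<^sup>2 + (cmod b)\<^sup>2" for a b :: complex
    proof -
      have "0 \<le> cmod a * cmod b" by simp
      then have "cmod a * cmod b \<le> 2 * cmod a * cmod b" by simp
      also have "\<dots> \<le> (cmod a)\<^sup>2 + (cmod b)\<^sup>2" by (rule sum_squares_bound)
      finally show ?thesis by (simp add: norm_mult)
    qed
    then show "AE x in M. norm (f x * cnj (g x)) \<le> norm ((cmod (f x))\<^sup>2 + (cmod (g x))\<^sup>2)"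
      by (intro AE_I2) simp
  qed measurable
qed

lemma L2_bounded:
  assumes "finite_measure M" "f \<in> borel_measurable M" "\<And>x. x \<in> space M \<Longrightarrow> cmod (f x) \<le> C"
  shows "f \<in> L2 M"
proof (rule L2_bounded_by_L2[of _ _ "\<lambda>_. 1" C])
  interpret finite_measure M by fact
  show "(\<lambda>_. 1) \<in> L2 M" by (simp add: L2_def)
qed (use assms in auto)

lemma L2_norm_nonneg [simp]: "0 \<le> L2_norm M f"
  by (simp add: L2_norm_def)

lemma L2_norm_power2: "(L2_norm M f)\<^sup>2 = (\<integral>x. (cmod (f x))\<^sup>2 \<partial>M)"
  by (simp add: L2_norm_def)

lemma L2_inner_self: "L2_inner M f f = of_real ((L2_norm M f)\<^sup>2)"
  unfolding L2_inner_def L2_norm_power2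
  by (subst integral_complex_of_real[symmetric]) (simp only: complex_norm_square)

lemma L2_norm_cong_AE:
  assumes "AE x in M. f x = g x" "f \<in> borel_measurable M" "g \<in> borel_measurable M"
  shows "L2_norm M f = L2_norm M g"
  unfolding L2_norm_def using assms by (intro arg_cong[where f=sqrt] integral_cong_AE) auto

lemma L2_norm_cong:
  assumes "\<And>x. x \<in> space M \<Longrightarrow> f x = g x"
  shows "L2_norm M f = L2_norm M g"
  unfolding L2_norm_def using assms by (simp cong: Bochner_Integration.integral_cong)

lemma L2_norm_scale: "L2_norm M (\<lambda>x. c * f x) = cmod c * L2_norm M f"
  unfolding L2_norm_def by (simp add: norm_mult power_mult_distrib real_sqrt_mult)

lemma L2_norm_minus_commute: "L2_norm M (\<lambda>x. f x - g x) = L2_norm M (\<lambda>x. g x - f x)"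
  by (simp add: L2_norm_def norm_minus_commute)

lemma L2_norm_eq_0_iff:
  assumes "f \<in> L2 M"
  shows "L2_norm M f = 0 \<longleftrightarrow> (AE x in M. f x = 0)"
proof -
  have "L2_norm M f = 0 \<longleftrightarrow> (\<integral>x. (cmod (f x))\<^sup>2 \<partial>M) = 0"
    by (simp add: L2_norm_def)
  also have "\<dots> \<longleftrightarrow> (AE x in M. (cmod (f x))\<^sup>2 = 0)"
    using L2_D[OF assms] by (intro integral_nonneg_eq_0_iff_AE) auto
  finally show ?thesis by simp
qed

lemma L2_inner_add_left:
  assumes "f \<in> L2 M" "g \<in> L2 M" "h \<in> L2 M"
  shows "L2_inner M (\<lambda>x. f x + g x) h = L2_inner M f h + L2_inner M g h"
  unfolding L2_inner_def using L2_integrable_mult[OF assms(1,3)] L2_integrable_mult[OF assms(2,3)]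
  by (simp add: distrib_right)

lemma L2_inner_commute: "L2_inner M g f = cnj (L2_inner M f g)"
proof -
  have "L2_inner M g f = (\<integral>x. cnj (f x * cnj (g x)) \<partial>M)"
    by (simp add: L2_inner_def mult.commute del: Bochner_Integration.integral_cnj)
  then show ?thesis
    by (simp only: Bochner_Integration.integral_cnj L2_inner_def)
qed

lemma L2_inner_scale_left: "L2_inner M (\<lambda>x. c * f x) h = c * L2_inner M f h"
  unfolding L2_inner_def by (simp add: mult.assoc)

lemma L2_inner_add_right:
  assumes "f \<in> L2 M" "g \<in> L2 M" "h \<in> L2 M"
  shows "L2_inner M h (\<lambda>x. f x + g x) = L2_inner M h f + L2_inner M h g"
  using L2_inner_add_left[OF assms] by (metis L2_inner_commute complex_cnj_add)

lemma L2_inner_diff_left: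
  assumes "f \<in> L2 M" "g \<in> L2 M" "h \<in> L2 M"
  shows "L2_inner M (\<lambda>x. f x - g x) h = L2_inner M f h - L2_inner M g h"
  using L2_inner_add_left[OF assms(1) L2_scale[OF assms(2), of "-1"] assms(3)]
    L2_inner_scale_left[of M "-1" g h] by simp

lemma L2_norm_add_power2:
  assumes "f \<in> L2 M" "g \<in> L2 M"
  shows "(L2_norm M (\<lambda>x. f x + g x))\<^sup>2 = (L2_norm M f)\<^sup>2 + (L2_norm M g)\<^sup>2 + 2 * Re (L2_inner M f g)"
proof -
  note i = L2_D(2)[OF assms(1)] L2_D(2)[OF assms(2)] L2_integrable_mult[OF assms]
  define r where "r x = Re (f x * cnj (g x))" for x
  have r: "integrable M r" "(\<integral>x. r x \<partial>M) = Re (L2_inner M f g)"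
    unfolding r_def L2_inner_def by (rule integrable_Re[OF i(3)], rule integral_Re[OF i(3)])
  have "(cmod (f x + g x))\<^sup>2 = (cmod (f x))\<^sup>2 + (cmod (g x))\<^sup>2 + 2 * r x" for x
    unfolding cmod_power2 r_def by (simp add: power2_eq_square algebra_simps)
  then show ?thesis
    unfolding L2_norm_power2 using i r by simp
qed

lemma L2_norm_diff_power2:
  assumes "f \<in> L2 M" "g \<in> L2 M"
  shows "(L2_norm M (\<lambda>x. f x - g x))\<^sup>2 = (L2_norm M f)\<^sup>2 + (L2_norm M g)\<^sup>2 - 2 * Re (L2_inner M f g)"
proof -
  have "Re (L2_inner M f (\<lambda>x. - 1 * g x)) = - Re (L2_inner M f g)"
    by (subst (1 2) L2_inner_commute) (simp only: L2_inner_scale_left, simp)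
  then show ?thesis
    using L2_norm_add_power2[OF assms(1) L2_scale[OF assms(2), of "-1"]]
      L2_norm_scale[of M "-1" g] by simp
qed

lemma L2_parallelogram:
  assumes "f \<in> L2 M" "g \<in> L2 M"
  shows "(L2_norm M (\<lambda>x. f x + g x))\<^sup>2 + (L2_norm M (\<lambda>x. f x - g x))\<^sup>2 =
    2 * (L2_norm M f)\<^sup>2 + 2 * (L2_norm M g)\<^sup>2"
  using L2_norm_add_power2[OF assms] L2_norm_diff_power2[OF assms] by simp

text \<open>The vector \<open>\<langle>g,g\<rangle>f - \<langle>f,g\<rangle>g\<close> has nonnegative square norm, which is the inequality
  multiplied by \<open>\<langle>g,g\<rangle>\<close>.\<close>

lemma L2_Cauchy_Schwarz:
  assumes f: "f \<in> L2 M" and g: "g \<in> L2 M"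
  shows "cmod (L2_inner M f g) \<le> L2_norm M f * L2_norm M g"
proof (cases "L2_norm M g = 0")
  case True
  have "AE x in M. f x * cnj (g x) = 0"
    using L2_norm_eq_0_iff[OF g] True by auto
  then have "L2_inner M f g = 0"
    unfolding L2_inner_def by (rule integral_eq_zero_AE)
  then show ?thesis by simp
next
  case False
  define B where "B = (L2_norm M g)\<^sup>2"
  define c where "c = L2_inner M f g"
  have B: "B > 0" and gB: "(L2_norm M g)\<^sup>2 = B" using False by (simp_all add: B_def)
  have "0 \<le> (L2_norm M (\<lambda>x. of_real B * f x - c * g x))\<^sup>2" by simp
  also have "\<dots> = B\<^sup>2 * (L2_norm M f)\<^sup>2 + (cmod c)\<^sup>2 * B
      - 2 * Re (L2_inner M (\<lambda>x. of_real B * f x) (\<lambda>x. c * g x))"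
    using L2_norm_diff_power2[OF L2_scale[OF f, of "of_real B"] L2_scale[OF g, of c]] B
    by (simp add: L2_norm_scale power_mult_distrib gB)
  also have "L2_inner M (\<lambda>x. of_real B * f x) (\<lambda>x. c * g x) = of_real B * (cnj c * c)"
    by (simp add: L2_inner_scale_left)
      (subst L2_inner_commute, simp add: L2_inner_scale_left, subst L2_inner_commute, simp add: c_def)
  also have "Re \<dots> = B * (cmod c)\<^sup>2"
    unfolding cmod_power2 by (simp add: power2_eq_square)
  finally have "B * (cmod c)\<^sup>2 \<le> B * (B * (L2_norm M f)\<^sup>2)"
    by (simp add: power2_eq_square algebra_simps)
  then have "(cmod c)\<^sup>2 \<le> (L2_norm M f * L2_norm M g)\<^sup>2"
    using B by (simp add: B_def power_mult_distrib mult.commute)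
  then show ?thesis
    unfolding c_def by (rule power2_le_imp_le) simp
qed

lemma L2_norm_triangle:
  assumes "f \<in> L2 M" "g \<in> L2 M"
  shows "L2_norm M (\<lambda>x. f x + g x) \<le> L2_norm M f + L2_norm M g"
proof (rule power2_le_imp_le)
  have "Re (L2_inner M f g) \<le> L2_norm M f * L2_norm M g"
    using complex_Re_le_cmod L2_Cauchy_Schwarz[OF assms] by (rule order_trans)
  then show "(L2_norm M (\<lambda>x. f x + g x))\<^sup>2 \<le> (L2_norm M f + L2_norm M g)\<^sup>2"
    using L2_norm_add_power2[OF assms] by (simp add: power2_sum)
qed simp

lemma L2_dist_triangle:
  assumes "f \<in> L2 M" "g \<in> L2 M" "h \<in> L2 M"
  shows "L2_norm M (\<lambda>x. f x - h x) \<le> L2_norm M (\<lambda>x. f x - g x) + L2_norm M (\<lambda>x. g x - h x)"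
  using L2_norm_triangle[OF L2_diff[OF assms(1,2)] L2_diff[OF assms(2,3)]] by simp

lemma L2_norm_triangle_diff:
  assumes "f \<in> L2 M" "g \<in> L2 M"
  shows "\<bar>L2_norm M f - L2_norm M g\<bar> \<le> L2_norm M (\<lambda>x. f x - g x)"
  using L2_norm_triangle[OF L2_diff[OF assms] assms(2)]
    L2_norm_triangle[OF L2_diff[OF assms(2,1)] assms(1)] L2_norm_minus_commute[of M f g]
  by simp

text \<open>On a finite measure space an \<open>L\<^sup>2\<close>-Cauchy sequence is \<open>L\<^sup>1\<close>-Cauchy, so a subsequence
  converges almost everywhere; Fatou's lemma shows that its limit is the \<open>L\<^sup>2\<close>-limit.\<close>

lemma L2_complete:
  fixes u :: "nat \<Rightarrow> 'a \<Rightarrow> complex"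
  assumes M: "finite_measure M" and u: "\<And>n. u n \<in> L2 M"
    and Cau: "\<And>e. e > 0 \<Longrightarrow> \<exists>K. \<forall>i\<ge>K. \<forall>j\<ge>K. L2_norm M (\<lambda>x. u i x - u j x) < e"
  obtains g where "g \<in> L2 M" "\<And>e. e > 0 \<Longrightarrow> \<exists>K. \<forall>n\<ge>K. L2_norm M (\<lambda>x. g x - u n x) < e"
proof -
  interpret finite_measure M by fact
  have [measurable]: "u n \<in> borel_measurable M" for n using u by (auto dest: L2_D)
  have one: "(\<lambda>_. 1) \<in> L2 M" by (simp add: L2_def)
  have int: "integrable M f" if "f \<in> L2 M" for f
    using L2_integrable_mult[OF that one] by simp
  have L1: "(\<integral>x. norm (f x) \<partial>M) \<le> L2_norm M f * L2_norm M (\<lambda>_. 1)" if f: "f \<in> L2 M" for f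
  proof -
    have f': "(\<lambda>x. of_real (cmod (f x))) \<in> L2 M"
      by (rule L2_bounded_by_L2[OF _ f, of _ 1]) (use L2_D(1)[OF f] in auto)
    have "L2_inner M (\<lambda>x. of_real (cmod (f x))) (\<lambda>_. 1) = of_real (\<integral>x. norm (f x) \<partial>M)"
      by (simp add: L2_inner_def)
    with L2_Cauchy_Schwarz[OF f' one] show ?thesis
      by (simp add: L2_norm_def)
  qed
  have "\<exists>K. \<forall>i\<ge>K. \<forall>j\<ge>K. (\<integral>x. norm (u i x - u j x) \<partial>M) < e" if "e > 0" for e
  proof -
    define C where "C = L2_norm M (\<lambda>_. 1) + 1"
    have C: "C > 0" "L2_norm M (\<lambda>_. 1) \<le> C" by (auto simp: C_def add_nonneg_pos)
    then have eC: "e / C > 0" using that by simp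
    obtain K where K: "\<forall>i\<ge>K. \<forall>j\<ge>K. L2_norm M (\<lambda>x. u i x - u j x) < e / C"
      using Cau[OF eC] by blast
    have "(\<integral>x. norm (u i x - u j x) \<partial>M) < e" if "i \<ge> K" "j \<ge> K" for i j
    proof -
      have "(\<integral>x. norm (u i x - u j x) \<partial>M) \<le> L2_norm M (\<lambda>x. u i x - u j x) * C"
        using L1[OF L2_diff[OF u u]] C(2)
        by (meson L2_norm_nonneg mult_left_mono order_trans)
      also have "\<dots> < e" using K that C by (simp add: pos_less_divide_eq)
      finally show ?thesis .
    qed
    then show ?thesis by blast
  qed
  then obtain r where r: "strict_mono r" and ae: "AE x in M. Cauchy (\<lambda>i. u (r i) x)"
    using cauchy_L1_AE_cauchy_subseq[of M u] int[OF u] by blast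
  define g where "g x = lim (\<lambda>i. u (r i) x)" for x
  have g_m [measurable]: "g \<in> borel_measurable M"
    unfolding g_def by measurable
  have lim: "AE x in M. (\<lambda>i. u (r i) x) \<longlonglongrightarrow> g x"
    using ae by eventually_elim (simp add: Cauchy_convergent_iff convergent_LIMSEQ_iff g_def)
  have fatou: "(\<integral>\<^sup>+x. ennreal ((cmod (g x - u n x))\<^sup>2) \<partial>M) \<le> ennreal (e\<^sup>2)"
    if e: "0 < e" and K: "\<forall>i\<ge>K. \<forall>j\<ge>K. L2_norm M (\<lambda>x. u i x - u j x) < e" and n: "n \<ge> K" for e K n
  proof -
    have "(\<integral>\<^sup>+x. ennreal ((cmod (g x - u n x))\<^sup>2) \<partial>M) =
        (\<integral>\<^sup>+x. liminf (\<lambda>i. ennreal ((cmod (u (r i) x - u n x))\<^sup>2)) \<partial>M)"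
    proof (rule nn_integral_cong_AE)
      show "AE x in M. ennreal ((cmod (g x - u n x))\<^sup>2) =
          liminf (\<lambda>i. ennreal ((cmod (u (r i) x - u n x))\<^sup>2))"
        using lim
      proof eventually_elim
        case (elim x)
        then have "(\<lambda>i. ennreal ((cmod (u (r i) x - u n x))\<^sup>2)) \<longlonglongrightarrow> ennreal ((cmod (g x - u n x))\<^sup>2)"
          by (intro tendsto_intros) auto
        then show ?case by (rule lim_imp_Liminf[OF sequentially_bot, symmetric])
      qed
    qed
    also have "\<dots> \<le> liminf (\<lambda>i. \<integral>\<^sup>+x. ennreal ((cmod (u (r i) x - u n x))\<^sup>2) \<partial>M)"
      by (rule nn_integral_liminf) measurable
    also have "\<dots> \<le> liminf (\<lambda>i. ennreal (e\<^sup>2))"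
    proof (rule Liminf_mono, unfold eventually_sequentially, intro exI allI impI)
      fix i assume "i \<ge> K"
      then have "r i \<ge> K" using seq_suble[OF r, of i] by simp
      then have "L2_norm M (\<lambda>x. u (r i) x - u n x) < e" using K n by blast
      then have "(L2_norm M (\<lambda>x. u (r i) x - u n x))\<^sup>2 \<le> e\<^sup>2"
        by (intro power_mono) auto
      then show "(\<integral>\<^sup>+x. ennreal ((cmod (u (r i) x - u n x))\<^sup>2) \<partial>M) \<le> ennreal (e\<^sup>2)"
        using L2_D(2)[OF L2_diff[OF u u]]
        by (subst nn_integral_eq_integral) (auto simp: L2_norm_power2 intro: ennreal_leI)
    qed
    also have "\<dots> = ennreal (e\<^sup>2)" by (simp add: Liminf_const)
    finally show ?thesis .
  qed
  have dist: "(\<lambda>x. g x - u n x) \<in> L2 M \<and> L2_norm M (\<lambda>x. g x - u n x) \<le> e"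
    if e: "0 < e" and K: "\<forall>i\<ge>K. \<forall>j\<ge>K. L2_norm M (\<lambda>x. u i x - u j x) < e" and n: "n \<ge> K" for e K n
  proof -
    have *: "integrable M (\<lambda>x. (cmod (g x - u n x))\<^sup>2)"
      using fatou[OF e K n] by (auto simp: integrable_iff_bounded intro: le_less_trans)
    then have L: "(\<lambda>x. g x - u n x) \<in> L2 M" by (simp add: L2_def)
    have "ennreal ((L2_norm M (\<lambda>x. g x - u n x))\<^sup>2) \<le> ennreal (e\<^sup>2)"
      using fatou[OF e K n] nn_integral_eq_integral[OF *] by (simp add: L2_norm_power2)
    then have "(L2_norm M (\<lambda>x. g x - u n x))\<^sup>2 \<le> e\<^sup>2"
      by simp
    then have "L2_norm M (\<lambda>x. g x - u n x) \<le> e"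
      by (rule power2_le_imp_le) (use e in simp)
    with L show ?thesis by simp
  qed
  show thesis
  proof
    obtain K where K: "\<forall>i\<ge>K. \<forall>j\<ge>K. L2_norm M (\<lambda>x. u i x - u j x) < 1" using Cau[of 1] by auto
    show "g \<in> L2 M"
      using L2_add[OF conjunct1[OF dist[OF _ K order_refl]] u[of K]] by simp
  next
    fix e :: real assume e: "e > 0"
    obtain K where K: "\<forall>i\<ge>K. \<forall>j\<ge>K. L2_norm M (\<lambda>x. u i x - u j x) < e/2" using Cau[of "e/2"] e by auto
    have "L2_norm M (\<lambda>x. g x - u n x) < e" if "n \<ge> K" for n
      using dist[OF _ K that] e by auto
    then show "\<exists>K. \<forall>n\<ge>K. L2_norm M (\<lambda>x. g x - u n x) < e" by blast
  qed
qed

section \<open>Closures of isometric relations\<close>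

text \<open>A linear isometric relation \<open>E\<close> between subspaces of two \<open>L\<^sup>2\<close> spaces.  A relation rather than a map
  is convenient because elements of \<open>L\<^sup>2\<close> are represented by functions, and a function given as a
  trigonometric polynomial may be written as one in several ways.\<close>

locale L2_isometry =
  fixes P :: "'p measure" and Q :: "'q measure"
    and E :: "('p \<Rightarrow> complex) \<Rightarrow> ('q \<Rightarrow> complex) \<Rightarrow> bool"
  assumes finite_P: "finite_measure P" and finite_Q: "finite_measure Q"
    and E_L2: "E G F \<Longrightarrow> G \<in> L2 P \<and> F \<in> L2 Q"
    and E_zero: "E (\<lambda>_. 0) (\<lambda>_. 0)"
    and E_add: "E G F \<Longrightarrow> E G' F' \<Longrightarrow> E (\<lambda>x. G x + G' x) (\<lambda>y. F y + F' y)"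
    and E_scale: "E G F \<Longrightarrow> E (\<lambda>x. c * G x) (\<lambda>y. c * F y)"
    and E_norm: "E G F \<Longrightarrow> L2_norm Q F = L2_norm P G"
begin

text \<open>The closure of the graph of \<open>E\<close>: the isometry that extends \<open>E\<close> by continuity to the closure of its
  domain.\<close>

definition isom :: "('p \<Rightarrow> complex) \<Rightarrow> ('q \<Rightarrow> complex) \<Rightarrow> bool" where
  "isom G F \<longleftrightarrow> G \<in> L2 P \<and> F \<in> L2 Q \<and>
     (\<forall>e>0. \<exists>G' F'. E G' F' \<and> L2_norm P (\<lambda>x. G x - G' x) < e \<and> L2_norm Q (\<lambda>y. F y - F' y) < e)"

lemma E_diff: "E G F \<Longrightarrow> E G' F' \<Longrightarrow> E (\<lambda>x. G x - G' x) (\<lambda>y. F y - F' y)"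
  using E_add[of G F "\<lambda>x. -1 * G' x" "\<lambda>y. -1 * F' y"] E_scale[of G' F' "-1"] by simp

lemma E_imp_R:
  assumes "E G F"
  shows "isom G F"
proof -
  have "L2_norm P (\<lambda>x. G x - G x) = 0" "L2_norm Q (\<lambda>y. F y - F y) = 0"
    by (simp_all add: L2_norm_def)
  then show ?thesis
    unfolding isom_def using E_L2[OF assms] assms by metis
qed

lemma isom_L2: "isom G F \<Longrightarrow> G \<in> L2 P" "isom G F \<Longrightarrow> F \<in> L2 Q"
  by (auto simp: isom_def)

lemma isom_approx:
  assumes "isom G F" "e > 0"
  obtains G' F' where "E G' F'" "L2_norm P (\<lambda>x. G x - G' x) < e" "L2_norm Q (\<lambda>y. F y - F' y) < e"
    "G' \<in> L2 P" "F' \<in> L2 Q"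
  using assms E_L2 unfolding isom_def by meson

lemma isom_norm:
  assumes "isom G F"
  shows "L2_norm Q F = L2_norm P G"
proof (rule ccontr)
  assume ne: "L2_norm Q F \<noteq> L2_norm P G"
  define e where "e = \<bar>L2_norm Q F - L2_norm P G\<bar> / 2"
  have "e > 0" using ne by (simp add: e_def)
  then obtain G' F' where a: "E G' F'" "L2_norm P (\<lambda>x. G x - G' x) < e" "L2_norm Q (\<lambda>y. F y - F' y) < e"
    "G' \<in> L2 P" "F' \<in> L2 Q"
    using isom_approx[OF assms] by metis
  have "\<bar>L2_norm Q F - L2_norm Q F'\<bar> < e" "\<bar>L2_norm P G - L2_norm P G'\<bar> < e"
    using L2_norm_triangle_diff[OF isom_L2(2)[OF assms] a(5)] L2_norm_triangle_diff[OF isom_L2(1)[OF assms] a(4)] a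
    by linarith+
  with E_norm[OF a(1)] have "\<bar>L2_norm Q F - L2_norm P G\<bar> < 2 * e" by linarith
  then show False by (simp add: e_def)
qed

lemma isom_limit:
  assumes G: "G \<in> L2 P" and F: "F \<in> L2 Q"
    and lim: "\<And>e. e > 0 \<Longrightarrow>
      \<exists>G' F'. isom G' F' \<and> L2_norm P (\<lambda>x. G x - G' x) < e \<and> L2_norm Q (\<lambda>y. F y - F' y) < e"
  shows "isom G F"
  unfolding isom_def
proof (intro conjI allI impI G F)
  fix e :: real assume "e > 0"
  then have e: "e / 2 > 0" by simp
  obtain G' F' where 1: "isom G' F'" "L2_norm P (\<lambda>x. G x - G' x) < e/2" "L2_norm Q (\<lambda>y. F y - F' y) < e/2"
    using lim[OF e] by blast
  obtain G'' F'' where 2: "E G'' F''" "L2_norm P (\<lambda>x. G' x - G'' x) < e/2" "L2_norm Q (\<lambda>y. F' y - F'' y) < e/2"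
    "G'' \<in> L2 P" "F'' \<in> L2 Q"
    using isom_approx[OF 1(1) e] by metis
  have "L2_norm P (\<lambda>x. G x - G'' x) < e"
    using L2_dist_triangle[OF G isom_L2(1)[OF 1(1)] 2(4)] 1 2 by linarith
  moreover have "L2_norm Q (\<lambda>x. F x - F'' x) < e"
    using L2_dist_triangle[OF F isom_L2(2)[OF 1(1)] 2(5)] 1 2 by linarith
  ultimately show "\<exists>G' F'. E G' F' \<and> L2_norm P (\<lambda>x. G x - G' x) < e \<and> L2_norm Q (\<lambda>y. F y - F' y) < e"
    using 2(1) by blast
qed

lemma isom_cong_AE:
  assumes "isom G F" and G': "G' \<in> borel_measurable P" and F': "F' \<in> borel_measurable Q"
    and "AE x in P. G' x = G x" "AE y in Q. F' y = F y"
  shows "isom G' F'"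
proof (rule isom_limit)
  have m: "G \<in> borel_measurable P" "F \<in> borel_measurable Q"
    using isom_L2[OF assms(1)] by (auto dest: L2_D)
  have [measurable]: "G \<in> borel_measurable P" "F \<in> borel_measurable Q"
    "G' \<in> borel_measurable P" "F' \<in> borel_measurable Q" by (fact m G' F')+
  have "integrable P (\<lambda>x. (cmod (G' x))\<^sup>2) \<longleftrightarrow> integrable P (\<lambda>x. (cmod (G x))\<^sup>2)"
    using assms(4) by (intro integrable_cong_AE) auto
  then show "G' \<in> L2 P" using isom_L2(1)[OF assms(1)] by (simp add: L2_def)
  have "integrable Q (\<lambda>x. (cmod (F' x))\<^sup>2) \<longleftrightarrow> integrable Q (\<lambda>x. (cmod (F x))\<^sup>2)"
    using assms(5) by (intro integrable_cong_AE) auto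
  then show "F' \<in> L2 Q" using isom_L2(2)[OF assms(1)] by (simp add: L2_def)
  have z: "L2_norm P (\<lambda>x. G' x - G x) = L2_norm P (\<lambda>_. 0)" "L2_norm Q (\<lambda>x. F' x - F x) = L2_norm Q (\<lambda>_. 0)"
    using assms(4,5) by (auto intro!: L2_norm_cong_AE)
  fix e :: real assume "e > 0"
  with z show "\<exists>G'' F''. isom G'' F'' \<and> L2_norm P (\<lambda>x. G' x - G'' x) < e \<and> L2_norm Q (\<lambda>y. F' y - F'' y) < e"
    using assms(1) by (intro exI[of _ G] exI[of _ F]) (simp add: L2_norm_def)
qed

lemma isom_add:
  assumes "isom G F" "isom G' F'"
  shows "isom (\<lambda>x. G x + G' x) (\<lambda>y. F y + F' y)"
  unfolding isom_def
proof (intro conjI allI impI)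
  note L = isom_L2[OF assms(1)] isom_L2[OF assms(2)]
  show "(\<lambda>x. G x + G' x) \<in> L2 P" "(\<lambda>x. F x + F' x) \<in> L2 Q"
    by (intro L2_add L)+
  fix e :: real assume "e > 0"
  then have e: "e / 2 > 0" by simp
  obtain G1 F1 where 1: "E G1 F1" "L2_norm P (\<lambda>x. G x - G1 x) < e/2" "L2_norm Q (\<lambda>y. F y - F1 y) < e/2"
    "G1 \<in> L2 P" "F1 \<in> L2 Q"
    using isom_approx[OF assms(1) e] by metis
  obtain G2 F2 where 2: "E G2 F2" "L2_norm P (\<lambda>x. G' x - G2 x) < e/2" "L2_norm Q (\<lambda>y. F' y - F2 y) < e/2"
    "G2 \<in> L2 P" "F2 \<in> L2 Q"
    using isom_approx[OF assms(2) e] by metis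
  have "L2_norm P (\<lambda>x. (G x + G' x) - (G1 x + G2 x)) < e"
    using L2_norm_triangle[OF L2_diff[OF L(1) 1(4)] L2_diff[OF L(3) 2(4)]] 1 2
    by (simp add: algebra_simps)
  moreover have "L2_norm Q (\<lambda>x. (F x + F' x) - (F1 x + F2 x)) < e"
    using L2_norm_triangle[OF L2_diff[OF L(2) 1(5)] L2_diff[OF L(4) 2(5)]] 1 2
    by (simp add: algebra_simps)
  ultimately show "\<exists>G'' F''. E G'' F'' \<and> L2_norm P (\<lambda>x. G x + G' x - G'' x) < e \<and>
      L2_norm Q (\<lambda>y. F y + F' y - F'' y) < e"
    using E_add[OF 1(1) 2(1)] by blast
qed

lemma isom_scale:
  assumes "isom G F"
  shows "isom (\<lambda>x. c * G x) (\<lambda>y. c * F y)"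
  unfolding isom_def
proof (intro conjI allI impI)
  note L = isom_L2[OF assms(1)]
  show "(\<lambda>x. c * G x) \<in> L2 P" "(\<lambda>x. c * F x) \<in> L2 Q"
    by (intro L2_scale L)+
  fix e :: real assume "e > 0"
  have c: "cmod c + 1 > 0" by (simp add: add_nonneg_pos)
  with \<open>e > 0\<close> have e: "e / (cmod c + 1) > 0" by simp
  obtain G1 F1 where 1: "E G1 F1" "L2_norm P (\<lambda>x. G x - G1 x) < e/(cmod c + 1)"
    "L2_norm Q (\<lambda>y. F y - F1 y) < e/(cmod c + 1)"
    using isom_approx[OF assms(1) e] by metis
  have small: "cmod c * x < e" if "x < e / (cmod c + 1)" "0 \<le> x" for x
  proof -
    have "cmod c * x \<le> (cmod c + 1) * x" using that by (simp add: mult_right_mono)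
    also have "\<dots> < e" using that c by (simp add: pos_less_divide_eq mult.commute)
    finally show ?thesis .
  qed
  have "L2_norm P (\<lambda>x. c * G x - c * G1 x) < e" "L2_norm Q (\<lambda>x. c * F x - c * F1 x) < e"
    using L2_norm_scale[of P c "\<lambda>x. G x - G1 x"] L2_norm_scale[of Q c "\<lambda>x. F x - F1 x"] small 1
    by (simp_all add: right_diff_distrib)
  then show "\<exists>G'' F''. E G'' F'' \<and> L2_norm P (\<lambda>x. c * G x - G'' x) < e \<and>
      L2_norm Q (\<lambda>y. c * F y - F'' y) < e"
    using E_scale[OF 1(1)] by blast
qed

lemma isom_diff:
  assumes "isom G F" "isom G' F'"
  shows "isom (\<lambda>x. G x - G' x) (\<lambda>y. F y - F' y)"
  using isom_add[OF assms(1) isom_scale[OF assms(2), of "-1"]] by simp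

lemma isom_sum:
  assumes "finite I" "\<And>i. i \<in> I \<Longrightarrow> isom (G i) (F i)"
  shows "isom (\<lambda>x. \<Sum>i\<in>I. G i x) (\<lambda>y. \<Sum>i\<in>I. F i y)"
  using assms by (induction I rule: finite_induct) (simp_all add: isom_add E_imp_R[OF E_zero])

text \<open>Since \<open>E\<close> is isometric, a sequence in its domain is Cauchy if and only if the sequence of images is.\<close>

lemma isom_complete:
  assumes E: "\<And>n::nat. E (G n) (F n)"
    and Cau: "\<And>e. e > 0 \<Longrightarrow> \<exists>K. \<forall>i\<ge>K. \<forall>j\<ge>K. L2_norm P (\<lambda>x. G i x - G j x) < e"
  obtains G' F' where "isom G' F'"
    "\<And>e. e > 0 \<Longrightarrow> \<exists>K. \<forall>n\<ge>K. L2_norm P (\<lambda>x. G' x - G n x) < e"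
    "\<And>e. e > 0 \<Longrightarrow> \<exists>K. \<forall>n\<ge>K. L2_norm Q (\<lambda>y. F' y - F n y) < e"
proof -
  have L: "G n \<in> L2 P" "F n \<in> L2 Q" for n using E_L2[OF E[of n]] by auto
  have eq: "L2_norm Q (\<lambda>x. F i x - F j x) = L2_norm P (\<lambda>x. G i x - G j x)" for i j
    by (rule E_norm[OF E_diff[OF E[of i] E[of j]]])
  have CauF: "\<exists>K. \<forall>i\<ge>K. \<forall>j\<ge>K. L2_norm Q (\<lambda>x. F i x - F j x) < e" if "e > 0" for e
    unfolding eq by (rule Cau[OF that])
  obtain G' where G': "G' \<in> L2 P" "\<And>e. e > 0 \<Longrightarrow> \<exists>K. \<forall>n\<ge>K. L2_norm P (\<lambda>x. G' x - G n x) < e"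
    by (rule L2_complete[of P G, OF finite_P L(1) Cau]) simp_all
  obtain F' where F': "F' \<in> L2 Q" "\<And>e. e > 0 \<Longrightarrow> \<exists>K. \<forall>n\<ge>K. L2_norm Q (\<lambda>x. F' x - F n x) < e"
    by (rule L2_complete[of Q F, OF finite_Q L(2) CauF]) simp_all
  have "isom G' F'"
  proof (rule isom_limit[OF G'(1) F'(1)])
    fix e :: real assume "e > 0"
    then obtain K1 K2 where "\<forall>n\<ge>K1. L2_norm P (\<lambda>x. G' x - G n x) < e" "\<forall>n\<ge>K2. L2_norm Q (\<lambda>x. F' x - F n x) < e"
      using G'(2) F'(2) by meson
    then show "\<exists>G'' F''. isom G'' F'' \<and> L2_norm P (\<lambda>x. G' x - G'' x) < e \<and> L2_norm Q (\<lambda>y. F' y - F'' y) < e"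
      using E_imp_R[OF E[of "max K1 K2"]] by (meson max.cobounded1 max.cobounded2)
  qed
  then show thesis using that G' F' by blast
qed

lemma isom_extend:
  assumes G: "G \<in> L2 P" and dense: "\<And>e. e > 0 \<Longrightarrow> \<exists>G' F'. E G' F' \<and> L2_norm P (\<lambda>x. G x - G' x) < e"
  obtains F where "isom G F"
proof -
  have "\<exists>G' F'. E G' F' \<and> L2_norm P (\<lambda>x. G x - G' x) < inverse (Suc n)" for n
    by (rule dense) simp
  then obtain Gn Fn where n: "\<And>n. E (Gn n) (Fn n)" "\<And>n. L2_norm P (\<lambda>x. G x - Gn n x) < inverse (Suc n)"
    by metis
  have L: "Gn n \<in> L2 P" for n using E_L2[OF n(1)[of n]] by auto
  have small: "\<exists>K. \<forall>n\<ge>K. L2_norm P (\<lambda>x. G x - Gn n x) < e" if "e > 0" for e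
  proof -
    obtain K where K: "inverse (Suc K) < e" using reals_Archimedean[OF \<open>e > 0\<close>] by auto
    have "L2_norm P (\<lambda>x. G x - Gn n x) < e" if "n \<ge> K" for n
    proof -
      have "inverse (real (Suc n)) \<le> inverse (Suc K)" using that by (intro le_imp_inverse_le) auto
      then show ?thesis using n(2)[of n] K by linarith
    qed
    then show ?thesis by blast
  qed
  have Cau: "\<exists>K. \<forall>i\<ge>K. \<forall>j\<ge>K. L2_norm P (\<lambda>x. Gn i x - Gn j x) < e" if "e > 0" for e
  proof -
    obtain K where K: "\<forall>n\<ge>K. L2_norm P (\<lambda>x. G x - Gn n x) < e/2" using small[of "e/2"] \<open>e > 0\<close> by auto
    have "L2_norm P (\<lambda>x. Gn i x - Gn j x) < e" if "i \<ge> K" "j \<ge> K" for i j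
    proof -
      have "L2_norm P (\<lambda>x. G x - Gn i x) < e/2" "L2_norm P (\<lambda>x. G x - Gn j x) < e/2"
        using K that by auto
      then show ?thesis
        using L2_dist_triangle[OF L[of i] G L[of j]] L2_norm_minus_commute[of P G "Gn i"] by linarith
    qed
    then show ?thesis by blast
  qed
  obtain G' F' where R: "isom G' F'" "\<And>e. e > 0 \<Longrightarrow> \<exists>K. \<forall>n\<ge>K. L2_norm P (\<lambda>x. G' x - Gn n x) < e"
    by (rule isom_complete[of Gn Fn, OF n(1) Cau]) simp_all
  have "L2_norm P (\<lambda>x. G' x - G x) < e" if "e > 0" for e
  proof -
    obtain K1 K2 where "\<forall>n\<ge>K1. L2_norm P (\<lambda>x. G' x - Gn n x) < e/2" "\<forall>n\<ge>K2. L2_norm P (\<lambda>x. G x - Gn n x) < e/2"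
      using R(2)[of "e/2"] small[of "e/2"] \<open>e > 0\<close> by auto
    then have "L2_norm P (\<lambda>x. G' x - Gn (max K1 K2) x) < e/2" "L2_norm P (\<lambda>x. G x - Gn (max K1 K2) x) < e/2"
      by auto
    then show ?thesis
      using L2_dist_triangle[OF isom_L2(1)[OF R(1)] L[of "max K1 K2"] G]
        L2_norm_minus_commute[of P G "Gn (max K1 K2)"] by linarith
  qed
  then have "L2_norm P (\<lambda>x. G' x - G x) = 0"
    using L2_norm_nonneg[of P "\<lambda>x. G' x - G x"] by (metis less_le less_irrefl)
  then have "AE x in P. G' x - G x = 0"
    using L2_norm_eq_0_iff[OF L2_diff[OF isom_L2(1)[OF R(1)] G]] by simp
  then have "AE x in P. G x = G' x" by eventually_elim simp
  then have "isom G F'"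
    using isom_cong_AE[OF R(1)] G isom_L2(2)[OF R(1)] by (auto dest: L2_D)
  then show thesis by (rule that)
qed

end

text \<open>Subtracting \<open>s \<langle>h,w\<rangle> w\<close> from \<open>h\<close> changes the square norm by
  \<open>- 2 s \<bar>\<langle>h,w\<rangle>\<bar>\<^sup>2 + s\<^sup>2 \<bar>\<langle>h,w\<rangle>\<bar>\<^sup>2 \<parallel>w\<parallel>\<^sup>2\<close>, which is negative for small \<open>s > 0\<close> unless
  \<open>\<langle>h,w\<rangle> = 0\<close>.\<close>

lemma L2_minimal_orthogonal:
  assumes h: "h \<in> L2 M" and w: "w \<in> L2 M"
    and min: "\<And>c. L2_norm M h \<le> L2_norm M (\<lambda>x. h x - c * w x)"
  shows "L2_inner M h w = 0"
proof (rule ccontr)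
  define a where "a = L2_inner M h w"
  \<comment> \<open>The summand 1 keeps the step size \<open>1 / B\<close> meaningful when \<open>w\<close> vanishes.\<close>
  define B where "B = (L2_norm M w)\<^sup>2 + 1"
  assume "L2_inner M h w \<noteq> 0"
  then have a: "(cmod a)\<^sup>2 > 0" by (simp add: a_def)
  have B: "B > 0" "(L2_norm M w)\<^sup>2 \<le> B" by (simp_all add: B_def add_nonneg_pos)
  define s where "s = 1 / B"
  have s: "s > 0" using B by (simp add: s_def)
  have "(L2_norm M h)\<^sup>2 \<le> (L2_norm M (\<lambda>x. h x - (of_real s * a) * w x))\<^sup>2"
    by (intro power_mono min) simp
  also have "\<dots> = (L2_norm M h)\<^sup>2 + s\<^sup>2 * (cmod a)\<^sup>2 * (L2_norm M w)\<^sup>2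
      - 2 * Re (L2_inner M h (\<lambda>x. (of_real s * a) * w x))"
    using L2_norm_diff_power2[OF h L2_scale[OF w, of "of_real s * a"]] s
    by (simp add: L2_norm_scale power_mult_distrib norm_mult)
  also have "L2_inner M h (\<lambda>x. (of_real s * a) * w x) = of_real s * (cnj a * a)"
    by (subst L2_inner_commute, subst L2_inner_scale_left, subst L2_inner_commute) (simp add: a_def)
  also have "Re \<dots> = s * (cmod a)\<^sup>2"
    unfolding cmod_power2 by (simp add: power2_eq_square)
  finally have "2 * (s * (cmod a)\<^sup>2) \<le> s\<^sup>2 * (cmod a)\<^sup>2 * (L2_norm M w)\<^sup>2" by simp
  also have "\<dots> \<le> s\<^sup>2 * (cmod a)\<^sup>2 * B"
    by (intro mult_left_mono B) simp
  also have "\<dots> = s * (cmod a)\<^sup>2"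
    using B by (simp add: s_def power2_eq_square)
  finally have "s * (cmod a)\<^sup>2 \<le> 0" by simp
  moreover have "0 < s * (cmod a)\<^sup>2" using s a by simp
  ultimately show False by simp
qed

text \<open>Orthogonal projection onto the closure of the range of \<open>E\<close>, by the usual minimising sequence;
  because \<open>E\<close> is isometric the preimages of the minimising sequence converge as well.\<close>

lemma (in L2_isometry) isom_project:
  assumes F: "F \<in> L2 Q"
  obtains G F' where "isom G F'" "\<And>G0 F0. E G0 F0 \<Longrightarrow> L2_inner Q (\<lambda>y. F y - F' y) F0 = 0"
proof -
  define D where "D = {L2_norm Q (\<lambda>y. F y - F0 y) |G0 F0. E G0 F0}"
  define d where "d = Inf D"
  have D: "D \<noteq> {}" "bdd_below D" using E_zero by (auto simp: D_def intro!: bdd_belowI[of _ 0])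
  have d_le: "d \<le> L2_norm Q (\<lambda>y. F y - F0 y)" if "E G0 F0" for G0 F0
    unfolding d_def using that by (intro cInf_lower D) (auto simp: D_def)
  have d0: "0 \<le> d" unfolding d_def by (intro cInf_greatest D) (auto simp: D_def)
  have "\<exists>G0 F0. E G0 F0 \<and> L2_norm Q (\<lambda>y. F y - F0 y) < d + inverse (real (Suc n))" for n
  proof -
    have "\<exists>x\<in>D. x < d + inverse (real (Suc n))"
      unfolding d_def by (rule cInf_lessD[OF D(1), THEN bexE]) auto
    then show ?thesis by (auto simp: D_def)
  qed
  then obtain Gn Fn where n: "\<And>n. E (Gn n) (Fn n)"
    "\<And>n. L2_norm Q (\<lambda>y. F y - Fn n y) < d + inverse (real (Suc n))" by metis
  have L: "Gn n \<in> L2 P" "Fn n \<in> L2 Q" for n using E_L2[OF n(1)[of n]] by auto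
  have n': "L2_norm Q (\<lambda>y. F y - Fn n y) \<le> d + inverse (real (Suc K))" if "n \<ge> K" for n K
  proof -
    have "inverse (real (Suc n)) \<le> inverse (Suc K)" using that by (intro le_imp_inverse_le) auto
    then show ?thesis using n(2)[of n] by linarith
  qed
  have close: "(L2_norm P (\<lambda>x. Gn i x - Gn j x))\<^sup>2 \<le> (8 * d + 4) * inverse (Suc K)"
    if "i \<ge> K" "j \<ge> K" for i j K
  proof -
    define k where "k = inverse (real (Suc K))"
    have k: "0 \<le> k" "k \<le> 1" by (auto simp: k_def intro: inverse_le_1_iff[THEN iffD2])
    have sq: "(L2_norm Q (\<lambda>y. F y - Fn n y))\<^sup>2 \<le> (d + k)\<^sup>2" if "n \<ge> K" for n
      using n'[OF that] unfolding k_def by (intro power_mono) auto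
    \<comment> \<open>The midpoint of \<open>Fn i\<close> and \<open>Fn j\<close> is again in the range of \<open>E\<close>.\<close>
    have "2 * d \<le> L2_norm Q (\<lambda>y. (F y - Fn i y) + (F y - Fn j y))"
    proof -
      have "L2_norm Q (\<lambda>y. (F y - Fn i y) + (F y - Fn j y)) =
          L2_norm Q (\<lambda>y. 2 * (F y - (1/2) * (Fn i y + Fn j y)))"
        by (rule L2_norm_cong) (simp add: algebra_simps)
      also have "\<dots> = 2 * L2_norm Q (\<lambda>y. F y - (1/2) * (Fn i y + Fn j y))"
        by (simp only: L2_norm_scale) simp
      finally show ?thesis
        using d_le[OF E_scale[OF E_add[OF n(1)[of i] n(1)[of j]], of "1/2"]] by simp
    qed
    then have "(2 * d)\<^sup>2 \<le> (L2_norm Q (\<lambda>y. (F y - Fn i y) + (F y - Fn j y)))\<^sup>2"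
      using d0 by (intro power_mono) auto
    moreover have "L2_norm P (\<lambda>x. Gn i x - Gn j x) = L2_norm Q (\<lambda>y. (F y - Fn i y) - (F y - Fn j y))"
      using E_norm[OF E_diff[OF n(1)[of i] n(1)[of j]]] L2_norm_minus_commute[of Q "Fn i" "Fn j"] by simp
    ultimately have "(L2_norm P (\<lambda>x. Gn i x - Gn j x))\<^sup>2 \<le> 4 * (d + k)\<^sup>2 - 4 * d\<^sup>2"
      using L2_parallelogram[OF L2_diff[OF F L(2)[of i]] L2_diff[OF F L(2)[of j]]] sq[OF that(1)] sq[OF that(2)]
      by (simp add: power_mult_distrib)
    also have "\<dots> = 8 * d * k + 4 * (k * k)" by (simp add: power2_eq_square algebra_simps)
    also have "\<dots> \<le> 8 * d * k + 4 * (k * 1)" using k by (intro add_left_mono mult_left_mono) auto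
    finally show ?thesis by (simp add: k_def algebra_simps)
  qed
  have Cau: "\<exists>K. \<forall>i\<ge>K. \<forall>j\<ge>K. L2_norm P (\<lambda>x. Gn i x - Gn j x) < e" if e: "e > 0" for e
  proof -
    have c: "8 * d + 4 > 0" using d0 by simp
    then have "0 < e\<^sup>2 / (8 * d + 4)" using e by simp
    then obtain K where "inverse (real (Suc K)) < e\<^sup>2 / (8 * d + 4)"
      using reals_Archimedean by blast
    then have K: "(8 * d + 4) * inverse (real (Suc K)) < e\<^sup>2"
      using c by (simp only: pos_less_divide_eq) (simp add: mult.commute)
    have "L2_norm P (\<lambda>x. Gn i x - Gn j x) < e" if "i \<ge> K" "j \<ge> K" for i j
    proof (rule power2_less_imp_less)
      show "(L2_norm P (\<lambda>x. Gn i x - Gn j x))\<^sup>2 < e\<^sup>2"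
        using close[OF that] K by linarith
    qed (use e in auto)
    then show ?thesis by blast
  qed
  obtain G F' where R: "isom G F'" "\<And>e. e > 0 \<Longrightarrow> \<exists>K. \<forall>n\<ge>K. L2_norm Q (\<lambda>x. F' x - Fn n x) < e"
    by (rule isom_complete[of Gn Fn, OF n(1) Cau]) simp_all
  note F' = isom_L2(2)[OF R(1)]
  have min: "L2_norm Q (\<lambda>y. F y - F' y) \<le> d"
  proof (rule field_le_epsilon)
    fix e :: real assume e: "e > 0"
    obtain K1 where K1: "\<forall>n\<ge>K1. L2_norm Q (\<lambda>x. F' x - Fn n x) < e/2" using R(2)[of "e/2"] e by auto
    obtain K2 where K2: "inverse (real (Suc K2)) < e/2" using reals_Archimedean[of "e/2"] e by auto
    have "L2_norm Q (\<lambda>y. F' y - Fn (max K1 K2) y) < e/2" using K1 by simp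
    moreover have "L2_norm Q (\<lambda>y. F y - Fn (max K1 K2) y) \<le> d + e/2"
      using n'[of K2 "max K1 K2"] K2 by simp
    ultimately show "L2_norm Q (\<lambda>y. F y - F' y) \<le> d + e"
      using L2_dist_triangle[OF F L(2)[of "max K1 K2"] F'] L2_norm_minus_commute[of Q F' "Fn (max K1 K2)"]
      by linarith
  qed
  have closure_min: "d \<le> L2_norm Q (\<lambda>y. F y - F2 y)" if r: "isom G2 F2" for G2 F2
  proof (rule field_le_epsilon)
    fix e :: real assume e: "e > 0"
    obtain G3 F3 where 3: "E G3 F3" "L2_norm Q (\<lambda>y. F2 y - F3 y) < e" "F3 \<in> L2 Q"
      using isom_approx[OF r e] by metis
    then show "d \<le> L2_norm Q (\<lambda>y. F y - F2 y) + e"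
      using d_le[OF 3(1)] L2_dist_triangle[OF F isom_L2(2)[OF r] 3(3)] by linarith
  qed
  have "L2_inner Q (\<lambda>y. F y - F' y) F0 = 0" if E0: "E G0 F0" for G0 F0
  proof (rule L2_minimal_orthogonal)
    show "(\<lambda>y. F y - F' y) \<in> L2 Q" by (rule L2_diff[OF F F'])
    show "F0 \<in> L2 Q" using E_L2[OF E0] by simp
    fix c
    show "L2_norm Q (\<lambda>y. F y - F' y) \<le> L2_norm Q (\<lambda>x. F x - F' x - c * F0 x)"
      using min closure_min[OF isom_add[OF R(1) isom_scale[OF E_imp_R[OF E0], of c]]]
      by (simp add: diff_diff_eq)
  qed
  with R(1) show thesis by (rule that)
qed

lemma (in L2_isometry) isom_orthogonal_zero:
  assumes R: "isom G F" and orth: "\<And>G0 F0. E G0 F0 \<Longrightarrow> L2_inner Q F F0 = 0"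
  shows "AE x in P. G x = 0"
proof -
  note F = isom_L2(2)[OF R]
  have "(L2_norm Q F)\<^sup>2 \<le> L2_norm Q F * e" if e: "e > 0" for e
  proof -
    obtain G0 F0 where 0: "E G0 F0" "L2_norm Q (\<lambda>y. F y - F0 y) < e" "F0 \<in> L2 Q"
      using isom_approx[OF R e] by metis
    have "L2_inner Q (\<lambda>y. F y - F0 y) F = L2_inner Q F F"
      using L2_inner_diff_left[OF F 0(3) F] orth[OF 0(1)] L2_inner_commute[of Q F0 F] by simp
    then have "(L2_norm Q F)\<^sup>2 = cmod (L2_inner Q (\<lambda>y. F y - F0 y) F)"
      by (simp add: L2_inner_self norm_power)
    also have "\<dots> \<le> L2_norm Q (\<lambda>y. F y - F0 y) * L2_norm Q F"
      by (rule L2_Cauchy_Schwarz[OF L2_diff[OF F 0(3)] F])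
    also have "\<dots> \<le> e * L2_norm Q F" using 0 by (intro mult_right_mono) auto
    finally show ?thesis by (simp add: mult.commute)
  qed
  from this[of "L2_norm Q F / 2"] have "L2_norm Q F = 0"
    using L2_norm_nonneg[of Q F] by (cases "L2_norm Q F = 0") (auto simp: power2_eq_square)
  then show ?thesis
    using isom_norm[OF R] L2_norm_eq_0_iff[OF isom_L2(1)[OF R]] by simp
qed

text \<open>Being orthogonal to a fixed \<open>h\<close> is a closed condition.\<close>

lemma (in L2_isometry) isom_inner_zero:
  assumes R: "isom G F" and h: "h \<in> L2 Q" and zero: "\<And>G0 F0. E G0 F0 \<Longrightarrow> L2_inner Q h F0 = 0"
  shows "L2_inner Q h F = 0"
proof (rule ccontr)
  assume ne: "L2_inner Q h F \<noteq> 0"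
  note F = isom_L2(2)[OF R]
  define e where "e = cmod (L2_inner Q h F) / (L2_norm Q h + 1)"
  have pos: "L2_norm Q h + 1 > 0" by (simp add: add_nonneg_pos)
  then have "e > 0" using ne by (simp add: e_def)
  then obtain G0 F0 where 0: "E G0 F0" "L2_norm Q (\<lambda>y. F y - F0 y) < e" "F0 \<in> L2 Q"
    using isom_approx[OF R] by metis
  have "L2_inner Q (\<lambda>y. F y - F0 y) h = L2_inner Q F h"
    using L2_inner_diff_left[OF F 0(3) h] zero[OF 0(1)] L2_inner_commute[of Q F0 h] by simp
  then have "cmod (L2_inner Q h F) = cmod (L2_inner Q (\<lambda>y. F y - F0 y) h)"
    using L2_inner_commute[of Q h F] by simp
  also have "\<dots> \<le> L2_norm Q (\<lambda>y. F y - F0 y) * L2_norm Q h"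
    by (rule L2_Cauchy_Schwarz[OF L2_diff[OF F 0(3)] h])
  also have "\<dots> \<le> e * L2_norm Q h" using 0 by (intro mult_right_mono) auto
  also have "\<dots> < e * (L2_norm Q h + 1)" using \<open>e > 0\<close> by simp
  also have "\<dots> = cmod (L2_inner Q h F)" using pos by (simp add: e_def)
  finally show False by simp
qed

section \<open>Measure preserving maps\<close>

definition measure_preserving :: "'a measure \<Rightarrow> 'b measure \<Rightarrow> ('a \<Rightarrow> 'b) \<Rightarrow> bool" where
  "measure_preserving M N \<theta> \<longleftrightarrow> \<theta> \<in> measurable M N \<and> distr M N \<theta> = N"

lemma measure_preserving_integral:
  fixes f :: "'b \<Rightarrow> 'c::{banach, second_countable_topology}"
  assumes "measure_preserving M N \<theta>" "f \<in> borel_measurable N"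
  shows "(\<integral>x. f (\<theta> x) \<partial>M) = (\<integral>y. f y \<partial>N)"
  using assms integral_distr[of \<theta> M N f] by (simp add: measure_preserving_def)

lemma measure_preserving_AE:
  assumes "measure_preserving M N \<theta>" "AE y in N. Q y"
  shows "AE x in M. Q (\<theta> x)"
  using assms AE_distrD[of \<theta> M N Q] unfolding measure_preserving_def by metis

lemma measure_preserving_L2:
  assumes "measure_preserving M N \<theta>" "f \<in> L2 N"
  shows "(\<lambda>x. f (\<theta> x)) \<in> L2 M"
proof -
  have \<theta>: "\<theta> \<in> measurable M N" "distr M N \<theta> = N" using assms(1) by (auto simp: measure_preserving_def)
  have "integrable (distr M N \<theta>) (\<lambda>y. (cmod (f y))\<^sup>2)" using L2_D(2)[OF assms(2)] \<theta> by simp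
  then have "integrable M (\<lambda>x. (cmod (f (\<theta> x)))\<^sup>2)" by (rule integrable_distr[OF \<theta>(1)])
  with measurable_compose[OF \<theta>(1) L2_D(1)[OF assms(2)]] show ?thesis by (simp add: L2_def)
qed

lemma measure_preserving_L2_norm:
  assumes "measure_preserving M N \<theta>" "f \<in> borel_measurable N"
  shows "L2_norm M (\<lambda>x. f (\<theta> x)) = L2_norm N f"
proof -
  have [measurable]: "f \<in> borel_measurable N" by fact
  show ?thesis
    unfolding L2_norm_def by (subst measure_preserving_integral[OF assms(1)]) auto
qed

lemma measure_preserving_L2_inner:
  assumes "measure_preserving M N \<theta>" "f \<in> L2 N" "g \<in> L2 N"
  shows "L2_inner M (\<lambda>x. f (\<theta> x)) (\<lambda>x. g (\<theta> x)) = L2_inner N f g"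
proof -
  have [measurable]: "f \<in> borel_measurable N" "g \<in> borel_measurable N" using assms by (auto dest: L2_D)
  show ?thesis
    unfolding L2_inner_def by (subst measure_preserving_integral[OF assms(1)]) auto
qed

section \<open>Translation on the unit cube\<close>

definition int_part :: "real ^ 'd \<Rightarrow> int ^ 'd" where
  "int_part v = (\<chi> i. \<lfloor>v $ i\<rfloor>)"

definition frac_part :: "real ^ 'd \<Rightarrow> real ^ 'd" where
  "frac_part v = (\<chi> i. frac (v $ i))"

definition real_vec :: "int ^ 'd \<Rightarrow> real ^ 'd" where
  "real_vec n = (\<chi> i. of_int (n $ i))"

lemma suspension_eq: "suspension T t = (\<lambda>(x, r). (T (int_part (t + r)) x, frac_part (t + r)))"
  by (simp add: suspension_def int_part_def frac_part_def)

lemma frac_part_eq: "frac_part v = v - real_vec (int_part v)"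
  by (simp add: frac_part_def int_part_def real_vec_def vec_eq_iff frac_def)

lemma int_part_add_real_vec: "int_part (v + real_vec n) = int_part v + n"
  by (simp add: int_part_def real_vec_def vec_eq_iff)

lemma frac_part_add_real_vec: "frac_part (v + real_vec n) = frac_part v"
  by (simp add: frac_part_def real_vec_def vec_eq_iff)

lemma space_unit_cube: "space (unit_cube :: (real ^ 'd) measure) = {r. int_part r = 0}"
  by (auto simp: unit_cube_def space_restrict_space int_part_def vec_eq_iff floor_eq_iff)

lemma int_part_frac_part [simp]: "int_part (frac_part v) = 0"
  by (simp add: frac_part_def int_part_def vec_eq_iff)

lemma frac_part_id: "int_part v = 0 \<Longrightarrow> frac_part v = v"
  by (simp add: frac_part_eq real_vec_def vec_eq_iff)

lemma measurable_vec_nth [measurable]: "(\<lambda>v :: real ^ 'd. v $ i) \<in> borel_measurable borel"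
  by (intro borel_measurable_continuous_onI continuous_intros)

lemma measurable_vec_lambda:
  fixes g :: "'a \<Rightarrow> 'd::finite \<Rightarrow> real"
  assumes "\<And>i. (\<lambda>x. g x i) \<in> borel_measurable M"
  shows "(\<lambda>x. \<chi> i. g x i) \<in> borel_measurable M"
proof (subst borel_measurable_euclidean_space, intro ballI)
  fix b :: "real ^ 'd" assume "b \<in> Basis"
  then obtain i where "b = axis i 1" by (auto simp: Basis_vec_def)
  then show "(\<lambda>x. (\<chi> i. g x i) \<bullet> b) \<in> borel_measurable M"
    using assms by (simp add: inner_axis)
qed

lemma measurable_int_part [measurable]:
  "(int_part :: real ^ 'd \<Rightarrow> int ^ 'd) \<in> measurable borel (count_space UNIV)"
proof (subst measurable_count_space_eq2_countable, intro conjI ballI)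
  fix n :: "int ^ 'd"
  have "int_part -` {n} \<inter> space borel = {v \<in> space borel. \<forall>i. \<lfloor>v $ i\<rfloor> = n $ i}"
    by (auto simp: int_part_def vec_eq_iff)
  also have "\<dots> \<in> sets borel" by measurable
  finally show "int_part -` {n} \<inter> space (borel :: (real ^ 'd) measure) \<in> sets borel" .
qed auto

lemma measurable_frac_part [measurable]:
  "(frac_part :: real ^ 'd \<Rightarrow> real ^ 'd) \<in> borel_measurable borel"
  unfolding frac_part_def frac_def by (rule measurable_vec_lambda) measurable

lemma unit_cube_eq: "unit_cube = restrict_space lborel {r :: real ^ 'd. int_part r = 0}"
proof -
  have "{r :: real ^ 'd. \<forall>i. 0 \<le> r $ i \<and> r $ i < 1} = {r. int_part r = 0}"
    by (auto simp: int_part_def vec_eq_iff floor_eq_iff)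
  then show ?thesis by (simp add: unit_cube_def)
qed

lemma measurable_unit_cubeI:
  assumes "g \<in> measurable M borel" "\<And>x. x \<in> space M \<Longrightarrow> int_part (g x) = 0"
  shows "g \<in> measurable M unit_cube"
  unfolding unit_cube_eq using assms by (auto intro!: measurable_restrict_space2)

lemma measurable_unit_cubeD: "g \<in> measurable M unit_cube \<Longrightarrow> g \<in> measurable M borel"
  unfolding unit_cube_eq using measurable_restrict_space2_iff[of g M lborel] by auto

lemma finite_measure_unit_cube: "finite_measure (unit_cube :: (real ^ 'd) measure)"
proof
  have "{r :: real ^ 'd. int_part r = 0} \<subseteq> cbox 0 (\<chi> i. 1)"
    by (auto simp: int_part_def vec_eq_iff floor_eq_iff mem_box_cart less_imp_le)
  then have "emeasure lborel {r :: real ^ 'd. int_part r = 0} \<le> emeasure lborel (cbox 0 (\<chi> i. 1) :: (real ^ 'd) set)"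
    by (intro emeasure_mono) auto
  also have "\<dots> < \<infinity>" by (rule emeasure_lborel_cbox_finite)
  finally show "emeasure (unit_cube :: (real ^ 'd) measure) (space unit_cube) \<noteq> \<infinity>"
    unfolding space_unit_cube unit_cube_eq by (subst emeasure_restrict_space) auto
qed

lemma finite_int_part_translates:
  fixes t :: "real ^ 'd"
  obtains K where "finite K" "\<And>r. int_part r = 0 \<Longrightarrow> int_part (t + r) \<in> K"
proof
  let ?K = "(\<lambda>g. \<chi> i. g i) ` (Pi\<^sub>E UNIV (\<lambda>i. {\<lfloor>t $ i\<rfloor>, \<lfloor>t $ i\<rfloor> + 1}))"
  show "finite ?K" by (intro finite_imageI finite_PiE) auto
  fix r :: "real ^ 'd" assume "int_part r = 0"
  then have r: "0 \<le> r $ i \<and> r $ i < 1" for i by (auto simp: int_part_def vec_eq_iff floor_eq_iff)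
  have "\<lfloor>t $ i + r $ i\<rfloor> = \<lfloor>t $ i\<rfloor> \<or> \<lfloor>t $ i + r $ i\<rfloor> = \<lfloor>t $ i\<rfloor> + 1" for i
    using r[of i] by linarith
  then show "int_part (t + r) \<in> ?K"
    by (intro image_eqI[of _ _ "\<lambda>i. \<lfloor>t $ i + r $ i\<rfloor>"]) (auto simp: int_part_def)
qed

text \<open>Cut the cube into the finitely many pieces on which \<open>int_part (t + r)\<close> is constant and translate
  each piece back; Lebesgue measure is translation invariant.\<close>

lemma nn_integral_unit_cube_translate:
  fixes t :: "real ^ 'd"
  assumes h: "h \<in> borel_measurable unit_cube"
  shows "(\<integral>\<^sup>+r. h (frac_part (t + r)) \<partial>unit_cube) = (\<integral>\<^sup>+r. h r \<partial>unit_cube)"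
proof -
  let ?Q = "{r :: real ^ 'd. int_part r = 0}"
  define g where "g r = h r * indicator ?Q r" for r
  have g [measurable]: "g \<in> borel_measurable borel"
    using h unfolding unit_cube_eq g_def by (subst (asm) borel_measurable_restrict_space_iff_ennreal) auto
  obtain K where K: "finite K" "\<And>r. int_part r = 0 \<Longrightarrow> int_part (t + r) \<in> K"
    using finite_int_part_translates[of t] by metis
  have "(\<integral>\<^sup>+r. h (frac_part (t + r)) \<partial>unit_cube) =
      (\<integral>\<^sup>+r. h (frac_part (t + r)) * indicator ?Q r \<partial>lborel)"
    unfolding unit_cube_eq by (subst nn_integral_restrict_space) auto
  also have "\<dots> = (\<integral>\<^sup>+r. (\<Sum>m\<in>K. g (t + r - real_vec m) * indicator ?Q r) \<partial>lborel)"
  proof (rule nn_integral_cong)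
    fix r
    show "h (frac_part (t + r)) * indicator ?Q r = (\<Sum>m\<in>K. g (t + r - real_vec m) * indicator ?Q r)"
    proof (cases "int_part r = 0")
      case True
      have "g (t + r - real_vec m) = (if m = int_part (t + r) then h (frac_part (t + r)) else 0)" for m
      proof -
        have "int_part (t + r) = int_part (t + r - real_vec m) + m"
          using int_part_add_real_vec[of "t + r - real_vec m" m] by simp
        then show ?thesis by (auto simp: g_def frac_part_eq)
      qed
      then show ?thesis using True K by simp
    qed simp
  qed
  also have "\<dots> = (\<Sum>m\<in>K. \<integral>\<^sup>+r. g (t + r - real_vec m) * indicator ?Q r \<partial>lborel)"
    by (rule nn_integral_sum) measurable
  also have "\<dots> = (\<Sum>m\<in>K. \<integral>\<^sup>+s. g s * indicator ?Q (s - (t - real_vec m)) \<partial>lborel)"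
  proof (rule sum.cong[OF refl])
    fix m
    have "(\<integral>\<^sup>+s. g s * indicator ?Q (s - (t - real_vec m)) \<partial>lborel) =
        (\<integral>\<^sup>+s. g s * indicator ?Q (s - (t - real_vec m)) \<partial>distr lborel borel ((+) (t - real_vec m)))"
      by (subst lborel_distr_plus) simp
    also have "\<dots> = (\<integral>\<^sup>+r. g (t + r - real_vec m) * indicator ?Q r \<partial>lborel)"
      by (subst nn_integral_distr) (auto simp: algebra_simps)
    finally show "(\<integral>\<^sup>+r. g (t + r - real_vec m) * indicator ?Q r \<partial>lborel) =
        (\<integral>\<^sup>+s. g s * indicator ?Q (s - (t - real_vec m)) \<partial>lborel)" by simp
  qed
  also have "\<dots> = (\<integral>\<^sup>+s. (\<Sum>m\<in>K. g s * indicator ?Q (s - (t - real_vec m))) \<partial>lborel)"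
    by (rule nn_integral_sum[symmetric]) measurable
  also have "\<dots> = (\<integral>\<^sup>+s. g s \<partial>lborel)"
  proof (rule nn_integral_cong)
    fix s
    show "(\<Sum>m\<in>K. g s * indicator ?Q (s - (t - real_vec m))) = g s"
    proof (cases "int_part s = 0")
      case True
      \<comment> \<open>The only index of a piece whose translate contains \<open>s\<close>.\<close>
      define m0 where "m0 = - int_part (s - t)"
      have m: "int_part (s - (t - real_vec m)) = 0 \<longleftrightarrow> m = m0" for m
        using int_part_add_real_vec[of "s - t" m] by (auto simp: m0_def eq_neg_iff_add_eq_0 algebra_simps)
      have "m0 \<in> K"
        using K(2)[of "s - (t - real_vec m0)"] m[of m0] int_part_add_real_vec[of s m0] True
        by (simp add: algebra_simps)
      then show ?thesis using K m by (simp add: indicator_def if_distrib cong: if_cong)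
    qed (simp add: g_def)
  qed
  also have "\<dots> = (\<integral>\<^sup>+r. h r \<partial>unit_cube)"
    unfolding unit_cube_eq g_def by (subst nn_integral_restrict_space) auto
  finally show ?thesis .
qed

text \<open>The suspension is a skew product over the translation of the cube modulo 1, and it acts on each fibre
  by a measure preserving map.\<close>

lemma suspension_measure_preserving:
  fixes h :: "int ^ 'd \<Rightarrow> 'a \<Rightarrow> 'a"
  assumes "finite_measure M" and h: "\<And>n. measure_preserving M M (h n)"
  shows "measure_preserving (M \<Otimes>\<^sub>M unit_cube) (M \<Otimes>\<^sub>M unit_cube) (suspension h t)"
proof -
  interpret M: finite_measure M by fact
  interpret C: finite_measure "unit_cube :: (real ^ 'd) measure" by (rule finite_measure_unit_cube)
  interpret pair_sigma_finite M "unit_cube :: (real ^ 'd) measure" ..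
  have hm [measurable]: "h n \<in> measurable M M" for n using h by (auto simp: measure_preserving_def)
  have [measurable]: "(\<lambda>r. r) \<in> measurable (unit_cube :: (real ^ 'd) measure) borel"
    by (rule measurable_unit_cubeD[OF measurable_ident_sets[OF refl]])
  have [measurable]: "(\<lambda>z. t + snd z) \<in> measurable (M \<Otimes>\<^sub>M (unit_cube :: (real ^ 'd) measure)) borel"
    by (intro borel_measurable_add measurable_unit_cubeD[OF measurable_snd]) simp
  have fr [measurable]: "(\<lambda>r. frac_part (t + r)) \<in> measurable unit_cube unit_cube"
    by (rule measurable_unit_cubeI) auto
  have ip: "(\<lambda>z. int_part (t + snd z)) \<in> measurable (M \<Otimes>\<^sub>M unit_cube) (count_space UNIV)"
    by (rule measurable_compose[OF _ measurable_int_part]) measurable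
  have fr' [measurable]: "(\<lambda>z. frac_part (t + snd z)) \<in> measurable (M \<Otimes>\<^sub>M unit_cube) unit_cube"
    by (rule measurable_compose[OF measurable_snd fr])
  have hz [measurable]: "(\<lambda>z. h (int_part (t + snd z)) (fst z)) \<in> measurable (M \<Otimes>\<^sub>M unit_cube) M"
    by (rule measurable_compose_countable[OF _ ip]) (rule measurable_compose[OF measurable_fst hm])
  have m: "suspension h t \<in> measurable (M \<Otimes>\<^sub>M unit_cube) (M \<Otimes>\<^sub>M unit_cube)"
    unfolding suspension_eq split_beta by (rule measurable_Pair[OF hz fr'])
  have "distr (M \<Otimes>\<^sub>M unit_cube) (M \<Otimes>\<^sub>M unit_cube) (suspension h t) = M \<Otimes>\<^sub>M unit_cube" (is "?D = ?P")
  proof (rule measure_eqI)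
    fix A assume "A \<in> sets ?D"
    then have A [measurable]: "A \<in> sets ?P" by simp
    define k where "k r = (\<integral>\<^sup>+x. indicator A (x, r) \<partial>M)" for r
    have k [measurable]: "k \<in> borel_measurable unit_cube" unfolding k_def by measurable
    have "emeasure ?D A = (\<integral>\<^sup>+z. indicator A z \<partial>?D)" by simp
    also have "\<dots> = (\<integral>\<^sup>+z. indicator A (suspension h t z) \<partial>?P)"
      by (rule nn_integral_distr[OF m]) simp
    also have "\<dots> = (\<integral>\<^sup>+r. \<integral>\<^sup>+x. indicator A (suspension h t (x, r)) \<partial>M \<partial>unit_cube)"
      using measurable_compose[OF m, of "indicator A" borel] by (subst nn_integral_snd) auto
    also have "\<dots> = (\<integral>\<^sup>+r. k (frac_part (t + r)) \<partial>unit_cube)"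
    proof (rule nn_integral_cong)
      fix r :: "real ^ 'd" assume r: "r \<in> space unit_cube"
      then have sp: "frac_part (t + r) \<in> space unit_cube" by (simp add: space_unit_cube)
      have "k (frac_part (t + r)) =
          (\<integral>\<^sup>+x. indicator A (x, frac_part (t + r)) \<partial>distr M M (h (int_part (t + r))))"
        using h by (simp add: k_def measure_preserving_def)
      also have "\<dots> = (\<integral>\<^sup>+x. indicator A (suspension h t (x, r)) \<partial>M)"
        unfolding suspension_eq using sp by (subst nn_integral_distr) (auto intro!: hm)
      finally show "(\<integral>\<^sup>+x. indicator A (suspension h t (x, r)) \<partial>M) = k (frac_part (t + r))" by simp
    qed
    also have "\<dots> = (\<integral>\<^sup>+r. k r \<partial>unit_cube)" by (rule nn_integral_unit_cube_translate[OF k])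
    also have "\<dots> = (\<integral>\<^sup>+z. indicator A z \<partial>?P)" unfolding k_def by (subst nn_integral_snd) auto
    finally show "emeasure ?D A = emeasure ?P A" by simp
  qed simp
  with m show ?thesis by (simp add: measure_preserving_def)
qed

lemma suspension_inverse:
  assumes T: "mp_action M T" and z: "z \<in> space (M \<Otimes>\<^sub>M unit_cube)"
  shows "suspension T t (suspension T (- t) z) = z"
proof -
  obtain x r where xr: "z = (x, r)" "x \<in> space M" "int_part r = 0"
    using z by (auto simp: space_pair_measure space_unit_cube)
  define n where "n = int_part (r - t)"
  have r: "t + frac_part (r - t) = r + real_vec (- n)"
    by (simp add: frac_part_eq n_def real_vec_def vec_eq_iff)
  have i: "int_part (t + frac_part (r - t)) = - n" "frac_part (t + frac_part (r - t)) = r"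
    unfolding r int_part_add_real_vec frac_part_add_real_vec using xr by (auto simp: frac_part_id)
  have "T (- n) (T n x) = T (- n + n) x" using T xr unfolding mp_action_def by metis
  also have "\<dots> = x" using T xr by (simp add: mp_action_def)
  finally show ?thesis by (simp add: suspension_eq xr i n_def[symmetric])
qed

section \<open>Characters of the torus\<close>

lemma torus_char_zero [simp]: "torus_char a 0 = 1"
  by transfer simp

lemma torus_char_add: "torus_char a (m + n) = torus_char a m * torus_char a n"
  by transfer (simp add: cis_mult distrib_left sum.distrib)

lemma norm_torus_char [simp]: "cmod (torus_char a n) = 1"
  by transfer simp

lemma cnj_torus_char: "cnj (torus_char a n) = torus_char a (- n)"
  by transfer (simp add: cis_cnj sum_negf)

lemma borel_measurable_torus_char [measurable]: "(\<lambda>a. torus_char a n) \<in> borel_measurable borel"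
proof (rule borel_measurable_continuous_onI, subst continuous_on_open_vimage[OF open_UNIV], intro allI impI)
  fix B :: "complex set" assume B: "open B"
  have "continuous_on UNIV (\<lambda>v. torus_char (abs_torus v) n)"
    unfolding torus_char.abs_eq cis_conv_exp by (intro continuous_intros)
  then have "open ((\<lambda>v. torus_char (abs_torus v) n) -` B)"
    using B continuous_on_open_vimage[OF open_UNIV] by auto
  also have "(\<lambda>v. torus_char (abs_torus v) n) -` B = abs_torus -` ((\<lambda>a. torus_char a n) -` B)" by auto
  finally show "open ((\<lambda>a. torus_char a n) -` B \<inter> UNIV)" by (simp add: open_torus_def)
qed

section \<open>Products\<close>

lemma (in pair_sigma_finite)
  fixes u :: "'a \<Rightarrow> 'c::{banach, second_countable_topology, real_normed_field}"
  assumes u: "integrable M1 u" and v: "integrable M2 v"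
  shows integrable_times: "integrable (M1 \<Otimes>\<^sub>M M2) (\<lambda>z. u (fst z) * v (snd z))"
    and integral_times: "(\<integral>z. u (fst z) * v (snd z) \<partial>(M1 \<Otimes>\<^sub>M M2)) = (\<integral>x. u x \<partial>M1) * (\<integral>y. v y \<partial>M2)"
proof -
  have [measurable]: "u \<in> borel_measurable M1" "v \<in> borel_measurable M2" using u v by auto
  show i: "integrable (M1 \<Otimes>\<^sub>M M2) (\<lambda>z. u (fst z) * v (snd z))"
    by (rule Fubini_integrable) (use u v in \<open>auto simp: norm_mult\<close>)
  have "(\<integral>z. u (fst z) * v (snd z) \<partial>(M1 \<Otimes>\<^sub>M M2)) = (\<integral>x. \<integral>y. u x * v y \<partial>M2 \<partial>M1)"
    using integral_fst'[OF i] by simp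
  then show "(\<integral>z. u (fst z) * v (snd z) \<partial>(M1 \<Otimes>\<^sub>M M2)) = (\<integral>x. u x \<partial>M1) * (\<integral>y. v y \<partial>M2)"
    by simp
qed

lemma L2_times:
  assumes M: "finite_measure M" and N: "finite_measure N" and f: "f \<in> L2 M" and g: "g \<in> L2 N"
  shows "(\<lambda>z. f (fst z) * g (snd z)) \<in> L2 (M \<Otimes>\<^sub>M N)"
proof -
  interpret M: finite_measure M by fact
  interpret N: finite_measure N by fact
  interpret pair_sigma_finite M N ..
  have [measurable]: "f \<in> borel_measurable M" "g \<in> borel_measurable N" using f g by (auto dest: L2_D)
  show ?thesis
    using integrable_times[OF L2_D(2)[OF f] L2_D(2)[OF g]]
    by (auto simp: L2_def norm_mult power_mult_distrib)
qed

section \<open>The cyclic representation of the suspension\<close>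

text \<open>Let \<open>\<sigma>\<close> be the spectral measure of \<open>f\<close>.  The cyclic space of \<open>f\<close> is isometric to \<open>L2 \<sigma>\<close>, with
  \<open>f \<circ> T n\<close> corresponding to the character with index \<open>- n\<close>; the sign is the one in the definition of
  the spectral measure.  Tensoring with the bounded functions on the cube gives the pairs below.\<close>

inductive orbit_pair ::
  "(int ^ 'd \<Rightarrow> 'a \<Rightarrow> 'a) \<Rightarrow> ('a \<Rightarrow> complex) \<Rightarrow> ('d::finite torus \<times> (real ^ 'd) \<Rightarrow> complex) \<Rightarrow>
    ('a \<times> (real ^ 'd) \<Rightarrow> complex) \<Rightarrow> bool" for T f where
  base: "\<phi> \<in> borel_measurable unit_cube \<Longrightarrow> (\<And>r. cmod (\<phi> r) \<le> C) \<Longrightarrow>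
    orbit_pair T f (\<lambda>z. torus_char (fst z) (- n) * \<phi> (snd z)) (\<lambda>z. f (T n (fst z)) * \<phi> (snd z))"
| add: "orbit_pair T f G F \<Longrightarrow> orbit_pair T f G' F' \<Longrightarrow>
    orbit_pair T f (\<lambda>z. G z + G' z) (\<lambda>z. F z + F' z)"

text \<open>The counterpart, for functions on the torus times the cube, of composition with \<open>suspension T t\<close>.
  The suspension of the trivial action \<open>\<lambda>_ a. a\<close> only translates the cube variable modulo 1; the change
  of the base point is turned into a character.\<close>

definition twist ::
  "real ^ 'd \<Rightarrow> ('d::finite torus \<times> (real ^ 'd) \<Rightarrow> complex) \<Rightarrow> 'd torus \<times> (real ^ 'd) \<Rightarrow> complex" where
  "twist t G = (\<lambda>z. torus_char (fst z) (- int_part (t + snd z)) * G (suspension (\<lambda>_ a. a) t z))"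

locale spectral_system =
  fixes M :: "'a measure" and T :: "int ^ 'd::finite \<Rightarrow> 'a \<Rightarrow> 'a" and f :: "'a \<Rightarrow> complex"
    and \<sigma> :: "'d torus measure"
  assumes prob_M: "prob_space M" and T: "mp_action M T" and f: "f \<in> L2 M"
    and spectral: "spectral_measure M T f \<sigma>"
begin

abbreviation "P \<equiv> \<sigma> \<Otimes>\<^sub>M (unit_cube :: (real ^ 'd) measure)"
abbreviation "Q \<equiv> (suspension_space M :: ('a \<times> (real ^ 'd)) measure)"

lemma finite_M: "finite_measure M"
  using prob_M by (simp add: prob_space_def)

lemma finite_sigma: "finite_measure \<sigma>" and sets_sigma: "sets \<sigma> = sets borel"
  using spectral by (auto simp: spectral_measure_def)

lemma T_preserving: "measure_preserving M M (T n)"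
  using T by (simp add: mp_action_def measure_preserving_def)

lemma T_add: "x \<in> space M \<Longrightarrow> T (m + n) x = T m (T n x)"
  using T by (simp add: mp_action_def)

lemma f_T: "(\<lambda>x. f (T n x)) \<in> L2 M"
  by (rule measure_preserving_L2[OF T_preserving f])

lemma char_L2: "(\<lambda>a. torus_char a n) \<in> L2 \<sigma>"
  by (rule L2_bounded[OF finite_sigma, of _ 1]) (auto simp: measurable_cong_sets[OF sets_sigma refl])

lemma correlation: "(\<integral>x. f (T n x) * cnj (f (T m x)) \<partial>M) = (\<integral>a. torus_char a (- n) * cnj (torus_char a (- m)) \<partial>\<sigma>)"
proof -
  have [measurable]: "f \<in> borel_measurable M" "(\<lambda>x. f (T (n - m) x)) \<in> borel_measurable M"
    using f f_T by (auto dest: L2_D)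
  have "(\<integral>x. f (T n x) * cnj (f (T m x)) \<partial>M) = (\<integral>x. f (T (n - m) (T m x)) * cnj (f (T m x)) \<partial>M)"
    by (rule Bochner_Integration.integral_cong) (auto simp flip: T_add)
  also have "\<dots> = (\<integral>x. f (T (n - m) x) * cnj (f x) \<partial>M)"
    by (rule measure_preserving_integral[OF T_preserving, where f="\<lambda>x. f (T (n - m) x) * cnj (f x)"]) measurable
  also have "\<dots> = (\<integral>a. torus_char a (- (n - m)) \<partial>\<sigma>)"
    using spectral unfolding spectral_measure_def by blast
  also have "\<dots> = (\<integral>a. torus_char a (- n) * cnj (torus_char a (- m)) \<partial>\<sigma>)"
    by (simp add: cnj_torus_char flip: torus_char_add)
  finally show ?thesis .
qed

lemma orbit_pair_L2: "orbit_pair T f G F \<Longrightarrow> G \<in> L2 P \<and> F \<in> L2 Q"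
proof (induction rule: orbit_pair.induct)
  case (base \<phi> C n)
  have "\<phi> \<in> L2 unit_cube" by (rule L2_bounded[OF finite_measure_unit_cube base(1)]) (rule base(2))
  then show ?case
    unfolding suspension_space_def
    using L2_times[OF finite_sigma finite_measure_unit_cube char_L2] L2_times[OF finite_M finite_measure_unit_cube f_T]
    by blast
next
  case add
  then show ?case by (simp add: L2_add)
qed

lemma orbit_pair_scale: "orbit_pair T f G F \<Longrightarrow> orbit_pair T f (\<lambda>z. c * G z) (\<lambda>z. c * F z)"
proof (induction rule: orbit_pair.induct)
  case (base \<phi> C n)
  have "cmod (c * \<phi> r) \<le> cmod c * C" for r using base(2) by (simp add: norm_mult mult_left_mono)
  then have "orbit_pair T f (\<lambda>z. torus_char (fst z) (- n) * (c * \<phi> (snd z))) (\<lambda>z. f (T n (fst z)) * (c * \<phi> (snd z)))"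
    using base(1) by (intro orbit_pair.base[of "\<lambda>r. c * \<phi> r"]) auto
  then show ?case by (simp add: mult.left_commute)
next
  case (add G F G' F')
  show ?case using orbit_pair.add[OF add(3,4)] by (simp add: distrib_left)
qed

text \<open>On products, both inner products are the product of the one on the cube with a correlation of
  \<open>f\<close>, and the defining property of the spectral measure is that these correlations agree.\<close>

lemma orbit_pair_inner:
  assumes "orbit_pair T f G F" "orbit_pair T f G' F'"
  shows "L2_inner Q F F' = L2_inner P G G'"
  using assms
proof (induction arbitrary: G' F' rule: orbit_pair.induct)
  case b1: (base \<phi> C n)
  from b1(3) show ?case
  proof (induction rule: orbit_pair.induct)
    case b2: (base \<psi> D m)
    interpret M: finite_measure M by (rule finite_M)
    interpret S: finite_measure \<sigma> by (rule finite_sigma)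
    interpret C: finite_measure "unit_cube :: (real ^ 'd) measure" by (rule finite_measure_unit_cube)
    interpret MC: pair_sigma_finite M "unit_cube :: (real ^ 'd) measure" ..
    interpret SC: pair_sigma_finite \<sigma> "unit_cube :: (real ^ 'd) measure" ..
    have "\<phi> \<in> L2 unit_cube" by (rule L2_bounded[OF finite_measure_unit_cube b1(1)]) (rule b1(2))
    moreover have "\<psi> \<in> L2 unit_cube" by (rule L2_bounded[OF finite_measure_unit_cube b2(1)]) (rule b2(2))
    ultimately have i: "integrable unit_cube (\<lambda>r. \<phi> r * cnj (\<psi> r))" by (rule L2_integrable_mult)
    show ?case
      using MC.integral_times[OF L2_integrable_mult[OF f_T[of n] f_T[of m]] i]
        SC.integral_times[OF L2_integrable_mult[OF char_L2[of "- n"] char_L2[of "- m"]] i] correlation[of n m]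
      by (simp add: L2_inner_def suspension_space_def mult_ac)
  next
    case (add G F G' F')
    note L = orbit_pair_L2[OF add(1)] orbit_pair_L2[OF add(2)] orbit_pair_L2[OF orbit_pair.base[OF b1(1,2), of T f n]]
    show ?case
      using L add.IH by (simp add: L2_inner_add_right)
  qed
next
  case (add G1 F1 G2 F2)
  note L = orbit_pair_L2[OF add(1)] orbit_pair_L2[OF add(2)] orbit_pair_L2[OF add.prems]
  show ?case
    using L add.IH[OF add.prems] by (simp add: L2_inner_add_left)
qed

sublocale L2_isometry P Q "orbit_pair T f"
proof (rule L2_isometry.intro)
  interpret M: finite_measure M by (rule finite_M)
  interpret S: finite_measure \<sigma> by (rule finite_sigma)
  interpret C: finite_measure "unit_cube :: (real ^ 'd) measure" by (rule finite_measure_unit_cube)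
  show "finite_measure P" "finite_measure Q"
    unfolding suspension_space_def by (intro finite_measure_pair_measure finite_M finite_sigma finite_measure_unit_cube)+
  show "orbit_pair T f (\<lambda>_. 0) (\<lambda>_. 0)"
    using orbit_pair.base[of "\<lambda>_. 0" 0 T f 0] by simp
  fix G F assume GF: "orbit_pair T f G F"
  show "L2_norm Q F = L2_norm P G"
    using orbit_pair_inner[OF GF GF] unfolding L2_inner_self of_real_eq_iff
    by (rule power2_eq_imp_eq) auto
qed (auto dest: orbit_pair_L2 orbit_pair.add orbit_pair_scale)

lemma susp_preserving: "measure_preserving Q Q (suspension T t)"
  unfolding suspension_space_def by (rule suspension_measure_preserving[OF finite_M T_preserving])

lemma susp_id_preserving: "measure_preserving P P (suspension (\<lambda>_ a. a) t)"
  by (rule suspension_measure_preserving[OF finite_sigma]) (simp add: measure_preserving_def distr_id2)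

lemma twist_measurable:
  assumes "G \<in> borel_measurable P"
  shows "twist t G \<in> borel_measurable P"
proof -
  have s: "(\<lambda>z. t + snd z) \<in> measurable P borel"
    by (intro borel_measurable_add measurable_unit_cubeD[OF measurable_snd]) simp
  have c: "(\<lambda>z. torus_char (fst z) (- n)) \<in> borel_measurable P" for n
    by (rule measurable_compose[OF measurable_fst L2_D(1)[OF char_L2]])
  have "(\<lambda>z. torus_char (fst z) (- int_part (t + snd z))) \<in> borel_measurable P"
    by (rule measurable_compose_countable[OF c measurable_compose[OF s measurable_int_part]])
  moreover have "(\<lambda>z. G (suspension (\<lambda>_ a. a) t z)) \<in> borel_measurable P"
    using susp_id_preserving[of t] assms by (auto simp: measure_preserving_def intro: measurable_compose)
  ultimately show ?thesis unfolding twist_def by simp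
qed

lemma twist_L2:
  assumes G: "G \<in> L2 P"
  shows "twist t G \<in> L2 P"
proof (rule L2_bounded_by_L2[OF twist_measurable[OF L2_D(1)[OF G]]])
  show "(\<lambda>z. G (suspension (\<lambda>_ a. a) t z)) \<in> L2 P"
    by (rule measure_preserving_L2[OF susp_id_preserving G])
  show "cmod (twist t G z) \<le> 1 * cmod (G (suspension (\<lambda>_ a. a) t z))" for z
    by (simp add: twist_def norm_mult)
qed

lemma twist_norm: "G \<in> L2 P \<Longrightarrow> L2_norm P (twist t G) = L2_norm P G"
  using measure_preserving_L2_norm[OF susp_id_preserving[of t] L2_D(1)[of G P]]
  by (simp add: L2_norm_def twist_def norm_mult)

lemma twist_diff: "twist t (\<lambda>z. G z - G' z) = (\<lambda>z. twist t G z - twist t G' z)"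
  by (simp add: twist_def right_diff_distrib)

text \<open>On the part of the cube where \<open>int_part (t + r) = m\<close>, both sides are the generators with index
  \<open>n + m\<close>, and only finitely many \<open>m\<close> occur.\<close>

lemma isom_twist_orbit_pair:
  assumes "orbit_pair T f G F"
  shows "isom (twist t G) (\<lambda>z. F (suspension T t z))"
  using assms
proof (induction rule: orbit_pair.induct)
  case (base \<phi> C n)
  obtain K where K: "finite K" "\<And>r. int_part r = 0 \<Longrightarrow> int_part (t + r) \<in> K"
    using finite_int_part_translates[of t] by metis
  define \<psi> where "\<psi> m r = (if int_part (t + r) = m then \<phi> (frac_part (t + r)) else 0)" for m r
  have r: "(\<lambda>r. t + r) \<in> measurable (unit_cube :: (real ^ 'd) measure) borel"
    by (intro borel_measurable_add measurable_unit_cubeD[OF measurable_ident_sets[OF refl]]) simp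
  have fr: "(\<lambda>r. frac_part (t + r)) \<in> measurable unit_cube unit_cube"
    by (rule measurable_unit_cubeI[OF measurable_compose[OF r measurable_frac_part]]) simp
  have [measurable]: "(\<lambda>r. int_part (t + r)) \<in> measurable unit_cube (count_space UNIV)"
    by (rule measurable_compose[OF r measurable_int_part])
  have [measurable]: "(\<lambda>r. \<phi> (frac_part (t + r))) \<in> borel_measurable unit_cube"
    by (rule measurable_compose[OF fr base(1)])
  have \<psi>: "\<psi> m \<in> borel_measurable unit_cube" for m unfolding \<psi>_def by measurable
  have "0 \<le> C" using base(2) norm_ge_zero[of "\<phi> undefined"] order_trans by blast
  then have "cmod (\<psi> m r) \<le> C" for m r
    using base(2) by (simp add: \<psi>_def)
  then have op: "orbit_pair T f (\<lambda>z. torus_char (fst z) (- (n + m)) * \<psi> m (snd z))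
      (\<lambda>z. f (T (n + m) (fst z)) * \<psi> m (snd z))" for m
    using orbit_pair.base[OF \<psi>[of m], of C T f "n + m"] by blast
  have sum: "(\<Sum>m\<in>K. c m * \<psi> m r) = c (int_part (t + r)) * \<phi> (frac_part (t + r))"
    if "r \<in> space unit_cube" for r c
  proof -
    have "(\<Sum>m\<in>K. c m * \<psi> m r) = (\<Sum>m\<in>K. if m = int_part (t + r) then c m * \<phi> (frac_part (t + r)) else 0)"
      by (rule sum.cong) (auto simp: \<psi>_def)
    also have "\<dots> = c (int_part (t + r)) * \<phi> (frac_part (t + r))"
      using K that by (simp add: space_unit_cube)
    finally show ?thesis .
  qed
  have "isom (\<lambda>z. \<Sum>m\<in>K. torus_char (fst z) (- (n + m)) * \<psi> m (snd z))
      (\<lambda>z. \<Sum>m\<in>K. f (T (n + m) (fst z)) * \<psi> m (snd z))" (is "isom ?G ?F")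
    by (rule isom_sum[OF K(1) E_imp_R[OF op]])
  then show ?case
  proof (rule isom_cong_AE)
    have L: "(\<lambda>z. torus_char (fst z) (- n) * \<phi> (snd z)) \<in> L2 P" "(\<lambda>z. f (T n (fst z)) * \<phi> (snd z)) \<in> L2 Q"
      using orbit_pair_L2[OF orbit_pair.base[OF base(1,2), of T f n]] by auto
    show "twist t (\<lambda>z. torus_char (fst z) (- n) * \<phi> (snd z)) \<in> borel_measurable P"
      by (rule L2_D(1)[OF twist_L2[OF L(1)]])
    show "(\<lambda>z. f (T n (fst (suspension T t z))) * \<phi> (snd (suspension T t z))) \<in> borel_measurable Q"
      by (rule L2_D(1)[OF measure_preserving_L2[OF susp_preserving L(2)]])
    show "AE z in P. twist t (\<lambda>z. torus_char (fst z) (- n) * \<phi> (snd z)) z = ?G z"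
    proof (rule AE_I2)
      fix z assume "z \<in> space P"
      then have "snd z \<in> space unit_cube" by (auto simp: space_pair_measure)
      then show "twist t (\<lambda>z. torus_char (fst z) (- n) * \<phi> (snd z)) z = ?G z"
        using sum[of "snd z" "\<lambda>m. torus_char (fst z) (- (n + m))"]
          torus_char_add[of "fst z" "- n" "- int_part (t + snd z)"]
        by (simp add: twist_def suspension_eq split_beta mult.commute)
    qed
    show "AE z in Q. f (T n (fst (suspension T t z))) * \<phi> (snd (suspension T t z)) = ?F z"
    proof (rule AE_I2)
      fix z assume "z \<in> space Q"
      then have "snd z \<in> space unit_cube" "fst z \<in> space M" by (auto simp: suspension_space_def space_pair_measure)
      then show "f (T n (fst (suspension T t z))) * \<phi> (snd (suspension T t z)) = ?F z"
        using sum[of "snd z" "\<lambda>m. f (T (n + m) (fst z))"]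
        by (simp add: T_add suspension_eq split_beta)
    qed
  qed
next
  case (add G F G' F')
  then show ?case using isom_add[OF add.IH] by (simp add: twist_def distrib_left)
qed

lemma isom_twist:
  assumes "isom G F"
  shows "isom (twist t G) (\<lambda>z. F (suspension T t z))"
proof (rule isom_limit)
  note L = isom_L2[OF assms]
  show "twist t G \<in> L2 P" by (rule twist_L2[OF L(1)])
  show "(\<lambda>z. F (suspension T t z)) \<in> L2 Q" by (rule measure_preserving_L2[OF susp_preserving L(2)])
  fix e :: real assume e: "e > 0"
  obtain G0 F0 where 0: "orbit_pair T f G0 F0" "L2_norm P (\<lambda>x. G x - G0 x) < e"
    "L2_norm Q (\<lambda>y. F y - F0 y) < e" "G0 \<in> L2 P" "F0 \<in> L2 Q"
    by (rule isom_approx[OF assms e])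
  have "L2_norm P (\<lambda>z. twist t G z - twist t G0 z) < e"
    using twist_norm[OF L2_diff[OF L(1) 0(4)], of t] 0(2) by (simp add: twist_diff)
  moreover have "L2_norm Q (\<lambda>z. F (suspension T t z) - F0 (suspension T t z)) < e"
    using measure_preserving_L2_norm[OF susp_preserving L2_D(1)[OF L2_diff[OF L(2) 0(5)]], of t] 0(3) by simp
  ultimately show "\<exists>G' F'. isom G' F' \<and> L2_norm P (\<lambda>x. twist t G x - G' x) < e \<and>
      L2_norm Q (\<lambda>y. F (suspension T t y) - F' y) < e"
    using isom_twist_orbit_pair[OF 0(1), of t] by blast
qed

lemma isom_eigen_image:
  assumes R: "isom G F" and eig: "AE z in P. twist t G z = c * G z"
  shows "AE z in Q. F (suspension T t z) = c * F z"
proof -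
  have R': "isom (\<lambda>z. twist t G z - c * G z) (\<lambda>z. F (suspension T t z) - c * F z)"
    by (rule isom_diff[OF isom_twist[OF R] isom_scale[OF R]])
  have "AE z in P. twist t G z - c * G z = 0" using eig by eventually_elim simp
  then have "L2_norm Q (\<lambda>z. F (suspension T t z) - c * F z) = 0"
    using isom_norm[OF R'] L2_norm_eq_0_iff[OF isom_L2(1)[OF R']] by simp
  then have "AE z in Q. F (suspension T t z) - c * F z = 0"
    using L2_norm_eq_0_iff[OF isom_L2(2)[OF R']] by simp
  then show ?thesis by eventually_elim simp
qed

text \<open>The cyclic space is invariant under \<open>suspension T (- t)\<close>, the adjoint of \<open>suspension T t\<close>.  Hence its
  orthogonal complement is invariant under \<open>suspension T t\<close>, and the eigenvalue equation for \<open>F\<close> splits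
  into one for the projection \<open>F'\<close> and one for \<open>F - F'\<close>.\<close>

lemma isom_eigen_of_projection:
  assumes F: "F \<in> L2 Q" and R: "isom G F'"
    and orth: "\<And>G0 F0. orbit_pair T f G0 F0 \<Longrightarrow> L2_inner Q (\<lambda>y. F y - F' y) F0 = 0"
    and eig: "AE z in Q. F (suspension T t z) = c * F z"
  shows "AE z in P. twist t G z = c * G z"
proof -
  note F' = isom_L2(2)[OF R]
  define H where "H z = F z - F' z" for z
  have H: "H \<in> L2 Q" unfolding H_def by (rule L2_diff[OF F F'])
  have H_orth: "L2_inner Q H F0 = 0" if "orbit_pair T f G0 F0" for G0 F0
    using orth[OF that] by (simp add: H_def[abs_def])
  have Ht: "(\<lambda>z. H (suspension T t z)) \<in> L2 Q" by (rule measure_preserving_L2[OF susp_preserving H])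
  have cH: "(\<lambda>z. c * H z) \<in> L2 Q" by (rule L2_scale[OF H])
  have R': "isom (\<lambda>z. twist t G z - c * G z) (\<lambda>z. F' (suspension T t z) - c * F' z)"
    by (rule isom_diff[OF isom_twist[OF R] isom_scale[OF R]])
  have "L2_inner Q (\<lambda>z. F' (suspension T t z) - c * F' z) F0 = 0" if 0: "orbit_pair T f G0 F0" for G0 F0
  proof -
    have F0: "F0 \<in> L2 Q" using orbit_pair_L2[OF 0] by simp
    have bk: "isom (twist (- t) G0) (\<lambda>z. F0 (suspension T (- t) z))" by (rule isom_twist_orbit_pair[OF 0])
    have "L2_inner Q (\<lambda>z. H (suspension T t z)) F0 =
        L2_inner Q (\<lambda>z. H (suspension T t z)) (\<lambda>z. F0 (suspension T (- t) (suspension T t z)))"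
      unfolding L2_inner_def using suspension_inverse[OF T, of _ "- t"]
      by (intro Bochner_Integration.integral_cong) (auto simp: suspension_space_def)
    also have "\<dots> = L2_inner Q H (\<lambda>z. F0 (suspension T (- t) z))"
      by (rule measure_preserving_L2_inner[OF susp_preserving H isom_L2(2)[OF bk]])
    also have "\<dots> = 0"
      by (rule isom_inner_zero[OF bk H H_orth])
    finally have 1: "L2_inner Q (\<lambda>z. H (suspension T t z)) F0 = 0" .
    have 2: "L2_inner Q (\<lambda>z. c * H z) F0 = 0"
      using H_orth[OF 0] by (simp add: L2_inner_scale_left)
    have m: "(\<lambda>z. F' (suspension T t z) - c * F' z) \<in> borel_measurable Q"
        "(\<lambda>z. c * H z - H (suspension T t z)) \<in> borel_measurable Q" "F0 \<in> borel_measurable Q"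
      using L2_D(1)[OF isom_L2(2)[OF R']] L2_D(1)[OF L2_diff[OF cH Ht]] L2_D(1)[OF F0] by auto
    have "L2_inner Q (\<lambda>z. F' (suspension T t z) - c * F' z) F0 = L2_inner Q (\<lambda>z. c * H z - H (suspension T t z)) F0"
      unfolding L2_inner_def
    proof (rule integral_cong_AE)
      show "AE z in Q. (F' (suspension T t z) - c * F' z) * cnj (F0 z) = (c * H z - H (suspension T t z)) * cnj (F0 z)"
        using eig by eventually_elim (simp add: H_def algebra_simps)
    qed (use m in measurable)
    also have "\<dots> = 0" using L2_inner_diff_left[OF cH Ht F0] 1 2 by simp
    finally show ?thesis .
  qed
  from isom_orthogonal_zero[OF R' this] have "AE z in P. twist t G z - c * G z = 0" by simp
  then show ?thesis by eventually_elim simp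
qed

text \<open>Orthogonality to the functions of the cube variable passes to limits, and for a generator it follows
  from \<open>f \<circ> T n\<close> having the same integral as \<open>f\<close>, namely 0.\<close>

lemma isom_L2_O:
  assumes R: "isom G F" and f0: "f \<in> L2_0 M"
  shows "F \<in> L2_O M"
proof -
  have "L2_inner Q F h = 0" if h: "h \<in> fibre_functions" for h
  proof -
    interpret M: prob_space M by (rule prob_M)
    interpret C: finite_measure "unit_cube :: (real ^ 'd) measure" by (rule finite_measure_unit_cube)
    interpret MC: pair_sigma_finite M "unit_cube :: (real ^ 'd) measure" ..
    obtain k where k': "h = (\<lambda>(x, s). k s)" and k2: "k \<in> L2 unit_cube" using h by (auto simp: fibre_functions_def)
    have k: "h = (\<lambda>z. k (snd z))" "k \<in> L2 unit_cube" using k' k2 by auto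
    have hL: "h \<in> L2 Q"
      using L2_times[OF finite_M finite_measure_unit_cube, of "\<lambda>_. 1" k] k
      by (simp add: suspension_space_def L2_def)
    have fT0: "(\<integral>x. f (T n x) \<partial>M) = 0" for n
    proof -
      have "L2_inner M f (\<lambda>_. 1) = 0" using f0 by (auto simp: L2_0_def L2_orth_def)
      then show ?thesis
        using measure_preserving_integral[OF T_preserving L2_D(1)[OF f], of n] by (simp add: L2_inner_def)
    qed
    have "L2_inner Q h F0 = 0" if "orbit_pair T f G0 F0" for G0 F0
      using that
    proof (induction rule: orbit_pair.induct)
      case (base \<phi> C n)
      have \<phi>: "\<phi> \<in> L2 unit_cube" by (rule L2_bounded[OF finite_measure_unit_cube base(1)]) (rule base(2))
      have "(\<lambda>_. 1) \<in> L2 M" by (simp add: L2_def)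
      then have i: "integrable M (\<lambda>x. f (T n x))" using L2_integrable_mult[OF f_T[of n]] by fastforce
      have "L2_inner Q (\<lambda>z. f (T n (fst z)) * \<phi> (snd z)) h = 0"
        using MC.integral_times[OF i L2_integrable_mult[OF \<phi> k(2)]] fT0[of n]
        by (simp add: L2_inner_def suspension_space_def k(1) mult_ac)
      then show ?case by (subst L2_inner_commute) simp
    next
      case (add G F G' F')
      then show ?case
        using L2_inner_add_right[OF _ _ hL, of F F'] orbit_pair_L2[OF add(1)] orbit_pair_L2[OF add(2)] by simp
    qed
    from isom_inner_zero[OF R hL this] show ?thesis
      by (subst L2_inner_commute) simp
  qed
  then show ?thesis
    using isom_L2(2)[OF R] by (simp add: L2_O_def L2_orth_def)
qed

end

section \<open>Density of algebras of bounded functions\<close>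

lemma L2_norm_dominated_convergence:
  fixes u :: "nat \<Rightarrow> 'a \<Rightarrow> complex" and w :: "'a \<Rightarrow> real"
  assumes u: "\<And>k. u k \<in> borel_measurable M" and v: "v \<in> borel_measurable M"
    and w: "integrable M (\<lambda>x. (w x)\<^sup>2)"
    and le: "\<And>k x. x \<in> space M \<Longrightarrow> cmod (v x - u k x) \<le> w x"
    and lim: "\<And>x. x \<in> space M \<Longrightarrow> (\<lambda>k. u k x) \<longlonglongrightarrow> v x"
  shows "(\<lambda>k. L2_norm M (\<lambda>x. v x - u k x)) \<longlonglongrightarrow> 0"
proof -
  have [measurable]: "u k \<in> borel_measurable M" "v \<in> borel_measurable M" for k by (fact u v)+
  have "(\<lambda>k. \<integral>x. (cmod (v x - u k x))\<^sup>2 \<partial>M) \<longlonglongrightarrow> (\<integral>x. 0 \<partial>M)"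
  proof (rule integral_dominated_convergence[OF _ _ w])
    show "AE x in M. (\<lambda>k. (cmod (v x - u k x))\<^sup>2) \<longlonglongrightarrow> 0"
    proof (rule AE_I2)
      fix x assume "x \<in> space M"
      from tendsto_power[OF tendsto_norm[OF tendsto_diff[OF tendsto_const[of "v x"] lim[OF this]]], of 2]
      show "(\<lambda>k. (cmod (v x - u k x))\<^sup>2) \<longlonglongrightarrow> 0" by simp
    qed
    show "AE x in M. norm ((cmod (v x - u k x))\<^sup>2) \<le> (w x)\<^sup>2" for k
      using le by (intro AE_I2) (simp add: power_mono)
  qed auto
  then have "(\<lambda>k. sqrt (\<integral>x. (cmod (v x - u k x))\<^sup>2 \<partial>M)) \<longlonglongrightarrow> sqrt 0"
    by (intro tendsto_real_sqrt) simp
  then show ?thesis by (simp add: L2_norm_def)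
qed

text \<open>A functional form of the monotone class argument: the bounded functions that are \<open>L\<^sup>2\<close>-limits of elements
  of an algebra \<open>D\<close> are closed under products and bounded pointwise limits, so the sets whose indicators
  are such limits form a \<open>\<sigma>\<close>-algebra.  If it contains all measurable sets, \<open>D\<close> is dense.\<close>

locale bounded_function_algebra =
  fixes P :: "'p measure" and D :: "('p \<Rightarrow> complex) \<Rightarrow> bool"
  assumes finite_P: "finite_measure P"
    and D_measurable: "D G \<Longrightarrow> G \<in> borel_measurable P"
    and D_bounded: "D G \<Longrightarrow> \<exists>C. \<forall>z. cmod (G z) \<le> C"
    and D_one: "D (\<lambda>_. 1)"
    and D_add: "D G \<Longrightarrow> D H \<Longrightarrow> D (\<lambda>z. G z + H z)"
    and D_scale: "D G \<Longrightarrow> D (\<lambda>z. c * G z)"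
    and D_mult: "D G \<Longrightarrow> D H \<Longrightarrow> D (\<lambda>z. G z * H z)"
begin

definition approximable :: "('p \<Rightarrow> complex) \<Rightarrow> bool" where
  "approximable h \<longleftrightarrow> h \<in> borel_measurable P \<and> (\<exists>C. \<forall>z\<in>space P. cmod (h z) \<le> C) \<and>
     (\<forall>e>0. \<exists>G. D G \<and> L2_norm P (\<lambda>z. h z - G z) < e)"

lemma approximableI:
  assumes "h \<in> borel_measurable P" "\<And>z. z \<in> space P \<Longrightarrow> cmod (h z) \<le> C"
    "\<And>e. e > 0 \<Longrightarrow> \<exists>G. D G \<and> L2_norm P (\<lambda>z. h z - G z) < e"
  shows "approximable h"
  using assms unfolding approximable_def by blast

lemma approximableD:
  assumes "approximable h"
  shows "h \<in> borel_measurable P" and "\<exists>C. C > 0 \<and> (\<forall>z\<in>space P. cmod (h z) \<le> C)"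
    and "e > 0 \<Longrightarrow> \<exists>G. D G \<and> L2_norm P (\<lambda>z. h z - G z) < e" and "h \<in> L2 P"
proof -
  show m: "h \<in> borel_measurable P" using assms by (simp add: approximable_def)
  obtain C where C: "\<forall>z\<in>space P. cmod (h z) \<le> C" using assms by (auto simp: approximable_def)
  then have "\<forall>z\<in>space P. cmod (h z) \<le> max C 1" by (auto simp: le_max_iff_disj)
  then show "\<exists>C. C > 0 \<and> (\<forall>z\<in>space P. cmod (h z) \<le> C)" by (intro exI[of _ "max C 1"]) auto
  show "h \<in> L2 P" by (rule L2_bounded[OF finite_P m]) (use C in auto)
  show "e > 0 \<Longrightarrow> \<exists>G. D G \<and> L2_norm P (\<lambda>z. h z - G z) < e" using assms by (simp add: approximable_def)
qed

lemma D_L2: "D G \<Longrightarrow> G \<in> L2 P"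
  using D_bounded[of G] L2_bounded[OF finite_P D_measurable[of G]] by blast

lemma D_approximable:
  assumes "D G"
  shows "approximable G"
proof -
  obtain C where "\<forall>z. cmod (G z) \<le> C" using D_bounded[OF assms] by blast
  moreover have "L2_norm P (\<lambda>z. G z - G z) = 0" by (simp add: L2_norm_def)
  ultimately show ?thesis
    using assms by (intro approximableI[of _ C] D_measurable) (auto intro!: exI[of _ G])
qed

lemma approximable_cong:
  assumes "approximable h" "\<And>z. z \<in> space P \<Longrightarrow> g z = h z"
  shows "approximable g"
proof -
  have "L2_norm P (\<lambda>z. g z - G z) = L2_norm P (\<lambda>z. h z - G z)" for G
    by (rule L2_norm_cong) (simp add: assms(2))
  then show ?thesis
    using assms measurable_cong[of P g h borel] unfolding approximable_def by auto
qed

lemma approximable_add: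
  assumes h: "approximable h" and g: "approximable g"
  shows "approximable (\<lambda>z. h z + g z)"
proof -
  obtain A B where AB: "\<And>z. z \<in> space P \<Longrightarrow> cmod (h z) \<le> A" "\<And>z. z \<in> space P \<Longrightarrow> cmod (g z) \<le> B"
    using approximableD(2)[OF h] approximableD(2)[OF g] by blast
  show ?thesis
  proof (rule approximableI[of _ "A + B"])
    show "(\<lambda>z. h z + g z) \<in> borel_measurable P"
      using approximableD(1)[OF h] approximableD(1)[OF g] by simp
    show "cmod (h z + g z) \<le> A + B" if "z \<in> space P" for z
      using norm_triangle_mono[OF AB(1)[OF that] AB(2)[OF that]] .
    fix e :: real assume "e > 0"
    then have e: "e / 2 > 0" by simp
    obtain G1 where G1: "D G1" "L2_norm P (\<lambda>z. h z - G1 z) < e/2" using approximableD(3)[OF h e] by blast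
    obtain G2 where G2: "D G2" "L2_norm P (\<lambda>z. g z - G2 z) < e/2" using approximableD(3)[OF g e] by blast
    have "L2_norm P (\<lambda>z. (h z - G1 z) + (g z - G2 z)) < e"
      using L2_norm_triangle[OF L2_diff[OF approximableD(4)[OF h] D_L2[OF G1(1)]]
          L2_diff[OF approximableD(4)[OF g] D_L2[OF G2(1)]]] G1 G2 by linarith
    then show "\<exists>G. D G \<and> L2_norm P (\<lambda>z. h z + g z - G z) < e"
      using D_add[OF G1(1) G2(1)] by (intro exI[of _ "\<lambda>z. G1 z + G2 z"]) (simp add: algebra_simps)
  qed
qed

text \<open>Approximate the first factor first: the second factor is bounded, and so is the element of the
  algebra that replaces the first factor.\<close>

lemma approximable_mult:
  assumes h: "approximable h" and g: "approximable g"
  shows "approximable (\<lambda>z. h z * g z)"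
proof -
  obtain A B where A: "\<And>z. z \<in> space P \<Longrightarrow> cmod (h z) \<le> A" "A > 0"
    and B: "\<And>z. z \<in> space P \<Longrightarrow> cmod (g z) \<le> B" "B > 0"
    using approximableD(2)[OF h] approximableD(2)[OF g] by blast
  have scaled: "L2_norm P (\<lambda>z. a z * b z) \<le> C * L2_norm P a"
    if a: "a \<in> L2 P" and b: "b \<in> borel_measurable P" and C: "\<And>z. z \<in> space P \<Longrightarrow> cmod (b z) \<le> C" "C > 0"
    for a b C
  proof (rule power2_le_imp_le)
    have [measurable]: "a \<in> borel_measurable P" "b \<in> borel_measurable P" using L2_D(1)[OF a] b by auto
    have le: "(cmod (a z * b z))\<^sup>2 \<le> C\<^sup>2 * (cmod (a z))\<^sup>2" if "z \<in> space P" for z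
      using mult_right_mono[OF power_mono[OF C(1)[OF that], of 2], of "(cmod (a z))\<^sup>2"]
      by (simp add: norm_mult power_mult_distrib mult.commute)
    have i: "integrable P (\<lambda>z. C\<^sup>2 * (cmod (a z))\<^sup>2)" using L2_D(2)[OF a] by simp
    have "integrable P (\<lambda>z. (cmod (a z * b z))\<^sup>2)"
      by (rule Bochner_Integration.integrable_bound[OF i]) (use le in auto)
    then have "(\<integral>z. (cmod (a z * b z))\<^sup>2 \<partial>P) \<le> (\<integral>z. C\<^sup>2 * (cmod (a z))\<^sup>2 \<partial>P)"
      by (rule integral_mono[OF _ i]) (rule le)
    then show "(L2_norm P (\<lambda>z. a z * b z))\<^sup>2 \<le> (C * L2_norm P a)\<^sup>2"
      by (simp add: L2_norm_power2 power_mult_distrib)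
  qed (use C in simp)
  show ?thesis
  proof (rule approximableI[of _ "A * B"])
    show "(\<lambda>z. h z * g z) \<in> borel_measurable P"
      using approximableD(1)[OF h] approximableD(1)[OF g] by simp
    show "cmod (h z * g z) \<le> A * B" if "z \<in> space P" for z
      unfolding norm_mult using A B that by (intro mult_mono) auto
    fix e :: real assume e: "e > 0"
    have "e / (2 * B) > 0" using e B by simp
    then obtain G1 where G1: "D G1" "L2_norm P (\<lambda>z. h z - G1 z) < e / (2 * B)" using approximableD(3)[OF h] by blast
    obtain C where C: "\<And>z. cmod (G1 z) \<le> C" "C > 0"
      using approximableD(2)[OF D_approximable[OF G1(1)]] D_bounded[OF G1(1)]
      by (metis less_max_iff_disj max.coboundedI1 zero_less_one)
    have "e / (2 * C) > 0" using e C by simp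
    then obtain G2 where G2: "D G2" "L2_norm P (\<lambda>z. g z - G2 z) < e / (2 * C)" using approximableD(3)[OF g] by blast
    note L = L2_diff[OF approximableD(4)[OF h] D_L2[OF G1(1)]] L2_diff[OF approximableD(4)[OF g] D_L2[OF G2(1)]]
    have 1: "L2_norm P (\<lambda>z. (h z - G1 z) * g z) < e / 2"
    proof -
      have "L2_norm P (\<lambda>z. (h z - G1 z) * g z) \<le> B * L2_norm P (\<lambda>z. h z - G1 z)"
        by (rule scaled[OF L(1) approximableD(1)[OF g] B])
      also have "\<dots> < B * (e / (2 * B))" using G1(2) B by (intro mult_strict_left_mono) auto
      finally show ?thesis using B by simp
    qed
    have 2: "L2_norm P (\<lambda>z. (g z - G2 z) * G1 z) < e / 2"
    proof -
      have "L2_norm P (\<lambda>z. (g z - G2 z) * G1 z) \<le> C * L2_norm P (\<lambda>z. g z - G2 z)"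
        by (rule scaled[OF L(2) D_measurable[OF G1(1)] C])
      also have "\<dots> < C * (e / (2 * C))" using G2(2) C by (intro mult_strict_left_mono) auto
      finally show ?thesis using C by simp
    qed
    have m1: "(\<lambda>z. (h z - G1 z) * g z) \<in> L2 P"
      by (rule L2_bounded_by_L2[OF _ L(1), of _ B])
        (use L2_D(1)[OF L(1)] approximableD(1)[OF g] B in \<open>auto simp: norm_mult mult.commute mult_right_mono\<close>)
    have m2: "(\<lambda>z. (g z - G2 z) * G1 z) \<in> L2 P"
      by (rule L2_bounded_by_L2[OF _ L(2), of _ C])
        (use L2_D(1)[OF L(2)] D_measurable[OF G1(1)] C in \<open>auto simp: norm_mult mult.commute mult_right_mono\<close>)
    have "L2_norm P (\<lambda>z. (h z - G1 z) * g z + (g z - G2 z) * G1 z) < e"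
      using L2_norm_triangle[OF m1 m2] 1 2 by linarith
    then show "\<exists>G. D G \<and> L2_norm P (\<lambda>z. h z * g z - G z) < e"
      using D_mult[OF G1(1) G2(1)] by (intro exI[of _ "\<lambda>z. G1 z * G2 z"]) (simp add: algebra_simps)
  qed
qed

lemma approximable_const: "approximable (\<lambda>_. c)"
  using D_approximable[OF D_scale[OF D_one, of c]] by simp

lemma approximable_scale: "approximable h \<Longrightarrow> approximable (\<lambda>z. c * h z)"
  by (rule approximable_mult[OF approximable_const])

lemma approximable_sum:
  "finite I \<Longrightarrow> (\<And>i. i \<in> I \<Longrightarrow> approximable (h i)) \<Longrightarrow> approximable (\<lambda>z. \<Sum>i\<in>I. h i z)"
  by (induction I rule: finite_induct) (simp_all add: approximable_add approximable_const)

lemma L2_limit_approximable: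
  assumes h: "\<And>k::nat. approximable (h k)" and g: "g \<in> L2 P"
    and lim: "(\<lambda>k. L2_norm P (\<lambda>z. g z - h k z)) \<longlonglongrightarrow> 0" and e: "e > 0"
  shows "\<exists>G. D G \<and> L2_norm P (\<lambda>z. g z - G z) < e"
proof -
  have "e / 2 > 0" using e by simp
  then obtain k where k: "L2_norm P (\<lambda>z. g z - h k z) < e / 2"
    using order_tendstoD(2)[OF lim] unfolding eventually_sequentially by blast
  obtain G where G: "D G" "L2_norm P (\<lambda>z. h k z - G z) < e/2"
    using approximableD(3)[OF h[of k] \<open>e / 2 > 0\<close>] by blast
  then show ?thesis
    using L2_dist_triangle[OF g approximableD(4)[OF h[of k]] D_L2[OF G(1)]] k
    by (intro exI[of _ G]) linarith
qed

lemma approximable_limit: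
  fixes h :: "nat \<Rightarrow> 'p \<Rightarrow> complex"
  assumes h: "\<And>k. approximable (h k)" and C: "\<And>k z. z \<in> space P \<Longrightarrow> cmod (h k z) \<le> C"
    and lim: "\<And>z. z \<in> space P \<Longrightarrow> (\<lambda>k. h k z) \<longlonglongrightarrow> g z"
  shows "approximable g"
proof -
  have g: "g \<in> borel_measurable P"
    by (rule borel_measurable_LIMSEQ_metric[OF approximableD(1)[OF h] lim])
  have gC: "cmod (g z) \<le> C" if "z \<in> space P" for z
    by (rule LIMSEQ_le_const2[OF tendsto_norm[OF lim[OF that]]]) (use C that in auto)
  interpret finite_measure P by (rule finite_P)
  have "(\<lambda>k. L2_norm P (\<lambda>z. g z - h k z)) \<longlonglongrightarrow> 0"
  proof (rule L2_norm_dominated_convergence[OF approximableD(1)[OF h] g _ _ lim])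
    show "integrable P (\<lambda>z. (C + C)\<^sup>2)" by simp
    show "cmod (g z - h k z) \<le> C + C" if "z \<in> space P" for k z
      using norm_triangle_ineq4[of "g z" "h k z"] gC[OF that] C[OF that, of k] by linarith
  qed
  from L2_limit_approximable[OF h L2_bounded[OF finite_P g gC] this] show ?thesis
    by (intro approximableI[OF g gC])
qed

definition approximable_sets :: "'p set set" where
  "approximable_sets = {A \<in> sets P. approximable (indicator A)}"

lemma sigma_algebra_approximable_sets: "sigma_algebra (space P) approximable_sets"
  unfolding sigma_algebra_iff2
proof (intro conjI ballI allI impI)
  show "approximable_sets \<subseteq> Pow (space P)"
    using sets.sets_into_space by (auto simp: approximable_sets_def)
  show "{} \<in> approximable_sets"
    using approximable_const[of 0] by (simp add: approximable_sets_def indicator_def[abs_def])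
  have compl: "space P - A \<in> approximable_sets" if "A \<in> approximable_sets" for A
  proof -
    have "approximable (\<lambda>z. 1 + (-1) * indicator A z)"
      using that by (intro approximable_add approximable_const approximable_scale) (simp add: approximable_sets_def)
    then have "approximable (indicator (space P - A))"
      by (rule approximable_cong) (auto simp: indicator_def)
    then show ?thesis using that by (auto simp: approximable_sets_def)
  qed
  then show "space P - A \<in> approximable_sets" if "A \<in> approximable_sets" for A using that .
  have un: "A \<union> B \<in> approximable_sets" if "A \<in> approximable_sets" "B \<in> approximable_sets" for A B
  proof -
    have "approximable (\<lambda>z. indicator A z + indicator B z + (-1) * (indicator A z * indicator B z))"
      using that by (intro approximable_add approximable_scale approximable_mult) (simp_all add: approximable_sets_def)
    then have "approximable (indicator (A \<union> B))"
      by (rule approximable_cong) (auto simp: indicator_def)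
    then show ?thesis using that by (auto simp: approximable_sets_def)
  qed
  fix A :: "nat \<Rightarrow> 'p set" assume A: "range A \<subseteq> approximable_sets"
  have fin: "(\<Union>i<k. A i) \<in> approximable_sets" for k
  proof (induction k)
    case 0
    show ?case using \<open>{} \<in> approximable_sets\<close> by simp
  next
    case (Suc k)
    have "(\<Union>i<Suc k. A i) = (\<Union>i<k. A i) \<union> A k" by (auto simp: less_Suc_eq)
    moreover have "A k \<in> approximable_sets" using A by blast
    ultimately show ?case using un[OF Suc] by metis
  qed
  have "approximable (indicator (\<Union>i. A i))"
  proof (rule approximable_limit[of "\<lambda>k. indicator (\<Union>i<k. A i)" 1])
    show "approximable (indicator (\<Union>i<k. A i))" for k using fin[of k] by (simp add: approximable_sets_def)
    show "(\<lambda>k. indicator (\<Union>i<k. A i) z :: complex) \<longlonglongrightarrow> indicator (\<Union>i. A i) z" for z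
      by (rule LIMSEQ_indicator_UN)
  qed (auto simp: indicator_def)
  then show "(\<Union>i. A i) \<in> approximable_sets" using A by (auto simp: approximable_sets_def)
qed

abbreviation "approximable_algebra \<equiv> sigma (space P) approximable_sets"

lemma sets_approximable_algebra: "sets approximable_algebra = approximable_sets"
  by (rule sigma_algebra.sets_measure_of_eq[OF sigma_algebra_approximable_sets])

lemma space_approximable_algebra [simp]: "space approximable_algebra = space P"
  by (simp add: space_measure_of_conv)

text \<open>By the Weierstrass theorem a continuous function of an approximable real function is
  approximable, and indicators of superlevel sets are limits of such functions.\<close>

lemma approximable_continuous:
  fixes g :: "'p \<Rightarrow> real" and q :: "real \<Rightarrow> real"
  assumes g: "approximable (\<lambda>z. of_real (g z))" and q: "continuous_on UNIV q"
  shows "approximable (\<lambda>z. of_real (q (g z)))"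
proof -
  obtain C where C: "\<And>z. z \<in> space P \<Longrightarrow> \<bar>g z\<bar> \<le> C"
    using approximableD(2)[OF g] by (metis norm_of_real real_norm_def)
  have poly: "approximable (\<lambda>z. of_real (p (g z)))" if "real_polynomial_function p" for p :: "real \<Rightarrow> real"
    using that
  proof (induction rule: real_polynomial_function.induct)
    case (linear p)
    have "p x = x * p 1" for x
      using linear_cmul[OF bounded_linear.linear[OF linear], of x 1] by simp
    then have "(\<lambda>z. complex_of_real (p (g z))) = (\<lambda>z. of_real (p 1) * of_real (g z))"
      by (metis mult.commute of_real_mult)
    then show ?case using approximable_scale[OF g, of "of_real (p 1)"] by simp
  next
    case (const c)
    show ?case by (rule approximable_const)
  next
    case (add p p')
    then show ?case using approximable_add[OF add.IH] by simp
  next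
    case (mult p p')
    then show ?case using approximable_mult[OF mult.IH] by simp
  qed
  have qC: "continuous_on {-C..C} q" using q continuous_on_subset by blast
  have "\<exists>p. real_polynomial_function p \<and> (\<forall>x\<in>{-C..C}. \<bar>q x - p x\<bar> < inverse (real (Suc k)))" for k
    by (rule Stone_Weierstrass_real_polynomial_function[OF compact_Icc qC, of "inverse (real (Suc k))"]) auto
  then obtain p where p: "\<And>k. real_polynomial_function (p k)"
    "\<And>k x. x \<in> {-C..C} \<Longrightarrow> \<bar>q x - p k x\<bar> < inverse (real (Suc k))"
    by metis
  have "bounded (q ` {-C..C})" by (intro compact_imp_bounded compact_continuous_image qC compact_Icc)
  then obtain B where B: "\<forall>x\<in>{-C..C}. \<bar>q x\<bar> \<le> B" by (auto simp: bounded_iff)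
  have gC: "g z \<in> {-C..C}" if "z \<in> space P" for z using C[OF that] by auto
  show ?thesis
  proof (rule approximable_limit[of "\<lambda>k z. of_real (p k (g z))" "B + 1"])
    show "approximable (\<lambda>z. of_real (p k (g z)))" for k by (rule poly[OF p(1)])
    show "cmod (of_real (p k (g z))) \<le> B + 1" if "z \<in> space P" for k z
    proof -
      have "inverse (real (Suc k)) \<le> 1" by (simp add: inverse_le_1_iff)
      then show ?thesis using p(2)[OF gC[OF that], of k] bspec[OF B gC[OF that]] by simp
    qed
    show "(\<lambda>k. complex_of_real (p k (g z))) \<longlonglongrightarrow> of_real (q (g z))" if "z \<in> space P" for z
    proof (rule tendsto_of_real)
      have "(\<lambda>k. p k (g z) - q (g z)) \<longlonglongrightarrow> 0"
      proof (rule Lim_null_comparison[OF _ LIMSEQ_inverse_real_of_nat])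
        show "\<forall>\<^sub>F k in sequentially. norm (p k (g z) - q (g z)) \<le> inverse (real (Suc k))"
          using p(2)[OF gC[OF that]] by (intro always_eventually) (auto simp: abs_minus_commute intro: less_imp_le)
      qed
      then show "(\<lambda>k. p k (g z)) \<longlonglongrightarrow> q (g z)" by (simp add: LIM_zero_iff)
    qed
  qed
qed

lemma approximable_real_measurable:
  fixes g :: "'p \<Rightarrow> real"
  assumes g: "approximable (\<lambda>z. of_real (g z))"
  shows "g \<in> borel_measurable approximable_algebra"
proof (subst borel_measurable_iff_greater, intro allI)
  fix c :: real
  define q where "q k x = min 1 (real k * max 0 (x - c))" for k x
  have "approximable (indicator {z \<in> space P. c < g z})"
  proof (rule approximable_limit[of "\<lambda>k z. of_real (q k (g z))" 1])
    show "approximable (\<lambda>z. of_real (q k (g z)))" for k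
      by (rule approximable_continuous[OF g]) (auto simp: q_def[abs_def] intro!: continuous_intros)
    show "cmod (of_real (q k (g z))) \<le> 1" for k z by (simp add: q_def)
    show "(\<lambda>k. complex_of_real (q k (g z))) \<longlonglongrightarrow> indicator {z \<in> space P. c < g z} z" if z: "z \<in> space P" for z
    proof (cases "c < g z")
      case True
      obtain K :: nat where K: "1 / (g z - c) < real K" using reals_Archimedean2 by blast
      have "q k (g z) = 1" if "k \<ge> K" for k
      proof -
        have "1 / (g z - c) \<le> real k" using K that by linarith
        then have "1 \<le> real k * (g z - c)" using True by (simp add: pos_divide_le_eq)
        then show ?thesis using True by (simp add: q_def)
      qed
      then have "\<forall>\<^sub>F k in sequentially. complex_of_real (q k (g z)) = 1"
        unfolding eventually_sequentially by auto
      then show ?thesis using True z by (simp add: tendsto_eventually)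
    next
      case False
      then show ?thesis by (simp add: q_def)
    qed
  qed
  moreover have "{z \<in> space P. c < g z} \<in> sets P"
  proof -
    have [measurable]: "(\<lambda>z. complex_of_real (g z)) \<in> borel_measurable P" by (rule approximableD(1)[OF g])
    have "(\<lambda>z. Re (complex_of_real (g z))) \<in> borel_measurable P" by measurable
    then have [measurable]: "g \<in> borel_measurable P" by simp
    show ?thesis by measurable
  qed
  ultimately have "{z \<in> space P. c < g z} \<in> sets approximable_algebra"
    unfolding sets_approximable_algebra by (simp add: approximable_sets_def)
  then show "{w \<in> space approximable_algebra. c < g w} \<in> sets approximable_algebra" by simp
qed

lemma dense_if_generating:
  assumes gen: "sets P \<subseteq> sets approximable_algebra" and G: "G \<in> L2 P" and e: "e > 0"
  shows "\<exists>H. D H \<and> L2_norm P (\<lambda>z. G z - H z) < e"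
proof -
  obtain s where s': "\<forall>i. simple_function P (s i)" "\<forall>z\<in>space P. (\<lambda>i. s i z) \<longlonglongrightarrow> G z"
    "\<forall>i. \<forall>z\<in>space P. dist (s i z) 0 \<le> 2 * dist (G z) 0"
    using borel_measurable_implies_sequence_metric[OF L2_D(1)[OF G], of 0] by blast
  have s: "simple_function P (s i)" "z \<in> space P \<Longrightarrow> (\<lambda>i. s i z) \<longlonglongrightarrow> G z"
    "z \<in> space P \<Longrightarrow> cmod (s i z) \<le> 2 * cmod (G z)" for i z
    using s' by auto
  have "approximable (s i)" for i
  proof (rule approximable_cong)
    show "approximable (\<lambda>z. \<Sum>y\<in>s i ` space P. y * indicator (s i -` {y} \<inter> space P) z)"
    proof (intro approximable_sum approximable_scale)
      show "finite (s i ` space P)" using s(1)[of i] by (simp add: simple_function_def)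
      show "approximable (indicator (s i -` {y} \<inter> space P))" for y
        using simple_functionD(2)[OF s(1)[of i], of "{y}"] gen
        unfolding sets_approximable_algebra by (auto simp: approximable_sets_def)
    qed
    show "s i z = (\<Sum>y\<in>s i ` space P. y * indicator (s i -` {y} \<inter> space P) z)" if "z \<in> space P" for z
    proof -
      have "s i z = (\<Sum>y\<in>s i ` space P. indicator (s i -` {y} \<inter> space P) z *\<^sub>R y)"
        by (rule simple_function_indicator_representation_banach[OF s(1) that])
      also have "\<dots> = (\<Sum>y\<in>s i ` space P. y * indicator (s i -` {y} \<inter> space P) z)"
        by (rule sum.cong) (auto simp: indicator_def)
      finally show ?thesis .
    qed
  qed
  moreover have "(\<lambda>i. L2_norm P (\<lambda>z. G z - s i z)) \<longlonglongrightarrow> 0"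
  proof (rule L2_norm_dominated_convergence[OF borel_measurable_simple_function[OF s(1)] L2_D(1)[OF G] _ _ s(2)])
    show "integrable P (\<lambda>z. (3 * cmod (G z))\<^sup>2)" using L2_D(2)[OF G] by (simp add: power_mult_distrib)
    show "cmod (G z - s i z) \<le> 3 * cmod (G z)" if "z \<in> space P" for i z
      using norm_triangle_ineq4[of "G z" "s i z"] s(3)[OF that, of i] by linarith
  qed
  ultimately show ?thesis by (rule L2_limit_approximable[OF _ G _ e])
qed

end

section \<open>The cyclic representation is defined everywhere\<close>

lemma borel_measurable_Arg2pi [measurable]: "Arg2pi \<in> borel_measurable borel"
proof -
  have "(\<lambda>z. indicator (- \<real>\<^sub>\<ge>\<^sub>0) z *\<^sub>R Arg2pi z) \<in> borel_measurable borel"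
  proof (rule borel_measurable_continuous_on_indicator)
    show "- \<real>\<^sub>\<ge>\<^sub>0 \<in> sets (borel :: complex measure)"
      using closed_nonneg_Reals_complex by (intro borel_open) (simp add: open_Compl)
    show "continuous_on (- \<real>\<^sub>\<ge>\<^sub>0) Arg2pi"
      by (intro continuous_at_imp_continuous_on ballI continuous_at_Arg2pi) simp
  qed
  also have "(\<lambda>z. indicator (- \<real>\<^sub>\<ge>\<^sub>0) z *\<^sub>R Arg2pi z) = Arg2pi"
    by (auto simp: fun_eq_iff indicator_def Arg2pi_eq_0 complex_nonneg_Reals_iff complex_is_Real_iff)
  finally show ?thesis .
qed

lemma borel_measurable_abs_torus: "abs_torus \<in> measurable borel borel"
  by (rule borel_measurableI) (auto simp: open_torus_def)

text \<open>The arguments of the coordinate characters give a Borel section of the quotient map from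
  \<open>\<real>\<^sup>d\<close> to the torus, so the coordinate characters generate the Borel sets of the torus.\<close>

lemma abs_torus_Arg2pi: "abs_torus (\<chi> i. Arg2pi (torus_char a (axis i 1)) / (2 * pi)) = a"
proof -
  obtain v where v: "a = abs_torus v" using torus.abs_induct[of "\<lambda>a. \<exists>v. a = abs_torus v"] by blast
  have "int_congruent (\<chi> i. Arg2pi (torus_char a (axis i 1)) / (2 * pi)) v"
    unfolding int_congruent_def
  proof
    fix i
    define z where "z = torus_char a (axis i 1)"
    have "(\<Sum>j\<in>UNIV. v $ j * of_int ((axis i 1 :: int ^ 'a) $ j)) = (\<Sum>j\<in>UNIV. if j = i then v $ j else 0)"
      by (rule sum.cong) (auto simp: axis_def)
    then have "z = cis (2 * pi * v $ i)"
      by (simp add: z_def v torus_char.abs_eq)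
    moreover have "cmod z = 1" by (simp add: z_def)
    then have "cis (Arg2pi z) = z" using Arg2pi_eq[of z] by (simp add: cis_conv_exp)
    ultimately have "cis (Arg2pi z) = cis (2 * pi * v $ i)" by simp
    then have "sin (Arg2pi z) = sin (2 * pi * v $ i) \<and> cos (Arg2pi z) = cos (2 * pi * v $ i)"
      by (simp add: complex_eq_iff)
    then obtain n :: int where "Arg2pi z = 2 * pi * v $ i + 2 * pi * n"
      unfolding sin_cos_eq_iff by blast
    then have "Arg2pi z / (2 * pi) - v $ i = of_int n" by (simp add: field_simps)
    then show "(\<chi> i. Arg2pi (torus_char a (axis i 1)) / (2 * pi)) $ i - v $ i \<in> \<int>"
      by (simp add: z_def)
  qed
  then show ?thesis unfolding v torus.abs_eq_iff by simp
qed

context spectral_system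
begin

lemma orbit_pair_algebra: "bounded_function_algebra P (\<lambda>G. \<exists>F. orbit_pair T f G F)"
proof (rule bounded_function_algebra.intro)
  show "finite_measure P" by (rule finite_P)
  fix G H :: "'d torus \<times> (real ^ 'd) \<Rightarrow> complex"
  assume "\<exists>F. orbit_pair T f G F"
  then obtain F where G: "orbit_pair T f G F" by blast
  show "G \<in> borel_measurable P" using orbit_pair_L2[OF G] by (auto dest: L2_D)
  show "\<exists>C. \<forall>z. cmod (G z) \<le> C"
    using G
  proof (induction rule: orbit_pair.induct)
    case (base \<phi> C n)
    then show ?case by (intro exI[of _ C]) (simp add: norm_mult)
  next
    case (add G F G' F')
    then obtain C C' where "\<forall>z. cmod (G z) \<le> C" "\<forall>z. cmod (G' z) \<le> C'" by blast
    then show ?case by (intro exI[of _ "C + C'"]) (auto intro: norm_triangle_mono)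
  qed
  show "\<exists>F. orbit_pair T f (\<lambda>z. c * G z) F" for c using orbit_pair_scale[OF G] by blast
  assume "\<exists>F. orbit_pair T f H F"
  then obtain F' where H: "orbit_pair T f H F'" by blast
  show "\<exists>F. orbit_pair T f (\<lambda>z. G z + H z) F" using orbit_pair.add[OF G H] by blast
  show "\<exists>F. orbit_pair T f (\<lambda>z. G z * H z) F"
    using G
  proof (induction rule: orbit_pair.induct)
    case b1: (base \<phi> C n)
    show ?case using H
    proof (induction rule: orbit_pair.induct)
      case b2: (base \<psi> C' m)
      have m: "(\<lambda>r. \<phi> r * \<psi> r) \<in> borel_measurable unit_cube" using b1(1) b2(1) by simp
      have "0 \<le> C" using b1(2) norm_ge_zero[of "\<phi> undefined"] order_trans by blast
      then have "cmod (\<phi> r * \<psi> r) \<le> C * C'" for r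
        unfolding norm_mult using b1(2) b2(2) by (intro mult_mono) auto
      then have "orbit_pair T f (\<lambda>z. torus_char (fst z) (- (n + m)) * (\<phi> (snd z) * \<psi> (snd z)))
          (\<lambda>z. f (T (n + m) (fst z)) * (\<phi> (snd z) * \<psi> (snd z)))"
        using orbit_pair.base[OF m, of "C * C'" T f "n + m"] by blast
      moreover have "(\<lambda>z. torus_char (fst z) (- (n + m)) * (\<phi> (snd z) * \<psi> (snd z))) =
          (\<lambda>z :: 'd torus \<times> (real ^ 'd). torus_char (fst z) (- n) * \<phi> (snd z) * (torus_char (fst z) (- m) * \<psi> (snd z)))"
      proof
        fix z :: "'d torus \<times> (real ^ 'd)"
        show "torus_char (fst z) (- (n + m)) * (\<phi> (snd z) * \<psi> (snd z)) =
            torus_char (fst z) (- n) * \<phi> (snd z) * (torus_char (fst z) (- m) * \<psi> (snd z))"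
          using torus_char_add[of "fst z" "- n" "- m"] by (simp add: mult_ac)
      qed
      ultimately show ?case by auto
    next
      case (add G1 F1 G2 F2)
      then obtain A B where AB: "orbit_pair T f (\<lambda>z. torus_char (fst z) (- n) * \<phi> (snd z) * G1 z) A"
        "orbit_pair T f (\<lambda>z. torus_char (fst z) (- n) * \<phi> (snd z) * G2 z) B" by blast
      show ?case using orbit_pair.add[OF AB] by (auto simp: distrib_left)
    qed
  next
    case (add G1 F1 G2 F2)
    then obtain A B where AB: "orbit_pair T f (\<lambda>z. G1 z * H z) A" "orbit_pair T f (\<lambda>z. G2 z * H z) B" by blast
    show ?case using orbit_pair.add[OF AB] by (auto simp: distrib_right)
  qed
next
  show "\<exists>F. orbit_pair T f (\<lambda>_. 1) F" using orbit_pair.base[of "\<lambda>_. 1" 1 T f 0] by auto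
qed

text \<open>Both coordinate projections of the torus times the cube are measurable for the \<open>\<sigma>\<close>-algebra of sets with
  approximable indicator, the first because the coordinate characters are.\<close>

lemma isom_total:
  assumes G: "G \<in> L2 P"
  obtains F where "isom G F"
proof -
  interpret A: bounded_function_algebra P "\<lambda>G. \<exists>F. orbit_pair T f G F" by (rule orbit_pair_algebra)
  have base: "A.approximable (\<lambda>z. torus_char (fst z) n * \<phi> (snd z))"
    if "\<phi> \<in> borel_measurable unit_cube" "\<And>r. cmod (\<phi> r) \<le> C" for n \<phi> C
    using orbit_pair.base[OF that, of T f "- n"] by (intro A.D_approximable) auto
  have char: "A.approximable (\<lambda>z. torus_char (fst z) n)" for n
    using base[of "\<lambda>_. 1" 1 n] by simp
  have char_m: "(\<lambda>z. torus_char (fst z) n) \<in> borel_measurable A.approximable_algebra" for n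
    unfolding borel_measurable_complex_iff
  proof (intro conjI A.approximable_real_measurable)
    have "A.approximable (\<lambda>z. (1/2) * (torus_char (fst z) n + torus_char (fst z) (- n)))"
      by (intro A.approximable_scale A.approximable_add char)
    also have "(\<lambda>z. (1/2) * (torus_char (fst z) n + torus_char (fst z) (- n))) =
        (\<lambda>z :: 'd torus \<times> (real ^ 'd). complex_of_real (Re (torus_char (fst z) n)))"
      by (auto simp: complex_eq_iff simp flip: cnj_torus_char)
    finally show "A.approximable (\<lambda>z. complex_of_real (Re (torus_char (fst z) n)))" .
    have "A.approximable (\<lambda>z. (- \<i>/2) * (torus_char (fst z) n + (-1) * torus_char (fst z) (- n)))"
      by (intro A.approximable_scale A.approximable_add char)
    also have "(\<lambda>z. (- \<i>/2) * (torus_char (fst z) n + (-1) * torus_char (fst z) (- n))) =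
        (\<lambda>z :: 'd torus \<times> (real ^ 'd). complex_of_real (Im (torus_char (fst z) n)))"
      by (auto simp: complex_eq_iff simp flip: cnj_torus_char)
    finally show "A.approximable (\<lambda>z. complex_of_real (Im (torus_char (fst z) n)))" .
  qed
  have "(\<lambda>z. \<chi> i. Arg2pi (torus_char (fst z) (axis i 1)) / (2 * pi)) \<in> borel_measurable A.approximable_algebra"
    by (rule measurable_vec_lambda)
      (intro borel_measurable_divide measurable_compose[OF char_m borel_measurable_Arg2pi] borel_measurable_const)
  from measurable_compose[OF this borel_measurable_abs_torus]
  have fst_m: "fst \<in> measurable A.approximable_algebra \<sigma>"
    by (simp add: abs_torus_Arg2pi measurable_cong_sets[OF refl sets_sigma])
  have snd_m: "snd \<in> measurable A.approximable_algebra (unit_cube :: (real ^ 'd) measure)"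
  proof (rule measurableI)
    fix z assume "z \<in> space A.approximable_algebra"
    then have "z \<in> space P" by (simp only: A.space_approximable_algebra)
    then show "snd z \<in> space unit_cube" by (auto simp: space_pair_measure)
  next
    fix B :: "(real ^ 'd) set" assume B: "B \<in> sets unit_cube"
    have "A.approximable (\<lambda>z. torus_char (fst z) 0 * indicator B (snd z))"
    proof (rule base[of _ 1])
      show "(indicator B :: _ \<Rightarrow> complex) \<in> borel_measurable unit_cube" using B by simp
      show "cmod (indicator B r) \<le> 1" for r by (simp add: indicator_def)
    qed
    then have "A.approximable (indicator (snd -` B \<inter> space P))"
      by (rule A.approximable_cong) (simp add: indicator_def)
    moreover have "snd -` B \<inter> space P \<in> sets P" by (rule measurable_sets[OF measurable_snd B])
    ultimately show "snd -` B \<inter> space A.approximable_algebra \<in> sets A.approximable_algebra"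
      unfolding A.sets_approximable_algebra A.space_approximable_algebra by (simp add: A.approximable_sets_def)
  qed
  have id: "(\<lambda>z. z) \<in> measurable A.approximable_algebra P"
    using measurable_Pair[OF fst_m snd_m] by simp
  have "sets P \<subseteq> sets A.approximable_algebra"
  proof
    fix B assume B: "B \<in> sets P"
    have "(\<lambda>z. z) -` B \<inter> space A.approximable_algebra \<in> sets A.approximable_algebra"
      by (rule measurable_sets[OF id B])
    moreover have "(\<lambda>z. z) -` B \<inter> space A.approximable_algebra = B"
      unfolding A.space_approximable_algebra using sets.sets_into_space[OF B] by blast
    ultimately show "B \<in> sets A.approximable_algebra" by simp
  qed
  then have "\<exists>G' F'. orbit_pair T f G' F' \<and> L2_norm P (\<lambda>x. G x - G' x) < e" if "e > 0" for e
    using A.dense_if_generating[OF _ G that] by blast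
  then show thesis using isom_extend[OF G] that by blast
qed

end

section \<open>Directional eigenfunctions are determined by the reduced spectral measure\<close>

text \<open>Rectangles generate the product \<open>\<sigma>\<close>-algebra and are closed under intersection, so all set integrals
  of \<open>h\<close> vanish.\<close>

lemma AE_zero_if_rectangle_integrals_zero:
  fixes h :: "'a \<times> 'b \<Rightarrow> complex"
  assumes fin: "finite_measure (M \<Otimes>\<^sub>M N)" and h: "integrable (M \<Otimes>\<^sub>M N) h"
    and rect: "\<And>A B. A \<in> sets M \<Longrightarrow> B \<in> sets N \<Longrightarrow> set_lebesgue_integral (M \<Otimes>\<^sub>M N) (A \<times> B) h = 0"
  shows "AE z in M \<Otimes>\<^sub>M N. h z = 0"
proof (rule sigma_finite_measure.density_zero[OF _ h])
  show "sigma_finite_measure (M \<Otimes>\<^sub>M N)" using fin by (simp add: finite_measure_def)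
next
  fix E assume "E \<in> sets (M \<Otimes>\<^sub>M N)"
  then have "E \<in> sigma_sets (space M \<times> space N) {a \<times> b |a b. a \<in> sets M \<and> b \<in> sets N}"
    by (simp add: sets_pair_measure)
  from Int_stable_pair_measure_generator pair_measure_closed this
  show "set_lebesgue_integral (M \<Otimes>\<^sub>M N) E h = 0"
  proof (induction rule: sigma_sets_induct_disjoint)
    case (basic E)
    then show ?case using rect by auto
  next
    case empty
    show ?case by (simp add: set_lebesgue_integral_def)
  next
    case (compl E)
    then have E: "E \<in> sets (M \<Otimes>\<^sub>M N)" by (simp add: sets_pair_measure)
    have i: "set_integrable (M \<Otimes>\<^sub>M N) B h" if "B \<in> sets (M \<Otimes>\<^sub>M N)" for B
      unfolding set_integrable_def by (rule integrable_mult_indicator[OF that h])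
    have "set_lebesgue_integral (M \<Otimes>\<^sub>M N) (E \<union> (space M \<times> space N - E)) h =
        set_lebesgue_integral (M \<Otimes>\<^sub>M N) E h + set_lebesgue_integral (M \<Otimes>\<^sub>M N) (space M \<times> space N - E) h"
      using E by (intro set_integral_Un i) (auto simp: space_pair_measure[symmetric])
    moreover have "E \<union> (space M \<times> space N - E) = space M \<times> space N"
      using sets.sets_into_space[OF E] by (auto simp: space_pair_measure)
    ultimately show ?case using compl rect[of "space M" "space N"] by simp
  next
    case (union A)
    then have A: "A i \<in> sets (M \<Otimes>\<^sub>M N)" for i by (auto simp: sets_pair_measure)
    have "set_lebesgue_integral (M \<Otimes>\<^sub>M N) (\<Union>i. A i) h = (\<Sum>i. set_lebesgue_integral (M \<Otimes>\<^sub>M N) (A i) h)"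
    proof (rule lebesgue_integral_countable_add[OF A])
      show "A i \<inter> A j = {}" if "i \<noteq> j" for i j using union(1) that by (auto simp: disjoint_family_on_def)
      show "set_integrable (M \<Otimes>\<^sub>M N) (\<Union>i. A i) h"
        unfolding set_integrable_def by (rule integrable_mult_indicator[OF _ h]) (use A in auto)
    qed
    then show ?case using union by simp
  qed
qed

text \<open>Products of a constant with a function on the cube are orthogonal to \<open>L2_O M\<close>, so on \<open>L2_O M\<close> the
  indicator of a rectangle may be replaced by a product with a centred indicator.\<close>

lemma L2_O_centred_indicator:
  fixes F :: "'a \<times> (real ^ 'd::finite) \<Rightarrow> complex"
  assumes M: "prob_space M" and F: "F \<in> L2_O M" and ne: "\<not> (AE z in suspension_space M. F z = 0)"
  obtains f B where "f \<in> L2_0 M" "B \<in> sets unit_cube"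
    "L2_inner (suspension_space M) F (\<lambda>z. f (fst z) * indicator B (snd z)) \<noteq> 0"
proof -
  let ?Q = "suspension_space M :: ('a \<times> (real ^ 'd)) measure"
  interpret prob_space M by fact
  interpret C: finite_measure "unit_cube :: (real ^ 'd) measure" by (rule finite_measure_unit_cube)
  have Q: "finite_measure ?Q"
    unfolding suspension_space_def by (intro finite_measure_pair_measure finite_measure_axioms C.finite_measure_axioms)
  have FL: "F \<in> L2 ?Q" and F_fibre: "\<And>h. h \<in> fibre_functions \<Longrightarrow> L2_inner ?Q F h = 0"
    using F by (auto simp: L2_O_def L2_orth_def)
  have ind: "indicator A \<in> L2 M'" if "A \<in> sets M'" "finite_measure M'" for A and M' :: "'c measure"
    by (rule L2_bounded[OF that(2), of _ 1]) (use that in \<open>auto simp: indicator_def[abs_def]\<close>)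
  have "\<exists>f B. f \<in> L2_0 M \<and> B \<in> sets unit_cube \<and> L2_inner ?Q F (\<lambda>z. f (fst z) * indicator B (snd z)) \<noteq> 0"
  proof (rule ccontr)
    assume neg: "\<not> ?thesis"
    have "AE z in M \<Otimes>\<^sub>M unit_cube. F z = 0"
    proof (rule AE_zero_if_rectangle_integrals_zero)
      show "finite_measure (M \<Otimes>\<^sub>M (unit_cube :: (real ^ 'd) measure))" using Q by (simp add: suspension_space_def)
      have "(\<lambda>_. 1) \<in> L2 ?Q" using Q by (auto simp: L2_def finite_measure.integrable_const)
      from L2_integrable_mult[OF FL this] show "integrable (M \<Otimes>\<^sub>M unit_cube) F"
        by (simp add: suspension_space_def)
      fix A :: "'a set" and B :: "(real ^ 'd) set"
      assume A: "A \<in> sets M" and B: "B \<in> sets unit_cube"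
      define f where "f x = indicator A x - complex_of_real (measure M A)" for x
      define k where "k = complex_of_real (measure M A)"
      note iA = ind[OF A finite_measure_axioms] and iB = ind[OF B C.finite_measure_axioms]
      have fL: "f \<in> L2 M"
        unfolding f_def by (rule L2_diff[OF iA]) (auto simp: L2_def)
      have "(\<integral>x. indicator A x \<partial>M) = (\<integral>x. complex_of_real (indicator A x) \<partial>M)"
        by (rule Bochner_Integration.integral_cong) (auto simp: indicator_def)
      also have "\<dots> = complex_of_real (measure M A)" using A by (simp add: Int_absorb2 sets.sets_into_space)
      finally have "(\<integral>x. indicator A x \<partial>M) = complex_of_real (measure M A)" .
      moreover have "integrable M (\<lambda>x. indicator A x :: complex)"
        using L2_integrable_mult[OF iA, of "\<lambda>_. 1"] by (simp add: L2_def)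
      ultimately have "(\<integral>x. f x \<partial>M) = 0"
        by (simp add: f_def prob_space)
      then have f0: "f \<in> L2_0 M"
        using fL by (auto simp: L2_0_def L2_orth_def L2_inner_def)
      with neg B have z1: "L2_inner ?Q F (\<lambda>z. f (fst z) * indicator B (snd z)) = 0" by blast
      have "(\<lambda>z. k * indicator B (snd z)) \<in> fibre_functions"
        unfolding fibre_functions_def using L2_scale[OF iB, of k]
        by (intro CollectI exI[of _ "\<lambda>s. k * indicator B s"]) (auto simp: case_prod_beta')
      then have z2: "L2_inner ?Q F (\<lambda>z. k * indicator B (snd z)) = 0" by (rule F_fibre)
      have "(\<lambda>_. k) \<in> L2 M" by (simp add: L2_def)
      from L2_times[OF finite_measure_axioms C.finite_measure_axioms this iB]
      have L2: "(\<lambda>z. k * indicator B (snd z)) \<in> L2 ?Q" by (simp add: suspension_space_def)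
      have L1: "(\<lambda>z. f (fst z) * indicator B (snd z)) \<in> L2 ?Q"
        unfolding suspension_space_def
        by (rule L2_times[OF finite_measure_axioms C.finite_measure_axioms fL iB])
      have "set_lebesgue_integral (M \<Otimes>\<^sub>M unit_cube) (A \<times> B) F =
          L2_inner ?Q F (\<lambda>z. f (fst z) * indicator B (snd z) + k * indicator B (snd z))"
        unfolding L2_inner_def set_lebesgue_integral_def suspension_space_def
        by (rule Bochner_Integration.integral_cong) (auto simp: f_def k_def indicator_def)
      also have "\<dots> = 0" using L2_inner_add_right[OF L1 L2 FL] z1 z2 by simp
      finally show "set_lebesgue_integral (M \<Otimes>\<^sub>M unit_cube) (A \<times> B) F = 0" .
    qed
    then have "AE z in ?Q. F z = 0" unfolding suspension_space_def .
    with ne show False ..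
  qed
  then show thesis using that by blast
qed

text \<open>Multiplication by the square root of the density depends on the torus variable only, so it
  commutes with \<open>twist t\<close>.\<close>

lemma twist_transport:
  fixes \<rho> \<tau> :: "'d::finite torus measure" and G :: "'d torus \<times> (real ^ 'd) \<Rightarrow> complex"
  assumes \<rho>: "finite_measure \<rho>" "sets \<rho> = sets borel" and \<tau>: "finite_measure \<tau>" "sets \<tau> = sets borel"
    and ac: "absolutely_continuous \<tau> \<rho>"
    and G: "G \<in> L2 (\<rho> \<Otimes>\<^sub>M unit_cube)" and ne: "\<not> (AE z in \<rho> \<Otimes>\<^sub>M unit_cube. G z = 0)"
    and eig: "\<And>t. t \<in> L \<Longrightarrow> AE z in \<rho> \<Otimes>\<^sub>M unit_cube. twist t G z = c t * G z"
  obtains G' where "G' \<in> L2 (\<tau> \<Otimes>\<^sub>M unit_cube)" "\<not> (AE z in \<tau> \<Otimes>\<^sub>M unit_cube. G' z = 0)"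
    "\<And>t. t \<in> L \<Longrightarrow> AE z in \<tau> \<Otimes>\<^sub>M unit_cube. twist t G' z = c t * G' z"
proof -
  let ?C = "unit_cube :: (real ^ 'd) measure"
  interpret R: finite_measure \<rho> by fact
  interpret T: finite_measure \<tau> by fact
  interpret C: finite_measure ?C by (rule finite_measure_unit_cube)
  have sets: "sets \<rho> = sets \<tau>" using \<rho> \<tau> by simp
  obtain D where D [measurable]: "D \<in> borel_measurable \<tau>" and D_AE: "AE x in \<tau>. RN_deriv \<tau> \<rho> x = ennreal (D x)"
    and D0: "\<And>x. 0 \<le> D x"
    using T.real_RN_deriv[OF \<rho>(1) ac sets] by metis
  have "\<rho> = density \<tau> (RN_deriv \<tau> \<rho>)" by (rule T.density_RN_deriv[OF ac sets, symmetric])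
  also have "\<dots> = density \<tau> (\<lambda>x. ennreal (D x))" by (rule density_cong[OF _ _ D_AE]) auto
  finally have \<rho>D: "\<rho> = density \<tau> (\<lambda>x. ennreal (D x))" .
  have "density \<tau> (\<lambda>x. ennreal (D x)) \<Otimes>\<^sub>M density ?C (\<lambda>_. 1) =
      density (\<tau> \<Otimes>\<^sub>M ?C) (\<lambda>(x, y). ennreal (D x) * 1)"
    by (rule pair_measure_density) (simp_all add: density_1 C.sigma_finite_measure_axioms)
  then have P: "\<rho> \<Otimes>\<^sub>M ?C = density (\<tau> \<Otimes>\<^sub>M ?C) (\<lambda>z. ennreal (D (fst z)))"
    by (simp add: \<rho>D[symmetric] density_1 case_prod_beta')
  have sP: "sets (\<rho> \<Otimes>\<^sub>M ?C) = sets (\<tau> \<Otimes>\<^sub>M ?C)" by (rule sets_pair_measure_cong[OF sets refl])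
  have Gm [measurable]: "G \<in> borel_measurable (\<tau> \<Otimes>\<^sub>M ?C)"
    using L2_D(1)[OF G] measurable_cong_sets[OF sP refl] by blast
  have Dm [measurable]: "(\<lambda>z. D (fst z)) \<in> borel_measurable (\<tau> \<Otimes>\<^sub>M ?C)" by measurable
  have AE: "(AE z in \<rho> \<Otimes>\<^sub>M ?C. p z) \<longleftrightarrow> (AE z in \<tau> \<Otimes>\<^sub>M ?C. 0 < D (fst z) \<longrightarrow> p z)" for p
    unfolding P by (subst AE_density) simp_all
  define G' where "G' z = of_real (sqrt (D (fst z))) * G z" for z
  have G'm [measurable]: "G' \<in> borel_measurable (\<tau> \<Otimes>\<^sub>M ?C)" unfolding G'_def by measurable
  have G'0: "G' z = 0" if "\<not> 0 < D (fst z)" for z using that D0[of "fst z"] by (simp add: G'_def less_le)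
  show thesis
  proof
    have "integrable (density (\<tau> \<Otimes>\<^sub>M ?C) (\<lambda>z. ennreal (D (fst z)))) (\<lambda>z. (cmod (G z))\<^sup>2)"
      using L2_D(2)[OF G] by (simp add: P)
    then have "integrable (\<tau> \<Otimes>\<^sub>M ?C) (\<lambda>z. D (fst z) *\<^sub>R (cmod (G z))\<^sup>2)"
      by (subst (asm) integrable_density) (use D0 in auto)
    moreover have "D (fst z) *\<^sub>R (cmod (G z))\<^sup>2 = (cmod (G' z))\<^sup>2" for z
      using D0[of "fst z"] by (simp add: G'_def norm_mult power_mult_distrib)
    ultimately show "G' \<in> L2 (\<tau> \<Otimes>\<^sub>M ?C)" by (simp add: L2_def)
    show "\<not> (AE z in \<tau> \<Otimes>\<^sub>M ?C. G' z = 0)"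
    proof
      assume "AE z in \<tau> \<Otimes>\<^sub>M ?C. G' z = 0"
      then have "AE z in \<tau> \<Otimes>\<^sub>M ?C. 0 < D (fst z) \<longrightarrow> G z = 0"
        by eventually_elim (auto simp: G'_def)
      with ne show False unfolding AE by simp
    qed
    fix t assume "t \<in> L"
    from eig[OF this] have "AE z in \<tau> \<Otimes>\<^sub>M ?C. 0 < D (fst z) \<longrightarrow> twist t G z = c t * G z"
      unfolding AE .
    then show "AE z in \<tau> \<Otimes>\<^sub>M ?C. twist t G' z = c t * G' z"
    proof eventually_elim
      case (elim z)
      have tw: "twist t G' z = of_real (sqrt (D (fst z))) * twist t G z"
        by (simp add: twist_def G'_def suspension_eq split_beta)
      show ?case
      proof (cases "0 < D (fst z)")
        case True
        then show ?thesis using elim by (simp add: tw G'_def)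
      next
        case False
        then have "D (fst z) = 0" using D0[of "fst z"] by simp
        then show ?thesis by (simp add: tw G'_def)
      qed
    qed
  qed
qed

text \<open>Project \<open>F\<close> to the cyclic space of \<open>f\<close>, carry the result over from \<open>\<rho>\<close> to \<open>\<tau>\<close>, and realise it in the cyclic
  space of \<open>g\<close>.  The hypothesis on the inner product keeps the projection from vanishing.\<close>

lemma eigenfunction_transfer:
  fixes M :: "'a measure" and N :: "'b measure"
    and T :: "int ^ 'd::finite \<Rightarrow> 'a \<Rightarrow> 'a" and S :: "int ^ 'd \<Rightarrow> 'b \<Rightarrow> 'b"
  assumes M: "prob_space M" "mp_action M T" and N: "prob_space N" "mp_action N S"
    and f: "f \<in> L2_0 M" "spectral_measure M T f \<rho>" and g: "g \<in> L2_0 N" "spectral_measure N S g \<tau>"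
    and ac: "absolutely_continuous \<tau> \<rho>" and B: "B \<in> sets unit_cube"
    and F: "direction_eigenvalue M T L l F"
    and ne: "L2_inner (suspension_space M) F (\<lambda>z. f (fst z) * indicator B (snd z)) \<noteq> 0"
  shows "\<exists>F'\<in>L2_O N. direction_eigenvalue N S L l F'"
proof -
  have fL: "f \<in> L2 M" and gL: "g \<in> L2 N" using f g by (auto simp: L2_0_def L2_orth_def)
  interpret X: spectral_system M T f \<rho> by (rule spectral_system.intro[OF M fL f(2)])
  interpret Y: spectral_system N S g \<tau> by (rule spectral_system.intro[OF N gL g(2)])
  let ?Q = "suspension_space M :: ('a \<times> (real ^ 'd)) measure"
  have FL: "F \<in> L2 ?Q" and eig: "\<And>t. t \<in> L \<Longrightarrow> AE y in ?Q. F (suspension T t y) = cis (2 * pi * (l \<bullet> t)) * F y"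
    using F by (auto simp: direction_eigenvalue_def)
  obtain G F1 where R: "X.isom G F1" and orth: "\<And>G0 F0. orbit_pair T f G0 F0 \<Longrightarrow> L2_inner ?Q (\<lambda>y. F y - F1 y) F0 = 0"
    using X.isom_project[OF FL] by blast
  have 0: "orbit_pair T f (\<lambda>z. torus_char (fst z) (- 0) * indicator B (snd z)) (\<lambda>z. f (T 0 (fst z)) * indicator B (snd z))"
    by (rule orbit_pair.base[of "indicator B" 1 T f 0]) (use B in \<open>auto simp: indicator_def\<close>)
  define F0 where "F0 z = f (T 0 (fst z)) * indicator B (snd z)" for z :: "'a \<times> (real ^ 'd)"
  have F0: "F0 \<in> L2 ?Q" using X.orbit_pair_L2[OF 0] by (simp add: F0_def[abs_def])
  have "L2_inner ?Q F F0 = L2_inner ?Q F (\<lambda>z. f (fst z) * indicator B (snd z))"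
    unfolding L2_inner_def F0_def
    by (rule Bochner_Integration.integral_cong) (use M(2) in \<open>auto simp: suspension_space_def space_pair_measure mp_action_def\<close>)
  then have "L2_inner ?Q F1 F0 \<noteq> 0"
    using ne orth[OF 0] L2_inner_diff_left[OF FL X.isom_L2(2)[OF R] F0] by (simp add: F0_def[abs_def])
  have "\<not> (AE z in \<rho> \<Otimes>\<^sub>M unit_cube. G z = 0)"
  proof
    assume "AE z in \<rho> \<Otimes>\<^sub>M unit_cube. G z = 0"
    then have "L2_norm ?Q F1 = 0"
      using X.isom_norm[OF R] L2_norm_eq_0_iff[OF X.isom_L2(1)[OF R]] by simp
    then have "L2_inner ?Q F1 F0 = 0"
      using L2_Cauchy_Schwarz[OF X.isom_L2(2)[OF R] F0] by simp
    with \<open>L2_inner ?Q F1 F0 \<noteq> 0\<close> show False ..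
  qed
  moreover have "AE z in \<rho> \<Otimes>\<^sub>M unit_cube. twist t G z = cis (2 * pi * (l \<bullet> t)) * G z" if "t \<in> L" for t
    by (rule X.isom_eigen_of_projection[OF FL R orth eig[OF that]])
  ultimately obtain G' where G': "G' \<in> L2 (\<tau> \<Otimes>\<^sub>M unit_cube)" "\<not> (AE z in \<tau> \<Otimes>\<^sub>M unit_cube. G' z = 0)"
    "\<And>t. t \<in> L \<Longrightarrow> AE z in \<tau> \<Otimes>\<^sub>M unit_cube. twist t G' z = cis (2 * pi * (l \<bullet> t)) * G' z"
    using twist_transport[OF X.finite_sigma X.sets_sigma Y.finite_sigma Y.sets_sigma ac X.isom_L2(1)[OF R],
        of L "\<lambda>t. cis (2 * pi * (l \<bullet> t))"] by blast
  obtain F' where R': "Y.isom G' F'" using Y.isom_total[OF G'(1)] by blast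
  have "F' \<in> L2_O N" by (rule Y.isom_L2_O[OF R' g(1)])
  moreover have "\<not> (AE y in suspension_space N. F' y = 0)"
    using L2_norm_eq_0_iff[OF Y.isom_L2(1)[OF R']] L2_norm_eq_0_iff[OF Y.isom_L2(2)[OF R']] Y.isom_norm[OF R'] G'(2)
    by simp
  moreover have "AE y in suspension_space N. F' (suspension S t y) = cis (2 * pi * (l \<bullet> t)) * F' y" if "t \<in> L" for t
    by (rule Y.isom_eigen_image[OF R' G'(3)[OF that]])
  ultimately show ?thesis
    using Y.isom_L2(2)[OF R'] by (auto simp: direction_eigenvalue_def)
qed

lemma absolutely_continuous_trans:
  "absolutely_continuous M N \<Longrightarrow> absolutely_continuous N K \<Longrightarrow> absolutely_continuous M K"
  by (auto simp: absolutely_continuous_def)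

lemma reduced_spectral_measure_transfer:
  fixes M :: "'a measure" and N :: "'b measure"
    and T :: "int ^ 'd::finite \<Rightarrow> 'a \<Rightarrow> 'a" and S :: "int ^ 'd \<Rightarrow> 'b \<Rightarrow> 'b"
  assumes M: "prob_space M" "mp_action M T" and N: "prob_space N" "mp_action N S"
    and \<sigma>: "reduced_spectral_measure M T \<sigma>" and \<tau>: "reduced_spectral_measure N S \<tau>"
    and ac: "absolutely_continuous \<tau> \<sigma>"
    and F: "F \<in> L2_O M" "direction_eigenvalue M T L l F"
  shows "\<exists>F'\<in>L2_O N. direction_eigenvalue N S L l F'"
proof -
  have "\<not> (AE y in suspension_space M. F y = 0)" using F(2) by (simp add: direction_eigenvalue_def)
  then obtain f B where f: "f \<in> L2_0 M" "B \<in> sets unit_cube"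
    "L2_inner (suspension_space M) F (\<lambda>z. f (fst z) * indicator B (snd z)) \<noteq> 0"
    using L2_O_centred_indicator[OF M(1) F(1)] by blast
  obtain \<rho> where \<rho>: "spectral_measure M T f \<rho>" "absolutely_continuous \<sigma> \<rho>"
    using \<sigma> f(1) unfolding reduced_spectral_measure_def by blast
  obtain g where g: "g \<in> L2_0 N" "spectral_measure N S g \<tau>"
    using \<tau> unfolding reduced_spectral_measure_def by blast
  show ?thesis
    by (rule eigenfunction_transfer[OF M N f(1) \<rho>(1) g absolutely_continuous_trans[OF ac \<rho>(2)] f(2) F(2) f(3)])
qed

lemma directions_eqI:
  fixes M :: "'a measure" and N :: "'b measure"
    and T :: "int ^ 'd::finite \<Rightarrow> 'a \<Rightarrow> 'a" and S :: "int ^ 'd \<Rightarrow> 'b \<Rightarrow> 'b"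
  assumes "\<And>L l. (\<exists>F\<in>L2_O M. direction_eigenvalue M T L l F) \<longleftrightarrow> (\<exists>F\<in>L2_O N. direction_eigenvalue N S L l F)"
  shows "ergodic_directions M T = ergodic_directions N S \<and>
    weak_mixing_directions M T = weak_mixing_directions N S"
proof -
  have "(\<exists>F\<in>L2_O M. direction_eigenfunction M T L F) \<longleftrightarrow> (\<exists>F\<in>L2_O N. direction_eigenfunction N S L F)" for L
    unfolding direction_eigenfunction_def using assms[of L] by blast
  then show ?thesis
    unfolding ergodic_directions_def weak_mixing_directions_def direction_invariant_def
    using assms[of _ 0] by simp
qed

section \<open>Isomorphic actions\<close>

lemma AE_fst_in:
  assumes A: "A \<in> sets M" "space M - A \<in> null_sets M" and C: "finite_measure C"
  shows "AE z in M \<Otimes>\<^sub>M C. fst z \<in> A"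
proof (rule AE_I)
  interpret C: finite_measure C by fact
  show "{z \<in> space (M \<Otimes>\<^sub>M C). \<not> fst z \<in> A} \<subseteq> (space M - A) \<times> space C"
    by (auto simp: space_pair_measure)
  have "emeasure (M \<Otimes>\<^sub>M C) ((space M - A) \<times> space C) = emeasure M (space M - A) * emeasure C (space C)"
    using A by (intro C.emeasure_pair_measure_Times) auto
  then show "emeasure (M \<Otimes>\<^sub>M C) ((space M - A) \<times> space C) = 0" using A(2) by auto
  show "(space M - A) \<times> space C \<in> sets (M \<Otimes>\<^sub>M C)" using A by auto
qed

lemma iso_mod0_measure_preserving:
  assumes iso: "iso_mod0 M N A B \<phi>" and b: "b \<in> space N"
  shows "measure_preserving M N (\<lambda>x. if x \<in> A then \<phi> x else b)"
proof -
  let ?\<psi> = "\<lambda>x. if x \<in> A then \<phi> x else b"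
  have A: "A \<in> sets M" "space M - A \<in> null_sets M" and B: "B \<in> sets N" "space N - B \<in> null_sets N"
    and \<phi>: "\<phi> \<in> measurable (restrict_space M A) (restrict_space N B)"
    and d: "distr (restrict_space M A) (restrict_space N B) \<phi> = restrict_space N B"
    using iso by (auto simp: iso_mod0_def)
  have AB: "A \<subseteq> space M" "B \<subseteq> space N" using A B sets.sets_into_space by auto
  have "\<phi> \<in> measurable (restrict_space M A) N"
    using \<phi> measurable_restrict_space2_iff[of \<phi> "restrict_space M A" N B] by simp
  then have m: "?\<psi> \<in> measurable M N"
    using measurable_restrict_space_iff[of A M b N \<phi>] A b AB by (simp add: Int_absorb2)
  have "distr M N ?\<psi> = N"
  proof (rule measure_eqI)
    fix E assume "E \<in> sets (distr M N ?\<psi>)"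
    then have E: "E \<in> sets N" by simp
    then have EB: "E \<inter> B \<in> sets (restrict_space N B)" by (auto simp: sets_restrict_space)
    have \<phi>B: "\<phi> x \<in> B" if "x \<in> A" for x
      using measurable_space[OF \<phi>, of x] that AB by (auto simp: space_restrict_space)
    have pre: "\<phi> -` (E \<inter> B) \<inter> A = ?\<psi> -` E \<inter> space M \<inter> A"
      using AB \<phi>B by auto
    have "emeasure (distr M N ?\<psi>) E = emeasure M (?\<psi> -` E \<inter> space M)"
      by (rule emeasure_distr[OF m E])
    also have "\<dots> = emeasure M (?\<psi> -` E \<inter> space M \<inter> A)"
    proof (rule emeasure_eq_AE)
      show "AE x in M. (x \<in> ?\<psi> -` E \<inter> space M) = (x \<in> ?\<psi> -` E \<inter> space M \<inter> A)"
        using AE_not_in[OF A(2)] by eventually_elim auto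
    qed (use m E A in auto)
    also have "\<dots> = emeasure (restrict_space M A) (\<phi> -` (E \<inter> B) \<inter> space (restrict_space M A))"
      using A AB pre by (subst emeasure_restrict_space) (auto simp: space_restrict_space Int_absorb2)
    also have "\<dots> = emeasure (distr (restrict_space M A) (restrict_space N B) \<phi>) (E \<inter> B)"
      by (rule emeasure_distr[OF \<phi> EB, symmetric])
    also have "\<dots> = emeasure N (E \<inter> B)"
      unfolding d using B AB by (subst emeasure_restrict_space) auto
    also have "\<dots> = emeasure N E"
    proof (rule emeasure_eq_AE)
      show "AE x in N. (x \<in> E \<inter> B) = (x \<in> E)"
        using AE_not_in[OF B(2)] AE_space by eventually_elim auto
    qed (use E B in auto)
    finally show "emeasure (distr M N ?\<psi>) E = emeasure N E" .
  qed simp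
  with m show ?thesis by (simp add: measure_preserving_def)
qed

lemma metrically_isomorphic_sym:
  assumes "metrically_isomorphic M T N S"
  shows "metrically_isomorphic N S M T"
proof -
  obtain A B \<phi> where iso: "iso_mod0 M N A B \<phi>" and T: "\<forall>n. \<forall>x\<in>A. T n x \<in> A" and S: "\<forall>n. \<forall>y\<in>B. S n y \<in> B"
    and eq: "\<forall>n. \<forall>x\<in>A. \<phi> (T n x) = S n (\<phi> x)"
    using assms unfolding metrically_isomorphic_def by blast
  define \<psi> where "\<psi> = the_inv_into A \<phi>"
  have bij: "bij_betw \<phi> A B" and A: "A \<in> sets M" and B: "B \<in> sets N"
    and \<phi>: "\<phi> \<in> measurable (restrict_space M A) (restrict_space N B)"
    and \<psi>: "\<psi> \<in> measurable (restrict_space N B) (restrict_space M A)"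
    and d: "distr (restrict_space M A) (restrict_space N B) \<phi> = restrict_space N B"
    using iso by (auto simp: iso_mod0_def \<psi>_def)
  have sp: "space (restrict_space M A) = A" "space (restrict_space N B) = B"
    using sets.sets_into_space[OF A] sets.sets_into_space[OF B] by (auto simp: space_restrict_space)
  have bij': "bij_betw \<psi> B A" unfolding \<psi>_def by (rule bij_betw_the_inv_into[OF bij])
  have \<psi>\<phi>: "\<psi> (\<phi> x) = x" if "x \<in> A" for x
    using bij that by (simp add: \<psi>_def bij_betw_def the_inv_into_f_f)
  have inv: "the_inv_into B \<psi> x = \<phi> x" if "x \<in> A" for x
    using bij bij' that \<psi>\<phi> by (intro the_inv_into_f_eq) (auto simp: bij_betw_def)
  have "the_inv_into B \<psi> \<in> measurable (restrict_space M A) (restrict_space N B) \<longleftrightarrow>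
      \<phi> \<in> measurable (restrict_space M A) (restrict_space N B)"
    by (rule measurable_cong) (simp add: sp inv)
  with \<phi> have m: "the_inv_into B \<psi> \<in> measurable (restrict_space M A) (restrict_space N B)" by simp
  have "distr (restrict_space N B) (restrict_space M A) \<psi> =
      distr (distr (restrict_space M A) (restrict_space N B) \<phi>) (restrict_space M A) \<psi>"
    by (simp only: d)
  also have "\<dots> = distr (restrict_space M A) (restrict_space M A) (\<psi> \<circ> \<phi>)"
    by (rule distr_distr[OF \<psi> \<phi>])
  also have "\<dots> = distr (restrict_space M A) (restrict_space M A) (\<lambda>x. x)"
    by (rule distr_cong) (simp_all add: sp \<psi>\<phi>)
  also have "\<dots> = restrict_space M A" by (simp add: distr_id2)
  finally have "iso_mod0 N M B A \<psi>"
    using iso bij' \<psi> m by (simp add: iso_mod0_def)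
  moreover have "\<psi> (S n y) = T n (\<psi> y)" if "y \<in> B" for n y
  proof -
    have "y \<in> \<phi> ` A" using bij that by (simp add: bij_betw_def)
    then obtain x where x: "x \<in> A" "y = \<phi> x" by blast
    then show ?thesis using \<psi>\<phi>[of "T n x"] \<psi>\<phi>[of x] eq T by auto
  qed
  ultimately show ?thesis
    unfolding metrically_isomorphic_def using T S by blast
qed

text \<open>An eigenfunction is composed with the isomorphism in the first variable; off the conull set on which
  the isomorphism is defined, its value is an arbitrary point \<open>b\<close>.\<close>

lemma isomorphic_transfer:
  fixes M :: "'a measure" and N :: "'b measure"
    and T :: "int ^ 'd::finite \<Rightarrow> 'a \<Rightarrow> 'a" and S :: "int ^ 'd \<Rightarrow> 'b \<Rightarrow> 'b"
  assumes M: "prob_space M" and N: "prob_space N" and iso: "metrically_isomorphic M T N S"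
    and F: "F \<in> L2_O N" "direction_eigenvalue N S L l F"
  shows "\<exists>F'\<in>L2_O M. direction_eigenvalue M T L l F'"
proof -
  let ?C = "unit_cube :: (real ^ 'd) measure"
  let ?QM = "suspension_space M :: ('a \<times> (real ^ 'd)) measure"
  let ?QN = "suspension_space N :: ('b \<times> (real ^ 'd)) measure"
  interpret M: prob_space M by fact
  interpret N: prob_space N by fact
  interpret C: finite_measure ?C by (rule finite_measure_unit_cube)
  obtain A B \<phi> where i: "iso_mod0 M N A B \<phi>" and T: "\<forall>n. \<forall>x\<in>A. T n x \<in> A"
    and eq: "\<forall>n. \<forall>x\<in>A. \<phi> (T n x) = S n (\<phi> x)"
    using iso unfolding metrically_isomorphic_def by blast
  obtain b where b: "b \<in> space N" using N.not_empty by blast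
  define \<psi> where "\<psi> x = (if x \<in> A then \<phi> x else b)" for x
  have "measure_preserving M N \<psi>" unfolding \<psi>_def[abs_def] by (rule iso_mod0_measure_preserving[OF i b])
  then have \<psi>: "\<psi> \<in> measurable M N" "distr M N \<psi> = N" by (simp_all add: measure_preserving_def)
  define \<Psi> where "\<Psi> z = (\<psi> (fst z), snd z)" for z :: "'a \<times> (real ^ 'd)"
  have "distr M N \<psi> \<Otimes>\<^sub>M distr ?C ?C (\<lambda>r. r) = distr (M \<Otimes>\<^sub>M ?C) (N \<Otimes>\<^sub>M ?C) (\<lambda>(x, r). (\<psi> x, r))"
    by (rule pair_measure_distr[OF \<psi>(1)]) (simp_all add: distr_id2 C.sigma_finite_measure_axioms)
  then have mp: "measure_preserving ?QM ?QN \<Psi>"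
    using measurable_Pair[OF measurable_compose[OF measurable_fst \<psi>(1)] measurable_snd, of ?C]
    by (simp add: measure_preserving_def suspension_space_def \<Psi>_def[abs_def] \<psi>(2) distr_id2 case_prod_beta')
  have FL: "F \<in> L2 ?QN" using F(2) by (simp add: direction_eigenvalue_def)
  define F' where "F' z = F (\<Psi> z)" for z
  have F'L: "F' \<in> L2 ?QM" unfolding F'_def[abs_def] by (rule measure_preserving_L2[OF mp FL])
  have AE_A: "AE z in ?QM. fst z \<in> A"
    unfolding suspension_space_def
    by (rule AE_fst_in[OF _ _ C.finite_measure_axioms]) (use i in \<open>auto simp: iso_mod0_def\<close>)
  have "L2_inner ?QM F' h = 0" if h: "h \<in> fibre_functions" for h
  proof -
    obtain k where k: "h = (\<lambda>(x, s). k s)" "k \<in> L2 ?C" using h by (auto simp: fibre_functions_def)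
    have "(\<lambda>_. 1) \<in> L2 N" by (simp add: L2_def)
    from L2_times[OF N.finite_measure_axioms C.finite_measure_axioms this k(2)]
    have kN: "(\<lambda>z. k (snd z)) \<in> L2 ?QN" by (simp add: suspension_space_def)
    have "(\<lambda>z :: 'b \<times> (real ^ 'd). k (snd z)) \<in> fibre_functions"
      using k(2) by (auto simp: fibre_functions_def case_prod_beta')
    then have "L2_inner ?QN F (\<lambda>z. k (snd z)) = 0"
      using F(1) by (auto simp: L2_O_def L2_orth_def)
    moreover have "L2_inner ?QM F' h = L2_inner ?QM (\<lambda>z. F (\<Psi> z)) (\<lambda>z. k (snd (\<Psi> z)))"
      by (simp add: F'_def[abs_def] k(1) \<Psi>_def case_prod_beta')
    ultimately show ?thesis
      using measure_preserving_L2_inner[OF mp FL kN] by simp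
  qed
  then have "F' \<in> L2_O M" using F'L by (simp add: L2_O_def L2_orth_def)
  moreover have "\<not> (AE z in ?QM. F' z = 0)"
    using L2_norm_eq_0_iff[OF F'L] L2_norm_eq_0_iff[OF FL] F(2)
      measure_preserving_L2_norm[OF mp L2_D(1)[OF FL]]
    by (simp add: direction_eigenvalue_def F'_def[abs_def])
  moreover have "AE z in ?QM. F' (suspension T t z) = cis (2 * pi * (l \<bullet> t)) * F' z" if t: "t \<in> L" for t
  proof -
    have "AE y in ?QN. F (suspension S t y) = cis (2 * pi * (l \<bullet> t)) * F y"
      using F(2) t by (simp add: direction_eigenvalue_def)
    from measure_preserving_AE[OF mp this] AE_A show ?thesis
    proof eventually_elim
      case (elim z)
      then have "\<Psi> (suspension T t z) = suspension S t (\<Psi> z)"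
        using T eq by (simp add: \<Psi>_def \<psi>_def suspension_eq split_beta)
      with elim show ?case by (simp add: F'_def)
    qed
  qed
  ultimately show ?thesis using F'L by (auto simp: direction_eigenvalue_def)
qed

theorem corollary4p12:
  fixes M :: "'a measure" and N :: "'b measure"
    and T :: "int ^ 'd \<Rightarrow> 'a \<Rightarrow> 'a" and S :: "int ^ 'd \<Rightarrow> 'b \<Rightarrow> 'b"
  assumes "lebesgue_prob_space M" and "free_mp_action M T"
    and "lebesgue_prob_space N" and "free_mp_action N S"
  shows "(\<forall>\<sigma> \<tau>. reduced_spectral_measure M T \<sigma> \<longrightarrow> reduced_spectral_measure N S \<tau> \<longrightarrow>
            equivalent_measures \<sigma> \<tau> \<longrightarrow>
            ergodic_directions M T = ergodic_directions N S \<and>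
            weak_mixing_directions M T = weak_mixing_directions N S) \<and>
         (metrically_isomorphic M T N S \<longrightarrow>
            ergodic_directions M T = ergodic_directions N S \<and>
            weak_mixing_directions M T = weak_mixing_directions N S)"
proof -
  have M: "prob_space M" "mp_action M T" and N: "prob_space N" "mp_action N S"
    using assms by (auto simp: lebesgue_prob_space_def free_mp_action_def)
  have spectral: "ergodic_directions M T = ergodic_directions N S \<and>
      weak_mixing_directions M T = weak_mixing_directions N S"
    if "reduced_spectral_measure M T \<sigma>" "reduced_spectral_measure N S \<tau>" "equivalent_measures \<sigma> \<tau>" for \<sigma> \<tau>
    using that reduced_spectral_measure_transfer[OF M N that(1,2)] reduced_spectral_measure_transfer[OF N M that(2,1)]
    unfolding equivalent_measures_def by (intro directions_eqI) blast
  have isomorphic: "ergodic_directions M T = ergodic_directions N S \<and>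
      weak_mixing_directions M T = weak_mixing_directions N S"
    if "metrically_isomorphic M T N S"
    using isomorphic_transfer[OF M(1) N(1) that] isomorphic_transfer[OF N(1) M(1) metrically_isomorphic_sym[OF that]]
    by (intro directions_eqI) blast
  from spectral isomorphic show ?thesis by blast
qed

end
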